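(* Let $A$ be a Green biset functor (for $\mathcal{D}$ over $k$) and let $G$ be an object of $\mathcal{D}$. Then the morphisms $$Inf_H=A(Inf_H^{H\times G}):A(H)\longrightarrow A(H\times G)=A_G(H),$$ for $H$ in $Ob(\mathcal{P}_A)=Ob(\mathcal{D})$, define a morphism of Green biset functors $Inf:A\longrightarrow A_G$.
   Context: Conventions. $k$ is a commutative ring; all groups are finite; rings and algebras are associative and unital. Bisets. For groups $H,G$, an $(H,G)$-biset is a finite set with commuting left $H$-action and right $G$-action. $B(H,G)$ is the Grothendieck group of the category of $(H,G)$-bisets with respect to disjoint union. If $Y$ is a $(K,H)$-biset and $X$ an $(H,G)$-biset, $Y\circ X=Y\times_H X$ is the set of $H$-orbits of $Y\times X$ under $h\cdot(y,x)=(yh^{-1},hx)$, a $(K,G)$-biset. The biset category $\mathcal{C}$ has all finite groups as objects, $\mathcal{C}(G,H)=B(H,G)$, composition induced by $\circ$, and identity $Id_G=[G]$. $\mathcal{D}$ is a full subcategory of $\mathcal{C}$ such that any group isomorphic to a subquotient of an object of $\mathcal{D}$ or to a product of two objects of $\mathcal{D}$ is an object of $\mathcal{D}$; $k\mathcal{D}$ is its $k$-linearization. A biset functor is a $k$-linear functor $k\mathcal{D}\to k\text{-Mod}$; morphisms are natural transformations. For an isomorphism $\psi:H\to G$, $Iso(\psi)$ is the $(G,H)$-biset $G$ with $g\cdot x\cdot h=gx\psi(h)$. The inflation $Inf_H^{H\times G}$ is the $(H\times G,H)$-biset $H$ with $(h,g)\cdot x\cdot h'=hxh'$. The external product of an $(L,K)$-biset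 $Y$ and an $(H,G)$-biset $X$ is the $(L\times H,K\times G)$-biset $Y\times X$ with $(l,h)(y,x)(k,g)=(lyk,hxg)$, extended bilinearly to $(\alpha,\beta)\mapsto\alpha\times\beta$. Green biset functors. A Green biset functor is a biset functor $A$ with bilinear products $A(K)\times A(H)\to A(K\times H)$, $(a,b)\mapsto a\times b$, for all objects $K,H$, and an element $\epsilon_A\in A(1)$, such that: (1) $(a\times b)\times c=A(Iso(\alpha_{L,K,H}))(a\times(b\times c))$ for $a\in A(L)$, $b\in A(K)$, $c\in A(H)$, with $\alpha_{L,K,H}:L\times(K\times H)\to(L\times K)\times H$ the canonical isomorphism; (2) $A(Iso(\lambda_H))(\epsilon_A\times a)=a=A(Iso(\rho_H))(a\times\epsilon_A)$ for $a\in A(H)$, with $\lambda_H:1\times H\to H$ and $\rho_H:H\times 1\to H$ canonical; (3) $A(\alpha\times\beta)(a\times b)=A(\alpha)(a)\times A(\beta)(b)$ for all morphisms $\alpha:K\to T$, $\beta:H\to L$ of $k\mathcal{D}$ and $a\in A(K)$, $b\in A(H)$. A morphism of Green biset functors $f:A\to C$ is a morphism of biset functors with $f_{K\times H}(a\times b)=f_K(a)\times f_H(b)$ for all $a\in A(K)$, $b\in A(H)$ and $f_1(\epsilon_A)=\epsilon_C$. Associated category. $\mathcal{P}_A$ denotes the category associated with $A$; its objects are those of $\mathcal{D}$. Shifted functor. $A_G$ is the biset functor with $A_G(H)=A(H\times G)$ and $A_G(\alpha)=A(\alpha\times Id_G)$. It is a Green biset functor with products $\times^d:A_G(K)\times A_G(H)\to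 A_G(K\times H)$ given by $a\times^d b=A(U_{K,H})(a\times b)$ for $a\in A(K\times G)$, $b\in A(H\times G)$, where $U_{K,H}$ is the $(K\times H\times G,\,K\times G\times H\times G)$-biset $K\times G\times H\times G$ with right action by multiplication and left action $(k,h,g)\cdot(k',g_1,h',g_2)=(kk',gg_1,hh',gg_2)$, and identity element $\epsilon_{A_G}=A(Inf_1^{1\times G})(\epsilon_A)$. *)

theory Defs
  imports "HOL-Algebra.IntRing" "HOL-Algebra.Module"
begin

section \<open>Modules given by generators and relations\<close>

definition linear_maps ::
  "('k, 'r) ring_scheme \<Rightarrow> ('k, 'm, 'p) module_scheme \<Rightarrow> ('k, 'n, 'q) module_scheme \<Rightarrow> ('m \<Rightarrow> 'n) set"
  where "linear_maps R M N =
    {f \<in> carrier M \<rightarrow> carrier N.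
       (\<forall>x\<in>carrier M. \<forall>y\<in>carrier M. f (x \<oplus>\<^bsub>M\<^esub> y) = f x \<oplus>\<^bsub>N\<^esub> f y) \<and>
       (\<forall>r\<in>carrier R. \<forall>x\<in>carrier M. f (r \<odot>\<^bsub>M\<^esub> x) = r \<odot>\<^bsub>N\<^esub> f x)}"

definition bilinear_maps ::
  "('k, 'r) ring_scheme \<Rightarrow> ('k, 'l, 'o) module_scheme \<Rightarrow> ('k, 'm, 'p) module_scheme \<Rightarrow>
   ('k, 'n, 'q) module_scheme \<Rightarrow> ('l \<Rightarrow> 'm \<Rightarrow> 'n) set"
  where "bilinear_maps R L M N =
    {f. (\<forall>x\<in>carrier L. f x \<in> linear_maps R M N) \<and>
        (\<forall>y\<in>carrier M. (\<lambda>x. f x y) \<in> linear_maps R L N)}"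

text \<open>The free module on a set \<open>S\<close>: finitely supported functions on \<open>S\<close>, extended by zero.
  The ring multiplication and unit inherited by the module record play no role.\<close>

definition free_mod :: "('k, 'r) ring_scheme \<Rightarrow> 's set \<Rightarrow> ('k, 's \<Rightarrow> 'k) module"
  where "free_mod R S =
    \<lparr>carrier = {u. (\<forall>s\<in>S. u s \<in> carrier R) \<and> (\<forall>s. s \<notin> S \<longrightarrow> u s = \<zero>\<^bsub>R\<^esub>) \<and>
                   finite {s. u s \<noteq> \<zero>\<^bsub>R\<^esub>}},
     monoid.mult = undefined, one = undefined,
     zero = (\<lambda>_. \<zero>\<^bsub>R\<^esub>), add = (\<lambda>u v s. u s \<oplus>\<^bsub>R\<^esub> v s), smult = (\<lambda>r u s. r \<otimes>\<^bsub>R\<^esub> u s)\<rparr>"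

definition gen :: "('k, 'r) ring_scheme \<Rightarrow> 's \<Rightarrow> 's \<Rightarrow> 'k"
  where "gen R s = (\<lambda>t. if t = s then \<one>\<^bsub>R\<^esub> else \<zero>\<^bsub>R\<^esub>)"

definition rel_span :: "('k, 'r) ring_scheme \<Rightarrow> 's set \<Rightarrow> ('s \<Rightarrow> 'k) set \<Rightarrow> ('s \<Rightarrow> 'k) set"
  where "rel_span R S E = \<Inter>{N. submodule N R (free_mod R S) \<and> E \<subseteq> N}"

text \<open>The class of \<open>u\<close> in the quotient of the free module on \<open>S\<close> by the relators \<open>E\<close>, and that
  quotient itself.\<close>

definition pres_class ::
  "('k, 'r) ring_scheme \<Rightarrow> 's set \<Rightarrow> ('s \<Rightarrow> 'k) set \<Rightarrow> ('s \<Rightarrow> 'k) \<Rightarrow> ('s \<Rightarrow> 'k) set"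
  where "pres_class R S E u = rel_span R S E +>\<^bsub>free_mod R S\<^esub> u"

definition pres_mod ::
  "('k, 'r) ring_scheme \<Rightarrow> 's set \<Rightarrow> ('s \<Rightarrow> 'k) set \<Rightarrow> ('k, ('s \<Rightarrow> 'k) set) module"
  where "pres_mod R S E =
    \<lparr>carrier = pres_class R S E ` carrier (free_mod R S),
     monoid.mult = undefined, one = undefined,
     zero = rel_span R S E,
     add = (\<lambda>c d. c <+>\<^bsub>free_mod R S\<^esub> d),
     smult = (\<lambda>r c. \<Union>u\<in>c. pres_class R S E (r \<odot>\<^bsub>free_mod R S\<^esub> u))\<rparr>"

text \<open>Bilinear extension of an operation \<open>f\<close> on generators to classes of formal combinations of
  generators; \<open>S\<close> and \<open>E\<close> present the target. The union over representatives is a single class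
  whenever \<open>f\<close> is compatible with the relations.\<close>

definition bilinear_ext ::
  "('k, 'r) ring_scheme \<Rightarrow> 'u set \<Rightarrow> ('u \<Rightarrow> 'k) set \<Rightarrow> ('s \<Rightarrow> 't \<Rightarrow> 'u) \<Rightarrow>
   ('s \<Rightarrow> 'k) set \<Rightarrow> ('t \<Rightarrow> 'k) set \<Rightarrow> ('u \<Rightarrow> 'k) set"
  where "bilinear_ext R S E f c d =
    (\<Union>u\<in>c. \<Union>v\<in>d. pres_class R S E
       (\<Oplus>\<^bsub>free_mod R S\<^esub> s \<in> {s. u s \<noteq> \<zero>\<^bsub>R\<^esub>}. \<Oplus>\<^bsub>free_mod R S\<^esub> t \<in> {t. v t \<noteq> \<zero>\<^bsub>R\<^esub>}.
          (u s \<otimes>\<^bsub>R\<^esub> v t) \<odot>\<^bsub>free_mod R S\<^esub> gen R (f s t)))"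


section \<open>Finite groups\<close>

text \<open>A universe of elements closed under pairing, so that a direct product of two objects is again
  an object. It is infinite, so every finite group is isomorphic to one with carrier in it.\<close>

datatype 'a univ = Point | Atom 'a | Pr (pfst: "'a univ") (psnd: "'a univ")

type_synonym 'a grp = "'a univ monoid"

definition triv :: "'a grp"
  where "triv = \<lparr>carrier = {Point}, monoid.mult = (\<lambda>_ _. Point), one = Point\<rparr>"

definition gprod :: "'a grp \<Rightarrow> 'a grp \<Rightarrow> 'a grp" (infixr \<open>\<boxtimes>\<close> 70)
  where "K \<boxtimes> H =
    \<lparr>carrier = {Pr k h | k h. k \<in> carrier K \<and> h \<in> carrier H},
     monoid.mult = (\<lambda>x y. Pr (pfst x \<otimes>\<^bsub>K\<^esub> pfst y) (psnd x \<otimes>\<^bsub>H\<^esub> psnd y)),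
     one = Pr \<one>\<^bsub>K\<^esub> \<one>\<^bsub>H\<^esub>\<rparr>"

text \<open>The objects of \<open>\<D>\<close>. A subquotient of \<open>G\<close> is \<open>S/N\<close> with \<open>S\<close> a subgroup of \<open>G\<close> and \<open>N\<close>
  normal in \<open>S\<close>.\<close>

definition admissible :: "'a grp set \<Rightarrow> bool"
  where "admissible D \<longleftrightarrow>
    (\<forall>G\<in>D. group G \<and> finite (carrier G)) \<and>
    (\<forall>G\<in>D. \<forall>S N H. subgroup S G \<and> N \<lhd> (G\<lparr>carrier := S\<rparr>) \<and> group H \<and>
        H \<cong> (G\<lparr>carrier := S\<rparr> Mod N) \<longrightarrow> H \<in> D) \<and>
    (\<forall>K\<in>D. \<forall>H\<in>D. \<forall>L. group L \<and> L \<cong> K \<times>\<times> H \<longrightarrow> L \<in> D)"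


section \<open>Bisets\<close>

record ('a, 'x) biset =
  pts :: "'x set"
  lact :: "'a univ \<Rightarrow> 'x \<Rightarrow> 'x"
  ract :: "'x \<Rightarrow> 'a univ \<Rightarrow> 'x"

definition is_biset :: "'a grp \<Rightarrow> 'a grp \<Rightarrow> ('a, 'x) biset \<Rightarrow> bool"
  where "is_biset H G X \<longleftrightarrow> finite (pts X) \<and>
    (\<forall>h\<in>carrier H. \<forall>x\<in>pts X. lact X h x \<in> pts X) \<and>
    (\<forall>x\<in>pts X. \<forall>g\<in>carrier G. ract X x g \<in> pts X) \<and>
    (\<forall>x\<in>pts X. lact X \<one>\<^bsub>H\<^esub> x = x \<and> ract X x \<one>\<^bsub>G\<^esub> = x) \<and>
    (\<forall>h\<in>carrier H. \<forall>h'\<in>carrier H. \<forall>x\<in>pts X. lact X (h \<otimes>\<^bsub>H\<^esub> h') x = lact X h (lact X h' x)) \<and>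
    (\<forall>x\<in>pts X. \<forall>g\<in>carrier G. \<forall>g'\<in>carrier G. ract X x (g \<otimes>\<^bsub>G\<^esub> g') = ract X (ract X x g) g') \<and>
    (\<forall>h\<in>carrier H. \<forall>x\<in>pts X. \<forall>g\<in>carrier G. ract X (lact X h x) g = lact X h (ract X x g))"

definition biset_iso :: "'a grp \<Rightarrow> 'a grp \<Rightarrow> ('a, 'x) biset \<Rightarrow> ('a, 'y) biset \<Rightarrow> bool"
  where "biset_iso H G X Y \<longleftrightarrow> (\<exists>f. bij_betw f (pts X) (pts Y) \<and>
    (\<forall>h\<in>carrier H. \<forall>x\<in>pts X. f (lact X h x) = lact Y h (f x)) \<and>
    (\<forall>x\<in>pts X. \<forall>g\<in>carrier G. f (ract X x g) = ract Y (f x) g))"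

definition biset_sum :: "('a, 'x) biset \<Rightarrow> ('a, 'y) biset \<Rightarrow> ('a, 'x + 'y) biset"
  where "biset_sum X Y =
    \<lparr>pts = pts X <+> pts Y,
     lact = (\<lambda>h. map_sum (lact X h) (lact Y h)),
     ract = (\<lambda>z g. map_sum (\<lambda>x. ract X x g) (\<lambda>y. ract Y y g) z)\<rparr>"

text \<open>\<open>Y \<circ> X = Y \<times>\<^sub>H X\<close>: its points are the \<open>H\<close>-orbits of \<open>Y \<times> X\<close>.\<close>

definition biset_comp :: "'a grp \<Rightarrow> ('a, 'y) biset \<Rightarrow> ('a, 'x) biset \<Rightarrow> ('a, ('y \<times> 'x) set) biset"
  where "biset_comp H Y X =
    \<lparr>pts = {{(ract Y y (inv\<^bsub>H\<^esub> h), lact X h x) | h. h \<in> carrier H} | y x. y \<in> pts Y \<and> x \<in> pts X},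
     lact = (\<lambda>k. image (\<lambda>(y, x). (lact Y k y, x))),
     ract = (\<lambda>O' g. (\<lambda>(y, x). (y, ract X x g)) ` O')\<rparr>"

definition biset_ext :: "('a, 'y) biset \<Rightarrow> ('a, 'x) biset \<Rightarrow> ('a, 'y \<times> 'x) biset"
  where "biset_ext Y X =
    \<lparr>pts = pts Y \<times> pts X,
     lact = (\<lambda>p (y, x). (lact Y (pfst p) y, lact X (psnd p) x)),
     ract = (\<lambda>(y, x) p. (ract Y y (pfst p), ract X x (psnd p)))\<rparr>"

definition id_biset :: "'a grp \<Rightarrow> ('a, 'a univ) biset"
  where "id_biset G = \<lparr>pts = carrier G, lact = (\<lambda>g x. g \<otimes>\<^bsub>G\<^esub> x), ract = (\<lambda>x g. x \<otimes>\<^bsub>G\<^esub> g)\<rparr>"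

definition iso_biset :: "'a grp \<Rightarrow> ('a univ \<Rightarrow> 'a univ) \<Rightarrow> ('a, 'a univ) biset"
  where "iso_biset G \<psi> =
    \<lparr>pts = carrier G, lact = (\<lambda>g x. g \<otimes>\<^bsub>G\<^esub> x), ract = (\<lambda>x h. x \<otimes>\<^bsub>G\<^esub> \<psi> h)\<rparr>"

text \<open>The \<open>(H \<boxtimes> G, H)\<close>-biset \<open>Inf\<close>; it does not depend on \<open>G\<close>, because the second component of
  the left factor acts trivially.\<close>

definition inf_biset :: "'a grp \<Rightarrow> ('a, 'a univ) biset"
  where "inf_biset H =
    \<lparr>pts = carrier H, lact = (\<lambda>p x. pfst p \<otimes>\<^bsub>H\<^esub> x), ract = (\<lambda>x h. x \<otimes>\<^bsub>H\<^esub> h)\<rparr>"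

text \<open>The \<open>((K \<boxtimes> H) \<boxtimes> G, (K \<boxtimes> G) \<boxtimes> (H \<boxtimes> G))\<close>-biset \<open>U\<close>: the left action is left multiplication
  after embedding \<open>G\<close> diagonally.\<close>

definition diag_biset :: "'a grp \<Rightarrow> 'a grp \<Rightarrow> 'a grp \<Rightarrow> ('a, 'a univ) biset"
  where "diag_biset G K H =
    \<lparr>pts = carrier ((K \<boxtimes> G) \<boxtimes> (H \<boxtimes> G)),
     lact = (\<lambda>p x. Pr (Pr (pfst (pfst p)) (psnd p)) (Pr (psnd (pfst p)) (psnd p))
                    \<otimes>\<^bsub>(K \<boxtimes> G) \<boxtimes> (H \<boxtimes> G)\<^esub> x),
     ract = (\<lambda>x q. x \<otimes>\<^bsub>(K \<boxtimes> G) \<boxtimes> (H \<boxtimes> G)\<^esub> q)\<rparr>"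


section \<open>The biset category and its linearization\<close>

text \<open>Isomorphism classes of finite bisets are recorded by their members with points in \<open>nat\<close>;
  the class of a biset with points in any other type is available through \<open>iso_class\<close>.\<close>

type_synonym 'a bclass = "('a, nat) biset set"

definition iso_class :: "'a grp \<Rightarrow> 'a grp \<Rightarrow> ('a, 'x) biset \<Rightarrow> 'a bclass"
  where "iso_class H G X = {Z. is_biset H G Z \<and> biset_iso H G Z X}"

definition iso_classes :: "'a grp \<Rightarrow> 'a grp \<Rightarrow> 'a bclass set"
  where "iso_classes H G = {iso_class H G X | X :: ('a, nat) biset. is_biset H G X}"

definition class_comp :: "'a grp \<Rightarrow> 'a grp \<Rightarrow> 'a grp \<Rightarrow> 'a bclass \<Rightarrow> 'a bclass \<Rightarrow> 'a bclass"
  where "class_comp K H G c d = (\<Union>Y\<in>c. \<Union>X\<in>d. iso_class K G (biset_comp H Y X))"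

definition class_ext ::
  "'a grp \<Rightarrow> 'a grp \<Rightarrow> 'a grp \<Rightarrow> 'a grp \<Rightarrow> 'a bclass \<Rightarrow> 'a bclass \<Rightarrow> 'a bclass"
  where "class_ext L K H G c d = (\<Union>Y\<in>c. \<Union>X\<in>d. iso_class (L \<boxtimes> H) (K \<boxtimes> G) (biset_ext Y X))"

text \<open>\<open>B(H,G)\<close> is the Grothendieck group for disjoint union: the free abelian group (that is, free
  \<open>\<int>\<close>-module) on the isomorphism classes, modulo \<open>[X \<squnion> Y] - [X] - [Y]\<close>.\<close>

type_synonym 'a burn = "('a bclass \<Rightarrow> int) set"

definition burnside_rels :: "'a grp \<Rightarrow> 'a grp \<Rightarrow> ('a bclass \<Rightarrow> int) set"
  where "burnside_rels H G =
    {gen \<Z> (iso_class H G (biset_sum X Y))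
       \<ominus>\<^bsub>free_mod \<Z> (iso_classes H G)\<^esub> gen \<Z> (iso_class H G X)
       \<ominus>\<^bsub>free_mod \<Z> (iso_classes H G)\<^esub> gen \<Z> (iso_class H G Y)
     | (X :: ('a, nat) biset) (Y :: ('a, nat) biset). is_biset H G X \<and> is_biset H G Y}"

definition burnside :: "'a grp \<Rightarrow> 'a grp \<Rightarrow> (int, 'a burn) module"
  where "burnside H G = pres_mod \<Z> (iso_classes H G) (burnside_rels H G)"

definition burn_class :: "'a grp \<Rightarrow> 'a grp \<Rightarrow> ('a, 'x) biset \<Rightarrow> 'a burn"
  where "burn_class H G X =
    pres_class \<Z> (iso_classes H G) (burnside_rels H G) (gen \<Z> (iso_class H G X))"

definition burn_comp :: "'a grp \<Rightarrow> 'a grp \<Rightarrow> 'a grp \<Rightarrow> 'a burn \<Rightarrow> 'a burn \<Rightarrow> 'a burn"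
  where "burn_comp K H G =
    bilinear_ext \<Z> (iso_classes K G) (burnside_rels K G) (class_comp K H G)"

definition burn_ext :: "'a grp \<Rightarrow> 'a grp \<Rightarrow> 'a grp \<Rightarrow> 'a grp \<Rightarrow> 'a burn \<Rightarrow> 'a burn \<Rightarrow> 'a burn"
  where "burn_ext L K H G =
    bilinear_ext \<Z> (iso_classes (L \<boxtimes> H) (K \<boxtimes> G)) (burnside_rels (L \<boxtimes> H) (K \<boxtimes> G)) (class_ext L K H G)"

text \<open>\<open>k\<B>(H,G) = k \<otimes>\<^sub>\<int> B(H,G)\<close>, presented by the generators \<open>1 \<otimes> b\<close> with the relations
  \<open>1 \<otimes> (b + b') = 1 \<otimes> b + 1 \<otimes> b'\<close>. It is the module of morphisms from \<open>G\<close> to \<open>H\<close> in the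
  linearized category.\<close>

type_synonym ('a, 'k) kburn = "('a burn \<Rightarrow> 'k) set"

definition kburnside_rels :: "('k, 'r) ring_scheme \<Rightarrow> 'a grp \<Rightarrow> 'a grp \<Rightarrow> ('a burn \<Rightarrow> 'k) set"
  where "kburnside_rels R H G =
    {gen R (b \<oplus>\<^bsub>burnside H G\<^esub> b')
       \<ominus>\<^bsub>free_mod R (carrier (burnside H G))\<^esub> gen R b
       \<ominus>\<^bsub>free_mod R (carrier (burnside H G))\<^esub> gen R b'
     | b b'. b \<in> carrier (burnside H G) \<and> b' \<in> carrier (burnside H G)}"

definition kburnside :: "('k, 'r) ring_scheme \<Rightarrow> 'a grp \<Rightarrow> 'a grp \<Rightarrow> ('k, ('a, 'k) kburn) module"
  where "kburnside R H G = pres_mod R (carrier (burnside H G)) (kburnside_rels R H G)"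

definition kclass :: "('k, 'r) ring_scheme \<Rightarrow> 'a grp \<Rightarrow> 'a grp \<Rightarrow> ('a, 'x) biset \<Rightarrow> ('a, 'k) kburn"
  where "kclass R H G X =
    pres_class R (carrier (burnside H G)) (kburnside_rels R H G) (gen R (burn_class H G X))"

definition kcomp ::
  "('k, 'r) ring_scheme \<Rightarrow> 'a grp \<Rightarrow> 'a grp \<Rightarrow> 'a grp \<Rightarrow>
   ('a, 'k) kburn \<Rightarrow> ('a, 'k) kburn \<Rightarrow> ('a, 'k) kburn"
  where "kcomp R K H G =
    bilinear_ext R (carrier (burnside K G)) (kburnside_rels R K G) (burn_comp K H G)"

definition kext ::
  "('k, 'r) ring_scheme \<Rightarrow> 'a grp \<Rightarrow> 'a grp \<Rightarrow> 'a grp \<Rightarrow> 'a grp \<Rightarrow>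
   ('a, 'k) kburn \<Rightarrow> ('a, 'k) kburn \<Rightarrow> ('a, 'k) kburn"
  where "kext R L K H G =
    bilinear_ext R (carrier (burnside (L \<boxtimes> H) (K \<boxtimes> G))) (kburnside_rels R (L \<boxtimes> H) (K \<boxtimes> G))
      (burn_ext L K H G)"


section \<open>Biset functors\<close>

text \<open>\<open>fmor A H K\<close> is the action of \<open>A\<close> on morphisms from \<open>H\<close> to \<open>K\<close>, i.e. on \<open>k\<B>(K,H)\<close>.\<close>

record ('a, 'k, 'm) biset_functor_data =
  fobj :: "'a grp \<Rightarrow> ('k, 'm) module"
  fmor :: "'a grp \<Rightarrow> 'a grp \<Rightarrow> ('a, 'k) kburn \<Rightarrow> 'm \<Rightarrow> 'm"

locale biset_functor = cring R
  for R :: "'k ring" (structure) and D :: "'a grp set"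
    and A :: "('a, 'k, 'm, 'z) biset_functor_data_scheme" +
  assumes objects: "admissible D"
    and fobj_module: "H \<in> D \<Longrightarrow> module R (fobj A H)"
    and fmor_bilinear: "\<lbrakk>H \<in> D; K \<in> D\<rbrakk> \<Longrightarrow>
      fmor A H K \<in> bilinear_maps R (kburnside R K H) (fobj A H) (fobj A K)"
    and fmor_id: "\<lbrakk>H \<in> D; a \<in> carrier (fobj A H)\<rbrakk> \<Longrightarrow>
      fmor A H H (kclass R H H (id_biset H)) a = a"
    and fmor_comp: "\<lbrakk>G \<in> D; H \<in> D; K \<in> D; \<beta> \<in> carrier (kburnside R K H);
        \<alpha> \<in> carrier (kburnside R H G); a \<in> carrier (fobj A G)\<rbrakk> \<Longrightarrow>
      fmor A G K (kcomp R K H G \<beta> \<alpha>) a = fmor A H K \<beta> (fmor A G H \<alpha> a)"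

locale biset_functor_morphism = source: biset_functor R D A + target: biset_functor R D C
  for R :: "'k ring" (structure) and D :: "'a grp set"
    and A :: "('a, 'k, 'm, 'y) biset_functor_data_scheme"
    and C :: "('a, 'k, 'n, 'z) biset_functor_data_scheme"
    and f :: "'a grp \<Rightarrow> 'm \<Rightarrow> 'n" +
  assumes component_linear: "H \<in> D \<Longrightarrow> f H \<in> linear_maps R (fobj A H) (fobj C H)"
    and natural: "\<lbrakk>H \<in> D; K \<in> D; \<alpha> \<in> carrier (kburnside R K H); a \<in> carrier (fobj A H)\<rbrakk> \<Longrightarrow>
      f K (fmor A H K \<alpha> a) = fmor C H K \<alpha> (f H a)"


section \<open>Green biset functors\<close>

record ('a, 'k, 'm) green_data = "('a, 'k, 'm) biset_functor_data" +
  ext_prod :: "'a grp \<Rightarrow> 'a grp \<Rightarrow> 'm \<Rightarrow> 'm \<Rightarrow> 'm"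
  unit_elt :: "'m"

text \<open>The canonical isomorphism from \<open>L \<boxtimes> (K \<boxtimes> H)\<close> to \<open>(L \<boxtimes> K) \<boxtimes> H\<close>; the unit isomorphisms
  are \<open>psnd\<close> and \<open>pfst\<close>.\<close>

definition assoc_map :: "'a univ \<Rightarrow> 'a univ"
  where "assoc_map x = Pr (Pr (pfst x) (pfst (psnd x))) (psnd (psnd x))"

locale green_biset_functor = biset_functor R D A
  for R :: "'k ring" (structure) and D :: "'a grp set"
    and A :: "('a, 'k, 'm, 'z) green_data_scheme" +
  assumes ext_prod_bilinear: "\<lbrakk>K \<in> D; H \<in> D\<rbrakk> \<Longrightarrow>
      ext_prod A K H \<in> bilinear_maps R (fobj A K) (fobj A H) (fobj A (K \<boxtimes> H))"
    and unit_closed: "unit_elt A \<in> carrier (fobj A triv)"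
    and ext_prod_assoc: "\<lbrakk>L \<in> D; K \<in> D; H \<in> D;
        a \<in> carrier (fobj A L); b \<in> carrier (fobj A K); c \<in> carrier (fobj A H)\<rbrakk> \<Longrightarrow>
      ext_prod A (L \<boxtimes> K) H (ext_prod A L K a b) c =
        fmor A (L \<boxtimes> (K \<boxtimes> H)) ((L \<boxtimes> K) \<boxtimes> H)
          (kclass R ((L \<boxtimes> K) \<boxtimes> H) (L \<boxtimes> (K \<boxtimes> H)) (iso_biset ((L \<boxtimes> K) \<boxtimes> H) assoc_map))
          (ext_prod A L (K \<boxtimes> H) a (ext_prod A K H b c))"
    and ext_prod_unit_left: "\<lbrakk>H \<in> D; a \<in> carrier (fobj A H)\<rbrakk> \<Longrightarrow>
      fmor A (triv \<boxtimes> H) H (kclass R H (triv \<boxtimes> H) (iso_biset H psnd))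
        (ext_prod A triv H (unit_elt A) a) = a"
    and ext_prod_unit_right: "\<lbrakk>H \<in> D; a \<in> carrier (fobj A H)\<rbrakk> \<Longrightarrow>
      fmor A (H \<boxtimes> triv) H (kclass R H (H \<boxtimes> triv) (iso_biset H pfst))
        (ext_prod A H triv a (unit_elt A)) = a"
    and ext_prod_functorial: "\<lbrakk>K \<in> D; T \<in> D; H \<in> D; L \<in> D;
        \<alpha> \<in> carrier (kburnside R T K); \<beta> \<in> carrier (kburnside R L H);
        a \<in> carrier (fobj A K); b \<in> carrier (fobj A H)\<rbrakk> \<Longrightarrow>
      fmor A (K \<boxtimes> H) (T \<boxtimes> L) (kext R T K L H \<alpha> \<beta>) (ext_prod A K H a b) =
        ext_prod A T L (fmor A K T \<alpha> a) (fmor A H L \<beta> b)"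

locale green_biset_functor_morphism =
  source: green_biset_functor R D A + target: green_biset_functor R D C +
  biset_functor_morphism R D A C f
  for R :: "'k ring" (structure) and D :: "'a grp set"
    and A :: "('a, 'k, 'm, 'y) green_data_scheme"
    and C :: "('a, 'k, 'n, 'z) green_data_scheme"
    and f :: "'a grp \<Rightarrow> 'm \<Rightarrow> 'n" +
  assumes preserves_ext_prod: "\<lbrakk>K \<in> D; H \<in> D; a \<in> carrier (fobj A K); b \<in> carrier (fobj A H)\<rbrakk> \<Longrightarrow>
      f (K \<boxtimes> H) (ext_prod A K H a b) = ext_prod C K H (f K a) (f H b)"
    and preserves_unit: "f triv (unit_elt A) = unit_elt C"

definition shift ::
  "'k ring \<Rightarrow> ('a, 'k, 'm) green_data \<Rightarrow> 'a grp \<Rightarrow> ('a, 'k, 'm) green_data"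
  where "shift R A G =
    \<lparr>fobj = (\<lambda>H. fobj A (H \<boxtimes> G)),
     fmor = (\<lambda>H K \<alpha>. fmor A (H \<boxtimes> G) (K \<boxtimes> G) (kext R K H G G \<alpha> (kclass R G G (id_biset G)))),
     ext_prod = (\<lambda>K H a b.
       fmor A ((K \<boxtimes> G) \<boxtimes> (H \<boxtimes> G)) ((K \<boxtimes> H) \<boxtimes> G)
         (kclass R ((K \<boxtimes> H) \<boxtimes> G) ((K \<boxtimes> G) \<boxtimes> (H \<boxtimes> G)) (diag_biset G K H))
         (ext_prod A (K \<boxtimes> G) (H \<boxtimes> G) a b)),
     unit_elt =
       fmor A triv (triv \<boxtimes> G) (kclass R (triv \<boxtimes> G) triv (inf_biset triv)) (unit_elt A)\<rparr>"

end

theory Submission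
  imports Defs
begin

text \<open>
  Inflation from \<open>H\<close> to \<open>H \<boxtimes> G\<close> is restriction along the projection \<open>H \<boxtimes> G \<rightarrow> H\<close>. In the same way,
  the identity bisets, the bisets of isomorphisms and the diagonal bisets in the product of \<open>A\<^sub>G\<close> are,
  up to isomorphism, regular bisets whose left action is restricted along a homomorphism: the identity, the inverse
  isomorphism, and \<open>((k, h), g) \<mapsto> ((k, g), (h, g))\<close>. Composition of such bisets is composition of the
  homomorphisms in the opposite order, and their external product is the product of the homomorphisms
  (\<open>kres_kcomp\<close>, \<open>kext_kres\<close>). Writing \<open>\<delta>\<^sup>*\<close> for the action of \<open>A\<close> on restriction along \<open>\<delta>\<close>, this gives
  \<open>\<delta>'\<^sup>* \<delta>\<^sup>* = (\<delta> \<circ> \<delta>')\<^sup>*\<close> and \<open>\<delta>\<^sup>* a \<times> \<delta>'\<^sup>* b = (\<delta> \<times> \<delta>')\<^sup>* (a \<times> b)\<close> (\<open>pull_pull\<close>, \<open>ext_prod_pull\<close>).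

  Associativity and the unit laws of \<open>A\<^sub>G\<close>, and the compatibility of inflation with products, follow from
  these two rules and the corresponding laws of \<open>A\<close>: each reduces to an equality of two homomorphisms
  given by permuting, duplicating and forgetting coordinates. For products, for instance, the projection
  \<open>(K \<boxtimes> H) \<boxtimes> G \<rightarrow> K \<boxtimes> H\<close> is the diagonal map followed by the projections of \<open>K \<boxtimes> G\<close> and \<open>H \<boxtimes> G\<close>.
  Inflation preserves the unit because the unit of \<open>A\<^sub>G\<close> is by definition the inflated one.

  The remaining claims quantify over all morphisms of the linearized biset category: functoriality of
  \<open>\<alpha> \<mapsto> \<alpha> \<times> Id\<close> (\<open>ext_id_kcomp\<close>), compatibility of the shifted product with \<open>\<alpha> \<times> \<beta>\<close> (\<open>ext_id_kext_diag\<close>)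
  and naturality of inflation (\<open>inf_natural_kcomp\<close>). Both sides are linear in each morphism and morphism
  modules are generated by classes of bisets (\<open>kburnside_linear_eq\<close>, \<open>kburnside_bilinear_eq\<close>), so these
  are isomorphisms of bisets: \<open>biset_ext_comp\<close>, \<open>biset_ext_diag_natural\<close> and \<open>biset_ext_inf_natural\<close>.

  For this reduction, composition and external product must be known to be well defined and
  bilinear on the modules of morphisms, which are presented in two stages: bisets modulo disjoint unions,
  then scalar extension. Both stages have relators of the form \<open>s\<^sub>0 - s\<^sub>1 - s\<^sub>2\<close>, and the locale
  \<open>bilinear_extension\<close> handles them uniformly.
\<close>

section \<open>Linear maps and free modules\<close>

lemma linear_mapsI:
  assumes "\<And>x. x \<in> carrier M \<Longrightarrow> f x \<in> carrier N"
    and "\<And>x y. x \<in> carrier M \<Longrightarrow> y \<in> carrier M \<Longrightarrow> f (x \<oplus>\<^bsub>M\<^esub> y) = f x \<oplus>\<^bsub>N\<^esub> f y"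
    and "\<And>r x. r \<in> carrier R \<Longrightarrow> x \<in> carrier M \<Longrightarrow> f (r \<odot>\<^bsub>M\<^esub> x) = r \<odot>\<^bsub>N\<^esub> f x"
  shows "f \<in> linear_maps R M N"
  using assms by (simp add: linear_maps_def)

lemma linear_mapsD:
  assumes "f \<in> linear_maps R M N"
  shows "x \<in> carrier M \<Longrightarrow> f x \<in> carrier N"
    and "x \<in> carrier M \<Longrightarrow> y \<in> carrier M \<Longrightarrow> f (x \<oplus>\<^bsub>M\<^esub> y) = f x \<oplus>\<^bsub>N\<^esub> f y"
    and "r \<in> carrier R \<Longrightarrow> x \<in> carrier M \<Longrightarrow> f (r \<odot>\<^bsub>M\<^esub> x) = r \<odot>\<^bsub>N\<^esub> f x"
  using assms by (auto simp: linear_maps_def)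

lemma linear_maps_comp:
  assumes "f \<in> linear_maps R M N" "g \<in> linear_maps R N P"
  shows "(\<lambda>x. g (f x)) \<in> linear_maps R M P"
  using linear_mapsD[OF assms(1)] linear_mapsD[OF assms(2)] by (intro linear_mapsI) simp_all

lemma bilinear_mapsD:
  assumes "f \<in> bilinear_maps R L M N"
  shows "x \<in> carrier L \<Longrightarrow> f x \<in> linear_maps R M N"
    and "y \<in> carrier M \<Longrightarrow> (\<lambda>x. f x y) \<in> linear_maps R L N"
    and "x \<in> carrier L \<Longrightarrow> y \<in> carrier M \<Longrightarrow> f x y \<in> carrier N"
  using assms linear_mapsD(1)[of "f x" R M N y] by (auto simp: bilinear_maps_def)

lemma linear_map_zero:
  assumes "module R M" "module R N" "f \<in> linear_maps R M N"
  shows "f \<zero>\<^bsub>M\<^esub> = \<zero>\<^bsub>N\<^esub>"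
proof -
  interpret M: module R M by fact
  interpret N: module R N by fact
  have "f \<zero>\<^bsub>M\<^esub> = f (\<zero>\<^bsub>R\<^esub> \<odot>\<^bsub>M\<^esub> \<zero>\<^bsub>M\<^esub>)"
    by simp
  also have "\<dots> = \<zero>\<^bsub>R\<^esub> \<odot>\<^bsub>N\<^esub> f \<zero>\<^bsub>M\<^esub>"
    by (rule linear_mapsD(3)[OF assms(3)]) auto
  finally show ?thesis
    using linear_mapsD(1)[OF assms(3), of "\<zero>\<^bsub>M\<^esub>"] by simp
qed

lemma linear_map_uminus:
  assumes "module R M" "module R N" "f \<in> linear_maps R M N" "x \<in> carrier M"
  shows "f (\<ominus>\<^bsub>M\<^esub> x) = \<ominus>\<^bsub>N\<^esub> f x"
proof -
  interpret M: module R M by fact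
  interpret N: module R N by fact
  have "f (\<ominus>\<^bsub>M\<^esub> x) = f ((\<ominus>\<^bsub>R\<^esub> \<one>\<^bsub>R\<^esub>) \<odot>\<^bsub>M\<^esub> x)"
    using assms(4) by (simp add: M.smult_l_minus)
  also have "\<dots> = (\<ominus>\<^bsub>R\<^esub> \<one>\<^bsub>R\<^esub>) \<odot>\<^bsub>N\<^esub> f x"
    using assms(4) by (intro linear_mapsD(3)[OF assms(3)]) auto
  finally show ?thesis
    using linear_mapsD(1)[OF assms(3,4)] by (simp add: N.smult_l_minus)
qed

lemma linear_map_minus:
  assumes "module R M" "module R N" "f \<in> linear_maps R M N" "x \<in> carrier M" "y \<in> carrier M"
  shows "f (x \<ominus>\<^bsub>M\<^esub> y) = f x \<ominus>\<^bsub>N\<^esub> f y"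
proof -
  interpret M: module R M by fact
  show ?thesis
    using linear_map_uminus[OF assms(1-3)] assms(4,5) linear_mapsD(2)[OF assms(3)]
    by (simp add: a_minus_def)
qed

lemma linear_maps_cong:
  assumes "module R M" "f \<in> linear_maps R M N" "\<And>x. x \<in> carrier M \<Longrightarrow> g x = f x"
  shows "g \<in> linear_maps R M N"
proof -
  interpret M: module R M by fact
  show ?thesis
    using linear_mapsD[OF assms(2)] assms(3) by (intro linear_mapsI) simp_all
qed

lemma submodule_preimage:
  assumes "module R M" "module R N" "f \<in> linear_maps R M N" "submodule K R N"
  shows "submodule {x \<in> carrier M. f x \<in> K} R M"
proof -
  interpret M: module R M by fact
  interpret N: module R N by fact
  note K = N.submoduleE[OF assms(4)]
  have "\<zero>\<^bsub>N\<^esub> \<in> K"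
    using subgroup.one_closed[OF submodule.axioms(1)[OF assms(4)]] by simp
  then show ?thesis
    using K linear_map_zero[OF assms(1-3)] linear_map_uminus[OF assms(1-3)] linear_mapsD[OF assms(3)]
    by (intro M.submoduleI) auto
qed

lemma submodule_equalizer:
  assumes "module R M" "module R N" "f \<in> linear_maps R M N" "g \<in> linear_maps R M N"
  shows "submodule {x \<in> carrier M. f x = g x} R M"
proof -
  interpret M: module R M by fact
  interpret N: module R N by fact
  show ?thesis
    using linear_map_zero[OF assms(1,2,3)] linear_map_uminus[OF assms(1,2,3)] linear_mapsD[OF assms(3)]
      linear_map_zero[OF assms(1,2,4)] linear_map_uminus[OF assms(1,2,4)] linear_mapsD[OF assms(4)]
    by (intro M.submoduleI) auto
qed

lemma linear_maps_finsum:
  assumes "module R M" "module R N" "finite A"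
    and "\<And>s. s \<in> A \<Longrightarrow> c s \<in> carrier R" "\<And>s. s \<in> A \<Longrightarrow> L s \<in> linear_maps R M N"
  shows "(\<lambda>v. \<Oplus>\<^bsub>N\<^esub>s\<in>A. c s \<odot>\<^bsub>N\<^esub> L s v) \<in> linear_maps R M N"
proof -
  interpret M: module R M by fact
  interpret N: module R N by fact
  have cl: "c s \<odot>\<^bsub>N\<^esub> L s v \<in> carrier N" if "s \<in> A" "v \<in> carrier M" for s v
    using assms that linear_mapsD(1) by (metis N.smult_closed)
  show ?thesis
  proof (rule linear_mapsI)
    fix x y assume xy: "x \<in> carrier M" "y \<in> carrier M"
    have "(\<Oplus>\<^bsub>N\<^esub>s\<in>A. c s \<odot>\<^bsub>N\<^esub> L s (x \<oplus>\<^bsub>M\<^esub> y)) =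
        (\<Oplus>\<^bsub>N\<^esub>s\<in>A. c s \<odot>\<^bsub>N\<^esub> L s x \<oplus>\<^bsub>N\<^esub> c s \<odot>\<^bsub>N\<^esub> L s y)"
      using assms(4) xy cl linear_mapsD[OF assms(5)]
      by (intro N.finsum_cong') (auto simp: N.smult_r_distr)
    also have "\<dots> = (\<Oplus>\<^bsub>N\<^esub>s\<in>A. c s \<odot>\<^bsub>N\<^esub> L s x) \<oplus>\<^bsub>N\<^esub> (\<Oplus>\<^bsub>N\<^esub>s\<in>A. c s \<odot>\<^bsub>N\<^esub> L s y)"
      using xy cl by (intro N.finsum_addf) auto
    finally show "(\<Oplus>\<^bsub>N\<^esub>s\<in>A. c s \<odot>\<^bsub>N\<^esub> L s (x \<oplus>\<^bsub>M\<^esub> y)) = \<dots>" .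
  next
    fix r x assume rx: "r \<in> carrier R" "x \<in> carrier M"
    have "c s \<odot>\<^bsub>N\<^esub> (r \<odot>\<^bsub>N\<^esub> L s x) = r \<odot>\<^bsub>N\<^esub> (c s \<odot>\<^bsub>N\<^esub> L s x)" if "s \<in> A" for s
      using assms(4)[OF that] rx linear_mapsD(1)[OF assms(5)[OF that]]
      by (simp flip: N.smult_assoc1 add: M.R.m_comm)
    then have "(\<Oplus>\<^bsub>N\<^esub>s\<in>A. c s \<odot>\<^bsub>N\<^esub> L s (r \<odot>\<^bsub>M\<^esub> x)) = (\<Oplus>\<^bsub>N\<^esub>s\<in>A. r \<odot>\<^bsub>N\<^esub> (c s \<odot>\<^bsub>N\<^esub> L s x))"
      using rx cl linear_mapsD[OF assms(5)] by (intro N.finsum_cong') auto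
    also have "\<dots> = r \<odot>\<^bsub>N\<^esub> (\<Oplus>\<^bsub>N\<^esub>s\<in>A. c s \<odot>\<^bsub>N\<^esub> L s x)"
      using rx cl assms(3) by (subst N.finsum_smult_ldistr) auto
    finally show "(\<Oplus>\<^bsub>N\<^esub>s\<in>A. c s \<odot>\<^bsub>N\<^esub> L s (r \<odot>\<^bsub>M\<^esub> x)) = \<dots>" .
  qed (use cl in auto)
qed

context cring
begin

lemma carrier_free_mod:
  "u \<in> carrier (free_mod R S) \<longleftrightarrow>
     (\<forall>s. u s \<in> carrier R) \<and> (\<forall>s. s \<notin> S \<longrightarrow> u s = \<zero>) \<and> finite {s. u s \<noteq> \<zero>}"
  by (auto simp: free_mod_def)

lemma free_mod_ops:
  "\<zero>\<^bsub>free_mod R S\<^esub> = (\<lambda>_. \<zero>)"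
  "u \<oplus>\<^bsub>free_mod R S\<^esub> v = (\<lambda>s. u s \<oplus> v s)"
  "r \<odot>\<^bsub>free_mod R S\<^esub> u = (\<lambda>s. r \<otimes> u s)"
  by (simp_all add: free_mod_def)

lemma free_mod_module: "module R (free_mod R S)"
proof (rule moduleI)
  have add: "u \<oplus>\<^bsub>free_mod R S\<^esub> v \<in> carrier (free_mod R S)"
    if "u \<in> carrier (free_mod R S)" "v \<in> carrier (free_mod R S)" for u v
  proof -
    have "{s. u s \<oplus> v s \<noteq> \<zero>} \<subseteq> {s. u s \<noteq> \<zero>} \<union> {s. v s \<noteq> \<zero>}"
      by auto
    then show ?thesis
      using that by (auto simp: carrier_free_mod free_mod_ops intro: finite_subset)
  qed
  show "abelian_group (free_mod R S)"
  proof (rule abelian_groupI)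
    fix u assume u: "u \<in> carrier (free_mod R S)"
    have "{s. \<ominus> u s \<noteq> \<zero>} \<subseteq> {s. u s \<noteq> \<zero>}"
      by auto
    then have "(\<lambda>s. \<ominus> u s) \<in> carrier (free_mod R S)"
      using u by (auto simp: carrier_free_mod intro: finite_subset)
    moreover have "(\<lambda>s. \<ominus> u s) \<oplus>\<^bsub>free_mod R S\<^esub> u = \<zero>\<^bsub>free_mod R S\<^esub>"
      using u by (auto simp: carrier_free_mod free_mod_ops l_neg)
    ultimately show "\<exists>v\<in>carrier (free_mod R S). v \<oplus>\<^bsub>free_mod R S\<^esub> u = \<zero>\<^bsub>free_mod R S\<^esub>"
      by blast
  qed (use add in \<open>auto simp: carrier_free_mod free_mod_ops a_ac\<close>)
  show "r \<odot>\<^bsub>free_mod R S\<^esub> u \<in> carrier (free_mod R S)"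
    if "r \<in> carrier R" "u \<in> carrier (free_mod R S)" for r u
  proof -
    have "{s. r \<otimes> u s \<noteq> \<zero>} \<subseteq> {s. u s \<noteq> \<zero>}"
      using that by auto
    then show ?thesis
      using that by (auto simp: carrier_free_mod free_mod_ops intro: finite_subset)
  qed
qed (auto simp: carrier_free_mod free_mod_ops l_distr r_distr m_assoc is_cring)

lemma gen_closed: "s \<in> S \<Longrightarrow> gen R s \<in> carrier (free_mod R S)"
  by (auto simp: carrier_free_mod gen_def)

text \<open>Linear algebra on a free module is governed by the generators: splitting off one point of the
  support at a time shows that they lie in no proper submodule.\<close>

lemma free_mod_generated:
  assumes N: "submodule N R (free_mod R S)" and gens: "\<And>s. s \<in> S \<Longrightarrow> gen R s \<in> N"
  shows "carrier (free_mod R S) \<subseteq> N"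
proof -
  interpret F: module R "free_mod R S" by (rule free_mod_module)
  note N' = F.submoduleE[OF N]
  have *: "u \<in> N" if "finite A" "A \<subseteq> S" "u \<in> carrier (free_mod R S)" "{s. u s \<noteq> \<zero>} \<subseteq> A" for A u
    using that
  proof (induction A arbitrary: u rule: finite_induct)
    case empty
    then have "u = \<zero>\<^bsub>free_mod R S\<^esub>"
      by (auto simp: free_mod_ops)
    then show ?case
      using subgroup.one_closed[OF submodule.axioms(1)[OF N]] by simp
  next
    case (insert x A)
    define w where "w = u(x := \<zero>)"
    have "{s. w s \<noteq> \<zero>} \<subseteq> {s. u s \<noteq> \<zero>}" "{s. w s \<noteq> \<zero>} \<subseteq> A"
      using insert.prems by (auto simp: w_def)
    then have "w \<in> carrier (free_mod R S)"
      using insert.prems by (auto simp: carrier_free_mod w_def intro: finite_subset)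
    then have "w \<in> N"
      using insert \<open>{s. w s \<noteq> \<zero>} \<subseteq> A\<close> by auto
    have "u = w \<oplus>\<^bsub>free_mod R S\<^esub> u x \<odot>\<^bsub>free_mod R S\<^esub> gen R x"
      using insert.prems by (auto simp: free_mod_ops w_def gen_def carrier_free_mod)
    moreover have "u x \<in> carrier R" "gen R x \<in> N"
      using insert.prems gens by (auto simp: carrier_free_mod)
    ultimately show ?case
      using \<open>w \<in> N\<close> N' by metis
  qed
  have "u \<in> N" if "u \<in> carrier (free_mod R S)" for u
    by (rule *[of "{s. u s \<noteq> \<zero>}"]) (use that in \<open>auto simp: carrier_free_mod\<close>)
  then show ?thesis
    by blast
qed

text \<open>This realizes the universal property of the free module: the linear map with values \<open>g\<close> on the
  generators.\<close>

definition free_lift :: "('a, 'n, 'q) module_scheme \<Rightarrow> ('s \<Rightarrow> 'n) \<Rightarrow> ('s \<Rightarrow> 'a) \<Rightarrow> 'n"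
  where "free_lift M g u = (\<Oplus>\<^bsub>M\<^esub>s\<in>{s. u s \<noteq> \<zero>}. u s \<odot>\<^bsub>M\<^esub> g s)"

text \<open>Enlarging the summation range beyond the support makes sums over different supports
  comparable.\<close>

lemma free_lift_superset:
  assumes "module R M" "u \<in> carrier (free_mod R S)" "\<And>s. s \<in> S \<Longrightarrow> g s \<in> carrier M"
    and "finite A" "{s. u s \<noteq> \<zero>} \<subseteq> A" "A \<subseteq> S"
  shows "free_lift M g u = (\<Oplus>\<^bsub>M\<^esub>s\<in>A. u s \<odot>\<^bsub>M\<^esub> g s)"
proof -
  interpret M: module R M by fact
  show ?thesis
    unfolding free_lift_def using assms
    by (intro M.add.finprod_mono_neutral_cong_left) (auto simp: carrier_free_mod subset_iff)
qed

lemma free_lift_linear: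
  fixes S :: "'s set"
  assumes "module R M" "\<And>s. s \<in> S \<Longrightarrow> g s \<in> carrier M"
  shows "free_lift M g \<in> linear_maps R (free_mod R S) M"
proof -
  interpret M: module R M by fact
  interpret F: module R "free_mod R S" by (rule free_mod_module)
  have sup: "{s. u s \<noteq> \<zero>} \<subseteq> S" "finite {s. u s \<noteq> \<zero>}" "u s \<in> carrier R"
    if "u \<in> carrier (free_mod R S)" for u :: "'s \<Rightarrow> 'a" and s
    using that by (auto simp: carrier_free_mod)
  show ?thesis
  proof (rule linear_mapsI)
    fix u assume u: "u \<in> carrier (free_mod R S)"
    then show "free_lift M g u \<in> carrier M"
      unfolding free_lift_def using assms(2) sup[OF u] by (auto intro!: M.finsum_closed)
  next
    fix u v assume uv: "u \<in> carrier (free_mod R S)" "v \<in> carrier (free_mod R S)"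
    let ?A = "{s. u s \<noteq> \<zero>} \<union> {s. v s \<noteq> \<zero>}"
    have A: "finite ?A" "?A \<subseteq> S"
      using sup uv by auto
    have gA: "g s \<in> carrier M" if "s \<in> ?A" for s
      using A that assms(2) by blast
    have "free_lift M g (u \<oplus>\<^bsub>free_mod R S\<^esub> v) = (\<Oplus>\<^bsub>M\<^esub>s\<in>?A. (u s \<oplus> v s) \<odot>\<^bsub>M\<^esub> g s)"
      using A assms F.a_closed[OF uv] by (subst free_lift_superset) (auto simp: free_mod_ops)
    also have "\<dots> = (\<Oplus>\<^bsub>M\<^esub>s\<in>?A. u s \<odot>\<^bsub>M\<^esub> g s \<oplus>\<^bsub>M\<^esub> v s \<odot>\<^bsub>M\<^esub> g s)"
      using gA sup(3) uv by (intro M.finsum_cong') (auto simp: M.smult_l_distr)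
    also have "\<dots> = (\<Oplus>\<^bsub>M\<^esub>s\<in>?A. u s \<odot>\<^bsub>M\<^esub> g s) \<oplus>\<^bsub>M\<^esub> (\<Oplus>\<^bsub>M\<^esub>s\<in>?A. v s \<odot>\<^bsub>M\<^esub> g s)"
      using gA sup(3) uv by (intro M.finsum_addf) auto
    also have "\<dots> = free_lift M g u \<oplus>\<^bsub>M\<^esub> free_lift M g v"
      using A assms uv by (simp add: free_lift_superset[where A = ?A and S = S])
    finally show "free_lift M g (u \<oplus>\<^bsub>free_mod R S\<^esub> v) = \<dots>" .
  next
    fix r u assume ru: "r \<in> carrier R" "u \<in> carrier (free_mod R S)"
    let ?A = "{s. u s \<noteq> \<zero>}"
    have gA: "g s \<in> carrier M" if "s \<in> ?A" for s
      using sup[OF ru(2)] that assms(2) by blast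
    have "free_lift M g (r \<odot>\<^bsub>free_mod R S\<^esub> u) = (\<Oplus>\<^bsub>M\<^esub>s\<in>?A. (r \<otimes> u s) \<odot>\<^bsub>M\<^esub> g s)"
      using sup[OF ru(2)] assms F.smult_closed[OF ru] ru
      by (subst free_lift_superset[where A = ?A and S = S]) (auto simp: free_mod_ops)
    also have "\<dots> = (\<Oplus>\<^bsub>M\<^esub>s\<in>?A. r \<odot>\<^bsub>M\<^esub> (u s \<odot>\<^bsub>M\<^esub> g s))"
      using gA sup(3) ru by (intro M.finsum_cong') (auto simp: M.smult_assoc1)
    also have "\<dots> = r \<odot>\<^bsub>M\<^esub> free_lift M g u"
      unfolding free_lift_def using gA sup ru by (subst M.finsum_smult_ldistr) auto
    finally show "free_lift M g (r \<odot>\<^bsub>free_mod R S\<^esub> u) = \<dots>" .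
  qed
qed

lemma free_lift_gen:
  assumes "module R M" "\<And>s. s \<in> S \<Longrightarrow> g s \<in> carrier M" "s \<in> S"
  shows "free_lift M g (gen R s) = g s"
proof -
  interpret M: module R M by fact
  have "free_lift M g (gen R s) = (\<Oplus>\<^bsub>M\<^esub>t\<in>{s}. gen R s t \<odot>\<^bsub>M\<^esub> g t)"
    using assms gen_closed[OF assms(3)]
    by (intro free_lift_superset[where S = S]) (auto simp: gen_def)
  then show ?thesis
    using assms(2)[OF assms(3)] by (simp add: M.finsum_insert gen_def)
qed

definition free_bilift ::
  "('a, 'n, 'q) module_scheme \<Rightarrow> ('s \<Rightarrow> 't \<Rightarrow> 'n) \<Rightarrow> ('s \<Rightarrow> 'a) \<Rightarrow> ('t \<Rightarrow> 'a) \<Rightarrow> 'n"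
  where "free_bilift M h u v =
    (\<Oplus>\<^bsub>M\<^esub>s\<in>{s. u s \<noteq> \<zero>}. \<Oplus>\<^bsub>M\<^esub>t\<in>{t. v t \<noteq> \<zero>}. (u s \<otimes> v t) \<odot>\<^bsub>M\<^esub> h s t)"

text \<open>As an iterated lift the double sum is visibly linear in \<open>u\<close>, and for fixed \<open>u\<close> it is a fixed finite
  linear combination of maps linear in \<open>v\<close>.\<close>

lemma free_bilift_iterated:
  assumes "module R M" "\<And>s t. s \<in> S \<Longrightarrow> t \<in> T \<Longrightarrow> h s t \<in> carrier M"
    and u: "u \<in> carrier (free_mod R S)" and v: "v \<in> carrier (free_mod R T)"
  shows "free_bilift M h u v = free_lift M (\<lambda>s. free_lift M (h s) v) u"
proof -
  interpret M: module R M by fact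
  have uv: "{s. u s \<noteq> \<zero>} \<subseteq> S" "\<And>s. u s \<in> carrier R" "{s. v s \<noteq> \<zero>} \<subseteq> T"
    "finite {s. v s \<noteq> \<zero>}" "\<And>s. v s \<in> carrier R"
    using u v by (auto simp: carrier_free_mod)
  have "(\<Oplus>\<^bsub>M\<^esub>t\<in>{t. v t \<noteq> \<zero>}. (u s \<otimes> v t) \<odot>\<^bsub>M\<^esub> h s t) = u s \<odot>\<^bsub>M\<^esub> free_lift M (h s) v"
    if "u s \<noteq> \<zero>" for s
  proof -
    have h: "h s t \<in> carrier M" if "v t \<noteq> \<zero>" for t
      using assms(2) uv that \<open>u s \<noteq> \<zero>\<close> by blast
    have "(\<Oplus>\<^bsub>M\<^esub>t\<in>{t. v t \<noteq> \<zero>}. (u s \<otimes> v t) \<odot>\<^bsub>M\<^esub> h s t) =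
        (\<Oplus>\<^bsub>M\<^esub>t\<in>{t. v t \<noteq> \<zero>}. u s \<odot>\<^bsub>M\<^esub> (v t \<odot>\<^bsub>M\<^esub> h s t))"
      using uv h by (intro M.finsum_cong') (auto simp: M.smult_assoc1)
    also have "\<dots> = u s \<odot>\<^bsub>M\<^esub> free_lift M (h s) v"
      unfolding free_lift_def using uv h by (subst M.finsum_smult_ldistr) auto
    finally show ?thesis .
  qed
  moreover have "free_lift M (h s) v \<in> carrier M" if "u s \<noteq> \<zero>" for s
    by (rule linear_mapsD(1)[OF free_lift_linear v]) (use assms uv that in blast)+
  ultimately show ?thesis
    unfolding free_bilift_def free_lift_def[of M "\<lambda>s. free_lift M (h s) v"]
    using uv by (intro M.finsum_cong') auto
qed

lemma free_bilift_bilinear: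
  assumes M: "module R M" and h: "\<And>s t. s \<in> S \<Longrightarrow> t \<in> T \<Longrightarrow> h s t \<in> carrier M"
  shows "free_bilift M h \<in> bilinear_maps R (free_mod R S) (free_mod R T) M"
proof -
  have it: "free_bilift M h u v = free_lift M (\<lambda>s. free_lift M (h s) v) u"
    if "u \<in> carrier (free_mod R S)" "v \<in> carrier (free_mod R T)" for u v
    using M h that by (rule free_bilift_iterated)
  interpret F: module R "free_mod R S" by (rule free_mod_module)
  interpret G: module R "free_mod R T" by (rule free_mod_module)
  have inner: "free_lift M (h s) \<in> linear_maps R (free_mod R T) M" if "s \<in> S" for s
    using M h that by (intro free_lift_linear)
  have "free_bilift M h u \<in> linear_maps R (free_mod R T) M" if u: "u \<in> carrier (free_mod R S)" for u
  proof -
    have u': "{s. u s \<noteq> \<zero>} \<subseteq> S" "\<And>s. u s \<in> carrier R" "finite {s. u s \<noteq> \<zero>}"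
      using u by (auto simp: carrier_free_mod)
    have "(\<lambda>v. free_lift M (\<lambda>s. free_lift M (h s) v) u) \<in> linear_maps R (free_mod R T) M"
      unfolding free_lift_def[of M "\<lambda>s. free_lift M (h s) _"]
      using u' inner by (intro linear_maps_finsum free_mod_module M) auto
    then show ?thesis
      by (rule linear_maps_cong[OF free_mod_module]) (rule it[OF u])
  qed
  moreover have "(\<lambda>u. free_bilift M h u v) \<in> linear_maps R (free_mod R S) M"
    if v: "v \<in> carrier (free_mod R T)" for v
  proof -
    have "free_lift M (\<lambda>s. free_lift M (h s) v) \<in> linear_maps R (free_mod R S) M"
      using linear_mapsD(1)[OF inner v] by (intro free_lift_linear M)
    then show ?thesis
      by (rule linear_maps_cong[OF free_mod_module]) (rule it[OF _ v])
  qed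
  ultimately show ?thesis
    by (auto simp: bilinear_maps_def)
qed

lemma free_bilift_gen:
  assumes "module R M" "\<And>s t. s \<in> S \<Longrightarrow> t \<in> T \<Longrightarrow> h s t \<in> carrier M" "s \<in> S" "t \<in> T"
  shows "free_bilift M h (gen R s) (gen R t) = h s t"
proof -
  have "free_lift M (h s') (gen R t) = h s' t" if "s' \<in> S" for s'
    using assms that by (intro free_lift_gen[where S = T]) auto
  then show ?thesis
    using assms gen_closed[OF assms(3)] gen_closed[OF assms(4)]
      free_bilift_iterated[where S = S and T = T and h = h and M = M]
      free_lift_gen[where S = S and s = s and g = "\<lambda>s. free_lift M (h s) (gen R t)" and M = M]
    by simp
qed

end

section \<open>Modules given by generators and relations\<close>

locale presentation = cring R for R :: "('k, 'r) ring_scheme" (structure)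
    and S :: "'s set" and E :: "('s \<Rightarrow> 'k) set" +
  assumes relators: "E \<subseteq> carrier (free_mod R S)"
begin

abbreviation "F \<equiv> free_mod R S"
abbreviation "N \<equiv> rel_span R S E"
abbreviation "Q \<equiv> pres_mod R S E"
abbreviation "cls \<equiv> pres_class R S E"

sublocale F: module R F by (rule free_mod_module)

lemma rel_span_submodule: "submodule N R F"
proof -
  let ?\<N> = "{N. submodule N R F \<and> E \<subseteq> N}"
  have "carrier F \<in> ?\<N>"
    using F.carrier_is_submodule relators by auto
  then have sub: "\<Inter>?\<N> \<subseteq> carrier F"
    by blast
  show ?thesis
    unfolding rel_span_def
  proof (rule F.submoduleI[OF sub])
    show "\<zero>\<^bsub>F\<^esub> \<in> \<Inter>?\<N>"
      using subgroup.one_closed[OF submodule.axioms(1)] by fastforce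
  qed (use F.submoduleE(3-5) in blast)+
qed

lemma rel_span_subset: "E \<subseteq> N"
  by (auto simp: rel_span_def)

lemma rel_span_least: "submodule K R F \<Longrightarrow> E \<subseteq> K \<Longrightarrow> N \<subseteq> K"
  by (auto simp: rel_span_def)

sublocale N: abelian_subgroup N F
  by (intro abelian_subgroupI3 additive_subgroupI F.abelian_group_axioms
      submodule.axioms(1)[OF rel_span_submodule])

lemma pres_mod_ops:
  "carrier Q = cls ` carrier F"
  "\<zero>\<^bsub>Q\<^esub> = N"
  "c \<oplus>\<^bsub>Q\<^esub> d = c <+>\<^bsub>F\<^esub> d"
  "r \<odot>\<^bsub>Q\<^esub> c = (\<Union>u\<in>c. cls (r \<odot>\<^bsub>F\<^esub> u))"
  by (simp_all add: pres_mod_def)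

lemma cls_self: "u \<in> carrier F \<Longrightarrow> u \<in> cls u"
  by (simp add: pres_class_def N.a_rcos_self)

lemma cls_mem_carrier: "v \<in> cls u \<Longrightarrow> u \<in> carrier F \<Longrightarrow> v \<in> carrier F"
  unfolding pres_class_def using N.a_elemrcos_carrier by blast

lemma cls_mem_eq: "v \<in> cls u \<Longrightarrow> u \<in> carrier F \<Longrightarrow> cls v = cls u"
  unfolding pres_class_def using N.a_repr_independence' by metis

lemma cls_eq_iff:
  assumes "u \<in> carrier F" "v \<in> carrier F"
  shows "cls u = cls v \<longleftrightarrow> u \<ominus>\<^bsub>F\<^esub> v \<in> N"
proof -
  have "cls u = cls v \<longleftrightarrow> u \<in> cls v"
    using assms cls_self cls_mem_eq by metis
  also have "\<dots> \<longleftrightarrow> u \<ominus>\<^bsub>F\<^esub> v \<in> N"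
    unfolding pres_class_def
    using N.a_rcos_module[of v u] assms by (simp add: a_minus_def)
  finally show ?thesis .
qed

lemma cls_add:
  assumes "u \<in> carrier F" "v \<in> carrier F"
  shows "cls u \<oplus>\<^bsub>Q\<^esub> cls v = cls (u \<oplus>\<^bsub>F\<^esub> v)"
  unfolding pres_mod_ops unfolding pres_class_def using assms by (rule N.a_rcos_sum)

lemma cls_smult:
  assumes "u \<in> carrier F" "r \<in> carrier R"
  shows "r \<odot>\<^bsub>Q\<^esub> cls u = cls (r \<odot>\<^bsub>F\<^esub> u)"
proof -
  have "cls (r \<odot>\<^bsub>F\<^esub> w) = cls (r \<odot>\<^bsub>F\<^esub> u)" if "w \<in> cls u" for w
  proof -
    have w: "w \<in> carrier F" "w \<ominus>\<^bsub>F\<^esub> u \<in> N"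
      using that assms cls_mem_carrier cls_mem_eq[OF that] cls_eq_iff by auto
    have "r \<odot>\<^bsub>F\<^esub> w \<ominus>\<^bsub>F\<^esub> r \<odot>\<^bsub>F\<^esub> u = r \<odot>\<^bsub>F\<^esub> (w \<ominus>\<^bsub>F\<^esub> u)"
      using w assms by (simp add: a_minus_def F.smult_r_distr F.smult_r_minus)
    then show ?thesis
      using w assms F.submoduleE(4)[OF rel_span_submodule] by (subst cls_eq_iff) auto
  qed
  then show "r \<odot>\<^bsub>Q\<^esub> cls u = cls (r \<odot>\<^bsub>F\<^esub> u)"
    unfolding pres_mod_ops using cls_self[OF assms(1)] by blast
qed

lemmas cls_ops = cls_add cls_smult

lemma zero_pres_mod: "\<zero>\<^bsub>Q\<^esub> = cls \<zero>\<^bsub>F\<^esub>"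
  unfolding pres_mod_ops pres_class_def using N.a_rcos_const[OF N.zero_closed] by simp

lemma pres_mod_cases:
  assumes "c \<in> carrier Q"
  obtains u where "u \<in> carrier F" "c = cls u"
  using assms by (auto simp: pres_mod_ops)

lemma cls_closed: "u \<in> carrier F \<Longrightarrow> cls u \<in> carrier Q"
  by (auto simp: pres_mod_ops)

lemma pres_mod_module: "module R Q"
proof (rule moduleI)
  show "abelian_group Q"
  proof (rule abelian_groupI)
    fix c assume "c \<in> carrier Q"
    then obtain u where u: "u \<in> carrier F" "c = cls u"
      by (rule pres_mod_cases)
    then have "cls (\<ominus>\<^bsub>F\<^esub> u) \<oplus>\<^bsub>Q\<^esub> c = \<zero>\<^bsub>Q\<^esub>" "cls (\<ominus>\<^bsub>F\<^esub> u) \<in> carrier Q"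
      by (simp_all add: cls_ops zero_pres_mod F.l_neg cls_closed)
    then show "\<exists>d\<in>carrier Q. d \<oplus>\<^bsub>Q\<^esub> c = \<zero>\<^bsub>Q\<^esub>"
      by blast
  qed (auto elim!: pres_mod_cases simp: cls_ops zero_pres_mod cls_closed F.a_ac)
qed (auto elim!: pres_mod_cases
    simp: cls_ops cls_closed F.smult_l_distr F.smult_r_distr F.smult_assoc1 is_cring)

lemma cls_linear: "cls \<in> linear_maps R F Q"
  by (rule linear_mapsI) (simp_all add: cls_ops cls_closed)

lemma pres_mod_generated:
  assumes "submodule K R Q" "\<And>s. s \<in> S \<Longrightarrow> cls (gen R s) \<in> K"
  shows "carrier Q \<subseteq> K"
proof -
  have "carrier F \<subseteq> {u \<in> carrier F. cls u \<in> K}"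
    using submodule_preimage[OF F.module_axioms pres_mod_module cls_linear assms(1)]
    by (rule free_mod_generated) (use assms(2) gen_closed in auto)
  then show ?thesis
    by (auto elim!: pres_mod_cases)
qed

end

lemma bilinear_maps_flip:
  "f \<in> bilinear_maps R L M N \<Longrightarrow> (\<lambda>y x. f x y) \<in> bilinear_maps R M L N"
  by (simp add: bilinear_maps_def)

text \<open>The arguments that \<open>\<Phi>\<close> sends into \<open>K\<close>, for a fixed second argument, form a submodule. So it is enough
  to test the relators, and then, with the relator fixed, generators in the second argument.\<close>

lemma bilinear_map_rel_span:
  assumes "presentation R S E" "module R M" "submodule K R M"
    and \<Phi>: "\<Phi> \<in> bilinear_maps R (free_mod R S) (free_mod R T) M"
    and rel: "\<And>e t. e \<in> E \<Longrightarrow> t \<in> T \<Longrightarrow> \<Phi> e (gen R t) \<in> K"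
    and u: "u \<in> rel_span R S E" and v: "v \<in> carrier (free_mod R T)"
  shows "\<Phi> u v \<in> K"
proof -
  interpret presentation R S E by fact
  interpret G: module R "free_mod R T" by (rule free_mod_module)
  have "\<Phi> e w \<in> K" if "e \<in> E" "w \<in> carrier (free_mod R T)" for e w
  proof -
    have "carrier (free_mod R T) \<subseteq> {w \<in> carrier (free_mod R T). \<Phi> e w \<in> K}"
      using relators that rel gen_closed
      by (intro free_mod_generated submodule_preimage[OF G.module_axioms assms(2)]
          bilinear_mapsD(1)[OF \<Phi>] assms(3)) auto
    then show ?thesis
      using that by blast
  qed
  then have "N \<subseteq> {u \<in> carrier F. \<Phi> u v \<in> K}"
    using relators v
    by (intro rel_span_least submodule_preimage[OF F.module_axioms assms(2)]
        bilinear_mapsD(2)[OF \<Phi>] assms(3)) auto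
  then show ?thesis
    using u by blast
qed

text \<open>Relators that make the passage from generators to classes additive; a triple in \<open>T\<close> lists a sum
  and its two summands. The Grothendieck group of bisets and its scalar extension are both presented
  in this way, so one criterion covers the operations of both.\<close>

definition additive_rels ::
  "('k, 'r) ring_scheme \<Rightarrow> 's set \<Rightarrow> ('s \<times> 's \<times> 's) set \<Rightarrow> ('s \<Rightarrow> 'k) set"
  where "additive_rels R S T =
    {gen R s0 \<ominus>\<^bsub>free_mod R S\<^esub> gen R s1 \<ominus>\<^bsub>free_mod R S\<^esub> gen R s2 | s0 s1 s2. (s0, s1, s2) \<in> T}"

locale additive_presentation = cring R for R :: "('k, 'r) ring_scheme" (structure)
    and S :: "'s set" and T :: "('s \<times> 's \<times> 's) set" +
  assumes triples: "T \<subseteq> S \<times> S \<times> S"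

sublocale additive_presentation \<subseteq> presentation R S "additive_rels R S T"
proof
  interpret module R "free_mod R S" by (rule free_mod_module)
  show "additive_rels R S T \<subseteq> carrier (free_mod R S)"
    using triples by (auto simp: additive_rels_def intro!: gen_closed)
qed

context additive_presentation
begin

lemma cls_gen_add:
  assumes "(s0, s1, s2) \<in> T"
  shows "cls (gen R s0) = cls (gen R s1) \<oplus>\<^bsub>Q\<^esub> cls (gen R s2)"
proof -
  have g: "gen R s0 \<in> carrier F" "gen R s1 \<in> carrier F" "gen R s2 \<in> carrier F"
    using assms triples by (auto intro!: gen_closed)
  have "gen R s0 \<ominus>\<^bsub>F\<^esub> gen R s1 \<ominus>\<^bsub>F\<^esub> gen R s2 \<in> N"
    using assms rel_span_subset by (auto simp: additive_rels_def)
  moreover have "gen R s0 \<ominus>\<^bsub>F\<^esub> gen R s1 \<ominus>\<^bsub>F\<^esub> gen R s2 =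
      gen R s0 \<ominus>\<^bsub>F\<^esub> (gen R s1 \<oplus>\<^bsub>F\<^esub> gen R s2)"
    using g by (simp add: a_minus_def F.minus_add F.a_assoc)
  ultimately show ?thesis
    using g by (simp add: cls_ops cls_eq_iff)
qed

end

text \<open>An operation on generators that carries additive triples to additive triples, in each argument
  separately, descends to a bilinear operation on the presented modules.\<close>

locale bilinear_extension = cring R +
  left: additive_presentation R S1 T1 + right: additive_presentation R S2 T2 +
  additive_presentation R S T
  for R :: "('k, 'r) ring_scheme" (structure)
    and S1 :: "'s set" and T1 and S2 :: "'t set" and T2 and S :: "'u set" and T +
  fixes f :: "'s \<Rightarrow> 't \<Rightarrow> 'u"
  assumes f_closed: "s \<in> S1 \<Longrightarrow> t \<in> S2 \<Longrightarrow> f s t \<in> S"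
    and f_additive_left:
      "(s0, s1, s2) \<in> T1 \<Longrightarrow> t \<in> S2 \<Longrightarrow> (f s0 t, f s1 t, f s2 t) \<in> T"
    and f_additive_right:
      "s \<in> S1 \<Longrightarrow> (t0, t1, t2) \<in> T2 \<Longrightarrow> (f s t0, f s t1, f s t2) \<in> T"
begin

abbreviation "\<Phi> \<equiv> free_bilift F (\<lambda>s t. gen R (f s t))"

lemma \<Phi>_bilinear: "\<Phi> \<in> bilinear_maps R left.F right.F F"
  by (rule free_bilift_bilinear[OF F.module_axioms]) (rule gen_closed[OF f_closed])

lemma \<Phi>_gen: "s \<in> S1 \<Longrightarrow> t \<in> S2 \<Longrightarrow> \<Phi> (gen R s) (gen R t) = gen R (f s t)"
  by (rule free_bilift_gen[OF F.module_axioms, where S = S1 and T = S2])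
    (auto intro: gen_closed f_closed)

lemma \<Phi>_relators_left:
  assumes "u \<in> left.N" "v \<in> carrier right.F"
  shows "\<Phi> u v \<in> N"
  using left.presentation_axioms F.module_axioms rel_span_submodule \<Phi>_bilinear _ assms
proof (rule bilinear_map_rel_span)
  fix e t assume "e \<in> additive_rels R S1 T1" "t \<in> S2"
  then obtain s0 s1 s2 where s: "(s0, s1, s2) \<in> T1" and
    e: "e = gen R s0 \<ominus>\<^bsub>left.F\<^esub> gen R s1 \<ominus>\<^bsub>left.F\<^esub> gen R s2"
    by (auto simp: additive_rels_def)
  have "s0 \<in> S1" "s1 \<in> S1" "s2 \<in> S1"
    using s left.triples by auto
  then have "\<Phi> e (gen R t) = gen R (f s0 t) \<ominus>\<^bsub>F\<^esub> gen R (f s1 t) \<ominus>\<^bsub>F\<^esub> gen R (f s2 t)"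
    using \<open>t \<in> S2\<close> linear_map_minus[OF left.F.module_axioms F.module_axioms
        bilinear_mapsD(2)[OF \<Phi>_bilinear gen_closed[OF \<open>t \<in> S2\<close>]]]
    by (simp add: e gen_closed \<Phi>_gen)
  also have "\<dots> \<in> N"
    using f_additive_left[OF s \<open>t \<in> S2\<close>] rel_span_subset by (auto simp: additive_rels_def)
  finally show "\<Phi> e (gen R t) \<in> N" .
qed

lemma \<Phi>_relators_right:
  assumes "v \<in> right.N" "u \<in> carrier left.F"
  shows "\<Phi> u v \<in> N"
  using right.presentation_axioms F.module_axioms rel_span_submodule
    bilinear_maps_flip[OF \<Phi>_bilinear] _ assms
proof (rule bilinear_map_rel_span)
  fix e s assume "e \<in> additive_rels R S2 T2" "s \<in> S1"
  then obtain t0 t1 t2 where t: "(t0, t1, t2) \<in> T2" and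
    e: "e = gen R t0 \<ominus>\<^bsub>right.F\<^esub> gen R t1 \<ominus>\<^bsub>right.F\<^esub> gen R t2"
    by (auto simp: additive_rels_def)
  have "t0 \<in> S2" "t1 \<in> S2" "t2 \<in> S2"
    using t right.triples by auto
  then have "\<Phi> (gen R s) e = gen R (f s t0) \<ominus>\<^bsub>F\<^esub> gen R (f s t1) \<ominus>\<^bsub>F\<^esub> gen R (f s t2)"
    using \<open>s \<in> S1\<close> linear_map_minus[OF right.F.module_axioms F.module_axioms
        bilinear_mapsD(1)[OF \<Phi>_bilinear gen_closed[OF \<open>s \<in> S1\<close>]]]
    by (simp add: e gen_closed \<Phi>_gen)
  also have "\<dots> \<in> N"
    using f_additive_right[OF \<open>s \<in> S1\<close> t] rel_span_subset by (auto simp: additive_rels_def)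
  finally show "\<Phi> (gen R s) e \<in> N" .
qed

text \<open>Changing representatives one argument at a time:
  \<open>\<Phi>(u, v) - \<Phi>(u', v') = \<Phi>(u - u', v) + \<Phi>(u', v - v')\<close>.\<close>

lemma \<Phi>_cong:
  assumes "u \<in> carrier left.F" "u' \<in> carrier left.F" "left.cls u = left.cls u'"
    and "v \<in> carrier right.F" "v' \<in> carrier right.F" "right.cls v = right.cls v'"
  shows "cls (\<Phi> u v) = cls (\<Phi> u' v')"
proof -
  note lin = bilinear_mapsD[OF \<Phi>_bilinear]
  have "\<Phi> u v \<ominus>\<^bsub>F\<^esub> \<Phi> u' v = \<Phi> (u \<ominus>\<^bsub>left.F\<^esub> u') v"
    using assms linear_map_minus[OF left.F.module_axioms F.module_axioms lin(2)] by simp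
  moreover have "\<dots> \<in> N"
    using assms by (intro \<Phi>_relators_left) (simp_all add: left.cls_eq_iff)
  moreover have "\<Phi> u' v \<ominus>\<^bsub>F\<^esub> \<Phi> u' v' = \<Phi> u' (v \<ominus>\<^bsub>right.F\<^esub> v')"
    using assms linear_map_minus[OF right.F.module_axioms F.module_axioms lin(1)] by simp
  moreover have "\<dots> \<in> N"
    using assms by (intro \<Phi>_relators_right) (simp_all add: right.cls_eq_iff)
  ultimately have "cls (\<Phi> u v) = cls (\<Phi> u' v)" "cls (\<Phi> u' v) = cls (\<Phi> u' v')"
    using assms lin(3) by (simp_all add: cls_eq_iff)
  then show ?thesis
    by simp
qed

lemma bilinear_ext_cls:
  assumes "u \<in> carrier left.F" "v \<in> carrier right.F"
  shows "bilinear_ext R S (additive_rels R S T) f (left.cls u) (right.cls v) = cls (\<Phi> u v)"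
proof -
  have "cls (\<Phi> u' v') = cls (\<Phi> u v)" if "u' \<in> left.cls u" "v' \<in> right.cls v" for u' v'
    using assms left.cls_mem_carrier[OF that(1)] left.cls_mem_eq[OF that(1)]
      right.cls_mem_carrier[OF that(2)] right.cls_mem_eq[OF that(2)]
    by (intro \<Phi>_cong) simp_all
  moreover have "u \<in> left.cls u" "v \<in> right.cls v"
    using assms left.cls_self right.cls_self by auto
  ultimately show ?thesis
    unfolding bilinear_ext_def free_bilift_def by blast
qed

lemma bilinear_ext_gen:
  assumes "s \<in> S1" "t \<in> S2"
  shows "bilinear_ext R S (additive_rels R S T) f (left.cls (gen R s)) (right.cls (gen R t)) =
    cls (gen R (f s t))"
  using assms by (simp add: bilinear_ext_cls \<Phi>_gen gen_closed)

lemma bilinear_ext_bilinear: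
  "bilinear_ext R S (additive_rels R S T) f \<in> bilinear_maps R left.Q right.Q Q"
proof -
  let ?g = "bilinear_ext R S (additive_rels R S T) f"
  note lin = bilinear_mapsD[OF \<Phi>_bilinear]
  have "?g c \<in> linear_maps R right.Q Q" if "c \<in> carrier left.Q" for c
    using that
    by (intro linear_mapsI)
      (auto elim!: left.pres_mod_cases right.pres_mod_cases
        simp: right.cls_ops bilinear_ext_cls cls_ops lin(3) cls_closed linear_mapsD[OF lin(1)])
  moreover have "(\<lambda>c. ?g c d) \<in> linear_maps R left.Q Q" if "d \<in> carrier right.Q" for d
    using that
    by (intro linear_mapsI)
      (auto elim!: left.pres_mod_cases right.pres_mod_cases
        simp: left.cls_ops bilinear_ext_cls cls_ops lin(3) cls_closed linear_mapsD[OF lin(2)])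
  ultimately show ?thesis
    by (simp add: bilinear_maps_def)
qed

end

section \<open>Direct products of groups\<close>

lemma gprod_simps [simp]:
  "x \<otimes>\<^bsub>K \<boxtimes> H\<^esub> y = Pr (pfst x \<otimes>\<^bsub>K\<^esub> pfst y) (psnd x \<otimes>\<^bsub>H\<^esub> psnd y)"
  "\<one>\<^bsub>K \<boxtimes> H\<^esub> = Pr \<one>\<^bsub>K\<^esub> \<one>\<^bsub>H\<^esub>"
  "Pr k h \<in> carrier (K \<boxtimes> H) \<longleftrightarrow> k \<in> carrier K \<and> h \<in> carrier H"
  by (simp_all add: gprod_def)

lemma gprod_carrierE:
  assumes "x \<in> carrier (K \<boxtimes> H)"
  obtains k h where "x = Pr k h" "k \<in> carrier K" "h \<in> carrier H"
  using assms by (auto simp: gprod_def)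

lemma gprod_eta: "x \<in> carrier (K \<boxtimes> H) \<Longrightarrow> Pr (pfst x) (psnd x) = x"
  by (auto elim: gprod_carrierE)

lemma gprod_carrier_proj [simp]:
  "x \<in> carrier (K \<boxtimes> H) \<Longrightarrow> pfst x \<in> carrier K"
  "x \<in> carrier (K \<boxtimes> H) \<Longrightarrow> psnd x \<in> carrier H"
  by (auto elim: gprod_carrierE)

lemma gprod_group:
  assumes "group K" "group H"
  shows "group (K \<boxtimes> H)"
proof -
  interpret K: group K by fact
  interpret H: group H by fact
  show ?thesis
  proof (rule groupI)
    fix x assume "x \<in> carrier (K \<boxtimes> H)"
    then obtain k h where x: "x = Pr k h" "k \<in> carrier K" "h \<in> carrier H"
      by (rule gprod_carrierE)
    then show "\<exists>y\<in>carrier (K \<boxtimes> H). y \<otimes>\<^bsub>K \<boxtimes> H\<^esub> x = \<one>\<^bsub>K \<boxtimes> H\<^esub>"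
      by (intro bexI[of _ "Pr (inv\<^bsub>K\<^esub> k) (inv\<^bsub>H\<^esub> h)"]) simp_all
  qed (auto elim!: gprod_carrierE simp: K.m_assoc H.m_assoc)
qed

definition finite_grp :: "'a grp \<Rightarrow> bool"
  where "finite_grp G \<longleftrightarrow> group G \<and> finite (carrier G)"

lemma finite_grp_gprod: "finite_grp K \<Longrightarrow> finite_grp H \<Longrightarrow> finite_grp (K \<boxtimes> H)"
proof -
  have "carrier (K \<boxtimes> H) = (\<lambda>(k, h). Pr k h) ` (carrier K \<times> carrier H)"
    by (auto simp: gprod_def)
  then show "finite_grp K \<Longrightarrow> finite_grp H \<Longrightarrow> finite_grp (K \<boxtimes> H)"
    by (simp add: finite_grp_def gprod_group)
qed

lemma finite_grp_triv: "finite_grp triv"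
proof -
  have "group triv"
    by (rule groupI) (simp_all add: triv_def)
  then show ?thesis
    by (simp add: finite_grp_def triv_def)
qed

section \<open>Isomorphisms of bisets\<close>

locale biset =
  fixes H G :: "'a grp" and X :: "('a, 'x) biset"
  assumes is_biset: "is_biset H G X"
begin

lemma finite_pts: "finite (pts X)"
  using is_biset by (simp add: is_biset_def)

lemma act_simps [simp]:
  "h \<in> carrier H \<Longrightarrow> x \<in> pts X \<Longrightarrow> lact X h x \<in> pts X"
  "g \<in> carrier G \<Longrightarrow> x \<in> pts X \<Longrightarrow> ract X x g \<in> pts X"
  "x \<in> pts X \<Longrightarrow> lact X \<one>\<^bsub>H\<^esub> x = x"
  "x \<in> pts X \<Longrightarrow> ract X x \<one>\<^bsub>G\<^esub> = x"
  "h \<in> carrier H \<Longrightarrow> x \<in> pts X \<Longrightarrow> g \<in> carrier G \<Longrightarrow>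
    ract X (lact X h x) g = lact X h (ract X x g)"
  using is_biset by (simp_all add: is_biset_def)

lemma act_mult:
  "h \<in> carrier H \<Longrightarrow> h' \<in> carrier H \<Longrightarrow> x \<in> pts X \<Longrightarrow> lact X (h \<otimes>\<^bsub>H\<^esub> h') x = lact X h (lact X h' x)"
  "g \<in> carrier G \<Longrightarrow> g' \<in> carrier G \<Longrightarrow> x \<in> pts X \<Longrightarrow> ract X x (g \<otimes>\<^bsub>G\<^esub> g') = ract X (ract X x g) g'"
  using is_biset by (simp_all add: is_biset_def)

lemma ract_cancel:
  assumes "group G" "x \<in> pts X" "x' \<in> pts X" "g \<in> carrier G" "g' \<in> carrier G"
    and "ract X x g = ract X x' g'"
  shows "ract X x (g \<otimes>\<^bsub>G\<^esub> inv\<^bsub>G\<^esub> g') = x'"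
proof -
  interpret group G by fact
  have "ract X x (g \<otimes>\<^bsub>G\<^esub> inv\<^bsub>G\<^esub> g') = ract X (ract X x' g') (inv\<^bsub>G\<^esub> g')"
    using assms by (simp add: act_mult(2))
  also have "\<dots> = x'"
    using assms by (simp flip: act_mult(2))
  finally show ?thesis .
qed

end

lemma is_bisetI:
  assumes "finite (pts X)"
    and "\<And>h x. h \<in> carrier H \<Longrightarrow> x \<in> pts X \<Longrightarrow> lact X h x \<in> pts X"
    and "\<And>g x. g \<in> carrier G \<Longrightarrow> x \<in> pts X \<Longrightarrow> ract X x g \<in> pts X"
    and "\<And>x. x \<in> pts X \<Longrightarrow> lact X \<one>\<^bsub>H\<^esub> x = x"
    and "\<And>x. x \<in> pts X \<Longrightarrow> ract X x \<one>\<^bsub>G\<^esub> = x"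
    and "\<And>h h' x. h \<in> carrier H \<Longrightarrow> h' \<in> carrier H \<Longrightarrow> x \<in> pts X \<Longrightarrow>
      lact X (h \<otimes>\<^bsub>H\<^esub> h') x = lact X h (lact X h' x)"
    and "\<And>g g' x. g \<in> carrier G \<Longrightarrow> g' \<in> carrier G \<Longrightarrow> x \<in> pts X \<Longrightarrow>
      ract X x (g \<otimes>\<^bsub>G\<^esub> g') = ract X (ract X x g) g'"
    and "\<And>h x g. h \<in> carrier H \<Longrightarrow> x \<in> pts X \<Longrightarrow> g \<in> carrier G \<Longrightarrow>
      ract X (lact X h x) g = lact X h (ract X x g)"
  shows "is_biset H G X"
  unfolding is_biset_def by (intro conjI ballI) (rule assms; assumption)+

lemma biset_isoI:
  assumes "bij_betw f (pts X) (pts Y)"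
    and "\<And>h x. h \<in> carrier H \<Longrightarrow> x \<in> pts X \<Longrightarrow> f (lact X h x) = lact Y h (f x)"
    and "\<And>x g. x \<in> pts X \<Longrightarrow> g \<in> carrier G \<Longrightarrow> f (ract X x g) = ract Y (f x) g"
  shows "biset_iso H G X Y"
  unfolding biset_iso_def using assms by blast

lemma biset_isoD:
  assumes "biset_iso H G X Y"
  shows "\<exists>f. bij_betw f (pts X) (pts Y) \<and> (\<forall>x\<in>pts X. f x \<in> pts Y) \<and>
    (\<forall>h\<in>carrier H. \<forall>x\<in>pts X. f (lact X h x) = lact Y h (f x)) \<and>
    (\<forall>x\<in>pts X. \<forall>g\<in>carrier G. f (ract X x g) = ract Y (f x) g)"
  using assms bij_betwE unfolding biset_iso_def by blast

lemma biset_iso_refl: "biset_iso H G X X"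
  by (rule biset_isoI[of id]) simp_all

lemma biset_iso_trans:
  assumes "biset_iso H G X Y" "biset_iso H G Y Z"
  shows "biset_iso H G X Z"
proof -
  obtain f where f: "bij_betw f (pts X) (pts Y)" "\<forall>x\<in>pts X. f x \<in> pts Y"
    "\<forall>h\<in>carrier H. \<forall>x\<in>pts X. f (lact X h x) = lact Y h (f x)"
    "\<forall>x\<in>pts X. \<forall>g\<in>carrier G. f (ract X x g) = ract Y (f x) g"
    using biset_isoD[OF assms(1)] by blast
  obtain f' where f': "bij_betw f' (pts Y) (pts Z)" "\<forall>x\<in>pts Y. f' x \<in> pts Z"
    "\<forall>h\<in>carrier H. \<forall>x\<in>pts Y. f' (lact Y h x) = lact Z h (f' x)"
    "\<forall>x\<in>pts Y. \<forall>g\<in>carrier G. f' (ract Y x g) = ract Z (f' x) g"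
    using biset_isoD[OF assms(2)] by blast
  show ?thesis
    by (rule biset_isoI[of "f' \<circ> f"]) (use f f' in \<open>auto intro: bij_betw_trans\<close>)
qed

lemma biset_iso_sym:
  assumes "is_biset H G X" "biset_iso H G X Y"
  shows "biset_iso H G Y X"
proof -
  interpret biset H G X by standard fact
  obtain f where f: "bij_betw f (pts X) (pts Y)" "\<forall>x\<in>pts X. f x \<in> pts Y"
    "\<forall>h\<in>carrier H. \<forall>x\<in>pts X. f (lact X h x) = lact Y h (f x)"
    "\<forall>x\<in>pts X. \<forall>g\<in>carrier G. f (ract X x g) = ract Y (f x) g"
    using biset_isoD[OF assms(2)] by blast
  define f' where "f' = inv_into (pts X) f"
  have f': "f' (f x) = x" if "x \<in> pts X" for x
    using f(1) that by (simp add: f'_def bij_betw_def)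
  have surj: "\<exists>x\<in>pts X. y = f x" if "y \<in> pts Y" for y
    using f(1) that by (auto simp: bij_betw_def)
  show ?thesis
  proof (rule biset_isoI[of f'])
    show "bij_betw f' (pts Y) (pts X)"
      unfolding f'_def using f(1) by (rule bij_betw_inv_into)
    fix y assume "y \<in> pts Y"
    then obtain x where x: "x \<in> pts X" "y = f x"
      using surj by blast
    show "f' (lact Y h y) = lact X h (f' y)" if "h \<in> carrier H" for h
      using x that f(3) act_simps(1) f' by metis
    show "f' (ract Y y g) = ract X (f' y) g" if "g \<in> carrier G" for g
      using x that f(4) act_simps(2) f' by metis
  qed
qed

lemma iso_class_eq:
  assumes "is_biset H G X" "biset_iso H G X Y"
  shows "iso_class H G X = iso_class H G Y"
  using biset_iso_trans[OF _ assms(2)] biset_iso_trans[OF _ biset_iso_sym[OF assms]]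
  unfolding iso_class_def by blast

text \<open>Isomorphism classes only record members with natural numbers as points. Composites, sums and
  external products have other points and are transported along an enumeration.\<close>

lemma biset_nat_model:
  assumes "is_biset H G X"
  obtains Z :: "('a, nat) biset" where "is_biset H G Z" "biset_iso H G Z X"
proof -
  interpret biset H G X by standard fact
  obtain e where e: "bij_betw e (pts X) {0..<card (pts X)}"
    using ex_bij_betw_finite_nat[OF finite_pts] by blast
  define d where "d = inv_into (pts X) e"
  define Z :: "('a, nat) biset" where
    "Z = \<lparr>pts = {0..<card (pts X)}, lact = (\<lambda>h n. e (lact X h (d n))), ract = (\<lambda>n g. e (ract X (d n) g))\<rparr>"
  have de: "d (e x) = x" if "x \<in> pts X" for x
    using e that by (simp add: d_def bij_betw_def)
  have d: "bij_betw d {0..<card (pts X)} (pts X)"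
    unfolding d_def using e by (rule bij_betw_inv_into)
  have d_mem: "d n \<in> pts X" if "n < card (pts X)" for n
    using bij_betwE[OF d] that by auto
  have e_mem: "e x < card (pts X)" if "x \<in> pts X" for x
    using bij_betwE[OF e] that by auto
  have ed: "e (d n) = n" if "n < card (pts X)" for n
    using e that unfolding d_def by (auto simp: bij_betw_def f_inv_into_f)
  show thesis
  proof (rule that)
    show "is_biset H G Z"
      by (rule is_bisetI) (simp_all add: Z_def de d_mem e_mem ed act_mult)
    show "biset_iso H G Z X"
      by (rule biset_isoI[of d]) (use d in \<open>simp_all add: Z_def de d_mem\<close>)
  qed
qed

lemma iso_class_closed: "is_biset H G X \<Longrightarrow> iso_class H G X \<in> iso_classes H G"
  by (rule biset_nat_model, assumption) (use iso_class_eq in \<open>force simp: iso_classes_def\<close>)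

lemma iso_class_nonempty: "is_biset H G X \<Longrightarrow> iso_class H G X \<noteq> {}"
  by (rule biset_nat_model, assumption) (force simp: iso_class_def)

lemma iso_classesE:
  assumes "c \<in> iso_classes H G"
  obtains X :: "('a, nat) biset" where "is_biset H G X" "c = iso_class H G X"
  using assms by (auto simp: iso_classes_def)

section \<open>Composition of bisets\<close>

definition biset_orbit :: "'a grp \<Rightarrow> ('a, 'y) biset \<Rightarrow> ('a, 'x) biset \<Rightarrow> 'y \<Rightarrow> 'x \<Rightarrow> ('y \<times> 'x) set"
  where "biset_orbit H Y X y x = {(ract Y y (inv\<^bsub>H\<^esub> h), lact X h x) | h. h \<in> carrier H}"

locale composable_bisets = Y: biset K H Y + X: biset H G X + H: group H
  for K H G :: "'a grp" and Y :: "('a, 'y) biset" and X :: "('a, 'x) biset"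
begin

abbreviation "orb \<equiv> biset_orbit H Y X"

lemma pts_comp: "pts (biset_comp H Y X) = {orb y x | y x. y \<in> pts Y \<and> x \<in> pts X}"
  by (simp add: biset_comp_def biset_orbit_def)

lemma orb_closed: "y \<in> pts Y \<Longrightarrow> x \<in> pts X \<Longrightarrow> orb y x \<in> pts (biset_comp H Y X)"
  by (auto simp: pts_comp)

text \<open>Moving the inverse to the other side leaves a condition on a single \<open>h\<close>, so that orbits can be compared
  without computing inverses of group elements.\<close>

lemma mem_orb_iff:
  assumes "y \<in> pts Y" "x \<in> pts X"
  shows "(y', x') \<in> orb y x \<longleftrightarrow> y' \<in> pts Y \<and> (\<exists>h\<in>carrier H. ract Y y' h = y \<and> x' = lact X h x)"
proof -
  have "y' = ract Y y (inv\<^bsub>H\<^esub> h) \<longleftrightarrow> y' \<in> pts Y \<and> ract Y y' h = y" if "h \<in> carrier H" for h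
    using assms that by (auto simp flip: Y.act_mult(2))
  then show ?thesis
    by (auto simp: biset_orbit_def)
qed

lemma orb_self: "y \<in> pts Y \<Longrightarrow> x \<in> pts X \<Longrightarrow> (y, x) \<in> orb y x"
  by (auto simp: mem_orb_iff intro!: bexI[of _ "\<one>\<^bsub>H\<^esub>"])

lemma orb_subset: "y \<in> pts Y \<Longrightarrow> x \<in> pts X \<Longrightarrow> orb y x \<subseteq> pts Y \<times> pts X"
  by (auto simp: biset_orbit_def)

lemma orb_eq_iff:
  assumes "y \<in> pts Y" "x \<in> pts X" "y' \<in> pts Y" "x' \<in> pts X"
  shows "orb y x = orb y' x' \<longleftrightarrow> (\<exists>h\<in>carrier H. ract Y y h = y' \<and> x = lact X h x')"
proof
  assume "orb y x = orb y' x'"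
  then have "(y, x) \<in> orb y' x'"
    using orb_self assms by metis
  then show "\<exists>h\<in>carrier H. ract Y y h = y' \<and> x = lact X h x'"
    using assms by (simp add: mem_orb_iff)
next
  assume "\<exists>h\<in>carrier H. ract Y y h = y' \<and> x = lact X h x'"
  then obtain h where h: "h \<in> carrier H" "ract Y y h = y'" "x = lact X h x'"
    by blast
  have "(z, w) \<in> orb y x \<longleftrightarrow> (z, w) \<in> orb y' x'" for z w
  proof
    assume "(z, w) \<in> orb y x"
    then obtain k where "z \<in> pts Y" "k \<in> carrier H" "ract Y z k = y" "w = lact X k x"
      using assms by (auto simp: mem_orb_iff)
    then show "(z, w) \<in> orb y' x'"
      using assms h
      by (auto simp: mem_orb_iff X.act_mult Y.act_mult intro!: bexI[of _ "k \<otimes>\<^bsub>H\<^esub> h"])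
  next
    assume "(z, w) \<in> orb y' x'"
    then obtain k where k: "z \<in> pts Y" "k \<in> carrier H" "ract Y z k = y'" "w = lact X k x'"
      using assms by (auto simp: mem_orb_iff)
    have "ract Y z (k \<otimes>\<^bsub>H\<^esub> inv\<^bsub>H\<^esub> h) = ract Y (ract Y y h) (inv\<^bsub>H\<^esub> h)"
      using k h by (simp add: Y.act_mult)
    also have "\<dots> = y"
      using h(1) assms(1) by (simp flip: Y.act_mult(2))
    finally have "ract Y z (k \<otimes>\<^bsub>H\<^esub> inv\<^bsub>H\<^esub> h) = y" .
    moreover have "lact X (k \<otimes>\<^bsub>H\<^esub> inv\<^bsub>H\<^esub> h) x = w"
      using k h assms by (simp add: H.m_assoc flip: X.act_mult(1))
    ultimately show "(z, w) \<in> orb y x"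
      using assms h k by (auto simp: mem_orb_iff intro!: bexI[of _ "k \<otimes>\<^bsub>H\<^esub> inv\<^bsub>H\<^esub> h"])
  qed
  then show "orb y x = orb y' x'"
    by auto
qed

lemma orb_balanced:
  "y \<in> pts Y \<Longrightarrow> x \<in> pts X \<Longrightarrow> h \<in> carrier H \<Longrightarrow> orb (ract Y y h) x = orb y (lact X h x)"
  by (auto simp: orb_eq_iff)
    (metis H.inv_closed H.l_inv H.r_inv X.act_mult(1) X.act_simps(3) Y.act_mult(2) Y.act_simps(4))

lemma lact_orb:
  assumes "y \<in> pts Y" "x \<in> pts X" "k \<in> carrier K"
  shows "lact (biset_comp H Y X) k (orb y x) = orb (lact Y k y) x"
proof -
  have "orb (lact Y k y) x = {(lact Y k (ract Y y (inv\<^bsub>H\<^esub> h)), lact X h x) | h. h \<in> carrier H}"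
    using assms unfolding biset_orbit_def by (metis (no_types, lifting) H.inv_closed Y.act_simps(5))
  then show ?thesis
    by (auto simp: biset_comp_def biset_orbit_def)
qed

lemma ract_orb:
  assumes "y \<in> pts Y" "x \<in> pts X" "g \<in> carrier G"
  shows "ract (biset_comp H Y X) (orb y x) g = orb y (ract X x g)"
proof -
  have "orb y (ract X x g) = {(ract Y y (inv\<^bsub>H\<^esub> h), ract X (lact X h x) g) | h. h \<in> carrier H}"
    using assms unfolding biset_orbit_def by (metis (no_types, lifting) X.act_simps(5))
  then show ?thesis
    by (auto simp: biset_comp_def biset_orbit_def)
qed

lemma comp_is_biset: "is_biset K G (biset_comp H Y X)"
proof (rule is_bisetI)
  have "pts (biset_comp H Y X) = (\<lambda>(y, x). orb y x) ` (pts Y \<times> pts X)"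
    by (auto simp: pts_comp)
  then show "finite (pts (biset_comp H Y X))"
    using X.finite_pts Y.finite_pts by simp
next
  fix h x assume "h \<in> carrier K" "x \<in> pts (biset_comp H Y X)"
  then show "lact (biset_comp H Y X) h x \<in> pts (biset_comp H Y X)"
    unfolding pts_comp using lact_orb Y.act_simps(1) by fastforce
next
  fix g x assume "g \<in> carrier G" "x \<in> pts (biset_comp H Y X)"
  then show "ract (biset_comp H Y X) x g \<in> pts (biset_comp H Y X)"
    unfolding pts_comp using ract_orb X.act_simps(2) by fastforce
next
  fix h g x assume "h \<in> carrier K" "x \<in> pts (biset_comp H Y X)" "g \<in> carrier G"
  then show "ract (biset_comp H Y X) (lact (biset_comp H Y X) h x) g =
      lact (biset_comp H Y X) h (ract (biset_comp H Y X) x g)"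
    by (auto simp: pts_comp lact_orb ract_orb)
next
  fix x assume "x \<in> pts (biset_comp H Y X)"
  then obtain y x' where "x = orb y x'" "y \<in> pts Y" "x' \<in> pts X"
    by (auto simp: pts_comp)
  then show "lact (biset_comp H Y X) \<one>\<^bsub>K\<^esub> x = x" "ract (biset_comp H Y X) x \<one>\<^bsub>G\<^esub> = x"
    using orb_subset by (force simp: biset_comp_def)+
next
  fix h h' x assume h: "h \<in> carrier K" "h' \<in> carrier K" "x \<in> pts (biset_comp H Y X)"
  then have "\<And>y x'. (y, x') \<in> x \<Longrightarrow> y \<in> pts Y"
    using orb_subset by (auto simp: pts_comp)
  then show "lact (biset_comp H Y X) (h \<otimes>\<^bsub>K\<^esub> h') x =
      lact (biset_comp H Y X) h (lact (biset_comp H Y X) h' x)"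
    using h(1,2) by (auto simp: biset_comp_def image_image Y.act_mult intro!: image_cong)
next
  fix g g' x assume g: "g \<in> carrier G" "g' \<in> carrier G" "x \<in> pts (biset_comp H Y X)"
  then have "\<And>y x'. (y, x') \<in> x \<Longrightarrow> x' \<in> pts X"
    using orb_subset by (auto simp: pts_comp)
  then show "ract (biset_comp H Y X) x (g \<otimes>\<^bsub>G\<^esub> g') =
      ract (biset_comp H Y X) (ract (biset_comp H Y X) x g) g'"
    using g(1,2) by (auto simp: biset_comp_def image_image X.act_mult intro!: image_cong)
qed

text \<open>Maps out of \<open>Y \<times>\<^sub>H X\<close> are balanced maps on \<open>Y \<times> X\<close>, and such a map is injective on orbits exactly
  when each of its fibres is a single orbit. All isomorphisms from composites below are found in this way.\<close>

lemma comp_isoI: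
  assumes closed: "\<And>y x. y \<in> pts Y \<Longrightarrow> x \<in> pts X \<Longrightarrow> \<phi> y x \<in> pts Z"
    and surj: "\<And>z. z \<in> pts Z \<Longrightarrow> \<exists>y\<in>pts Y. \<exists>x\<in>pts X. z = \<phi> y x"
    and balanced: "\<And>y x h. y \<in> pts Y \<Longrightarrow> x \<in> pts X \<Longrightarrow> h \<in> carrier H \<Longrightarrow>
      \<phi> (ract Y y h) x = \<phi> y (lact X h x)"
    and fibre: "\<And>y x y' x'. y \<in> pts Y \<Longrightarrow> x \<in> pts X \<Longrightarrow> y' \<in> pts Y \<Longrightarrow> x' \<in> pts X \<Longrightarrow>
      \<phi> y x = \<phi> y' x' \<Longrightarrow> \<exists>h\<in>carrier H. ract Y y h = y' \<and> x = lact X h x'"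
    and lact: "\<And>y x k. y \<in> pts Y \<Longrightarrow> x \<in> pts X \<Longrightarrow> k \<in> carrier K \<Longrightarrow>
      \<phi> (lact Y k y) x = lact Z k (\<phi> y x)"
    and ract: "\<And>y x g. y \<in> pts Y \<Longrightarrow> x \<in> pts X \<Longrightarrow> g \<in> carrier G \<Longrightarrow>
      \<phi> y (ract X x g) = ract Z (\<phi> y x) g"
  shows "biset_iso K G (biset_comp H Y X) Z"
proof -
  define f where "f = (\<lambda>O'. the_elem ((\<lambda>(y, x). \<phi> y x) ` O'))"
  have f: "f (orb y x) = \<phi> y x" if "y \<in> pts Y" "x \<in> pts X" for y x
  proof -
    have "\<phi> y' x' = \<phi> y x" if orb: "(y', x') \<in> orb y x" for y' x'
    proof -
      obtain h where "y' \<in> pts Y" "h \<in> carrier H" "ract Y y' h = y" "x' = lact X h x"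
        using orb unfolding mem_orb_iff[OF \<open>y \<in> pts Y\<close> \<open>x \<in> pts X\<close>] by blast
      then show ?thesis
        using balanced[of y' x h] \<open>x \<in> pts X\<close> by simp
    qed
    then have "\<forall>p\<in>orb y x. (\<lambda>(y, x). \<phi> y x) p = \<phi> y x"
      by auto
    then have "(\<lambda>(y, x). \<phi> y x) ` orb y x = {\<phi> y x}"
      using orb_self[OF that] by (auto simp: image_iff)
    then show ?thesis
      by (simp add: f_def)
  qed
  show ?thesis
  proof (rule biset_isoI[of f])
    have "inj_on f (pts (biset_comp H Y X))"
    proof (rule inj_onI)
      fix p q assume "p \<in> pts (biset_comp H Y X)" "q \<in> pts (biset_comp H Y X)" "f p = f q"
      then obtain y x y' x' where yx: "y \<in> pts Y" "x \<in> pts X" "y' \<in> pts Y" "x' \<in> pts X"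
        "p = orb y x" "q = orb y' x'" "\<phi> y x = \<phi> y' x'"
        by (auto simp: pts_comp f)
      then show "p = q"
        using fibre[OF yx(1-4) yx(7)] by (simp add: orb_eq_iff)
    qed
    moreover have "f ` pts (biset_comp H Y X) = pts Z"
    proof
      show "f ` pts (biset_comp H Y X) \<subseteq> pts Z"
        using closed by (auto simp: pts_comp f)
      show "pts Z \<subseteq> f ` pts (biset_comp H Y X)"
      proof
        fix z assume "z \<in> pts Z"
        then obtain y x where yx: "y \<in> pts Y" "x \<in> pts X" "z = \<phi> y x"
          using surj by blast
        then have "z = f (orb y x)" "orb y x \<in> pts (biset_comp H Y X)"
          by (auto simp: f pts_comp)
        then show "z \<in> f ` pts (biset_comp H Y X)"
          by blast
      qed
    qed
    ultimately show "bij_betw f (pts (biset_comp H Y X)) (pts Z)"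
      by (simp add: bij_betw_def)
  qed (auto simp: pts_comp f lact_orb ract_orb lact ract)
qed

end

text \<open>Stability under isomorphism and additivity in both arguments: this is what makes composition
  of classes well defined.\<close>

lemma biset_comp_cong:
  fixes Y :: "('a, 'y) biset" and X :: "('a, 'x) biset"
    and Y' :: "('a, 'y1) biset" and X' :: "('a, 'x1) biset"
  assumes "group H" "is_biset K H Y" "is_biset H G X" "is_biset K H Y'" "is_biset H G X'"
    and "biset_iso K H Y Y'" "biset_iso H G X X'"
  shows "biset_iso K G (biset_comp H Y X) (biset_comp H Y' X')"
proof -
  interpret group H by fact
  interpret YX: composable_bisets K H G Y X
    by unfold_locales fact+
  interpret YX': composable_bisets K H G Y' X'
    by unfold_locales fact+
  obtain f where f: "bij_betw f (pts Y) (pts Y')" "\<forall>y\<in>pts Y. f y \<in> pts Y'"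
    "\<forall>k\<in>carrier K. \<forall>y\<in>pts Y. f (lact Y k y) = lact Y' k (f y)"
    "\<forall>y\<in>pts Y. \<forall>h\<in>carrier H. f (ract Y y h) = ract Y' (f y) h"
    using biset_isoD[OF assms(6)] by blast
  obtain g where g: "bij_betw g (pts X) (pts X')" "\<forall>x\<in>pts X. g x \<in> pts X'"
    "\<forall>h\<in>carrier H. \<forall>x\<in>pts X. g (lact X h x) = lact X' h (g x)"
    "\<forall>x\<in>pts X. \<forall>l\<in>carrier G. g (ract X x l) = ract X' (g x) l"
    using biset_isoD[OF assms(7)] by blast
  show ?thesis
  proof (rule YX.comp_isoI[of "\<lambda>y x. YX'.orb (f y) (g x)"])
    fix z assume "z \<in> pts (biset_comp H Y' X')"
    then obtain y' x' where z: "z = YX'.orb y' x'" "y' \<in> pts Y'" "x' \<in> pts X'"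
      by (auto simp: YX'.pts_comp)
    moreover obtain y where "y \<in> pts Y" "y' = f y"
      using z f(1) by (auto simp: bij_betw_def)
    moreover obtain x where "x \<in> pts X" "x' = g x"
      using z g(1) by (auto simp: bij_betw_def)
    ultimately show "\<exists>y\<in>pts Y. \<exists>x\<in>pts X. z = YX'.orb (f y) (g x)"
      by blast
  next
    fix y x y' x'
    assume yx: "y \<in> pts Y" "x \<in> pts X" "y' \<in> pts Y" "x' \<in> pts X"
      and "YX'.orb (f y) (g x) = YX'.orb (f y') (g x')"
    then obtain h where h: "h \<in> carrier H" "ract Y' (f y) h = f y'" "g x = lact X' h (g x')"
      using f(2) g(2) by (auto simp: YX'.orb_eq_iff)
    then have "f (ract Y y h) = f y'" "g x = g (lact X h x')"
      using yx f(4) g(3) by auto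
    then have "ract Y y h = y'" "x = lact X h x'"
      using yx h(1) inj_onD[OF bij_betw_imp_inj_on[OF f(1)], of "ract Y y h" y']
        inj_onD[OF bij_betw_imp_inj_on[OF g(1)], of x "lact X h x'"] by simp_all
    then show "\<exists>h\<in>carrier H. ract Y y h = y' \<and> x = lact X h x'"
      using h(1) by blast
  qed (use f(2-4) g(2-4) in \<open>auto simp: YX'.orb_closed YX'.lact_orb YX'.ract_orb YX'.orb_balanced\<close>)
qed

lemma biset_sum_simps [simp]:
  "pts (biset_sum X Y) = pts X <+> pts Y"
  "lact (biset_sum X Y) h (Inl x) = Inl (lact X h x)"
  "lact (biset_sum X Y) h (Inr y) = Inr (lact Y h y)"
  "ract (biset_sum X Y) (Inl x) g = Inl (ract X x g)"
  "ract (biset_sum X Y) (Inr y) g = Inr (ract Y y g)"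
  by (simp_all add: biset_sum_def)

lemma biset_sum_is_biset:
  assumes "is_biset H G X" "is_biset H G Y"
  shows "is_biset H G (biset_sum X Y)"
proof -
  interpret X: biset H G X by standard fact
  interpret Y: biset H G Y by standard fact
  show ?thesis
    by (rule is_bisetI) (auto simp: X.finite_pts Y.finite_pts X.act_mult Y.act_mult)
qed

lemma biset_sum_cong:
  assumes "biset_iso H G X X'" "biset_iso H G Y Y'"
  shows "biset_iso H G (biset_sum X Y) (biset_sum X' Y')"
proof -
  obtain f where f: "bij_betw f (pts X) (pts X')"
    "\<forall>h\<in>carrier H. \<forall>x\<in>pts X. f (lact X h x) = lact X' h (f x)"
    "\<forall>x\<in>pts X. \<forall>g\<in>carrier G. f (ract X x g) = ract X' (f x) g"
    using assms(1) unfolding biset_iso_def by blast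
  obtain f' where f': "bij_betw f' (pts Y) (pts Y')"
    "\<forall>h\<in>carrier H. \<forall>y\<in>pts Y. f' (lact Y h y) = lact Y' h (f' y)"
    "\<forall>y\<in>pts Y. \<forall>g\<in>carrier G. f' (ract Y y g) = ract Y' (f' y) g"
    using assms(2) unfolding biset_iso_def by blast
  show ?thesis
  proof (rule biset_isoI[of "map_sum f f'"])
    show "bij_betw (map_sum f f') (pts (biset_sum X Y)) (pts (biset_sum X' Y'))"
    proof -
      have "map_sum f f' ` (pts X <+> pts Y) = f ` pts X <+> f' ` pts Y"
        by (simp add: Plus_def image_Un image_image)
      moreover have "inj_on (map_sum f f') (pts X <+> pts Y)"
        using bij_betw_imp_inj_on[OF f(1)] bij_betw_imp_inj_on[OF f'(1)]
        by (auto intro!: inj_onI dest: inj_onD)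
      ultimately show ?thesis
        using f(1) f'(1) by (simp add: bij_betw_def)
    qed
  qed (use f f' in auto)
qed

lemma biset_comp_sum_left:
  assumes "group H" "is_biset K H Y" "is_biset K H Y'" "is_biset H G X"
  shows "biset_iso K G (biset_comp H (biset_sum Y Y') X) (biset_sum (biset_comp H Y X) (biset_comp H Y' X))"
proof -
  interpret group H by fact
  interpret YX: composable_bisets K H G Y X
    by unfold_locales fact+
  interpret YX': composable_bisets K H G Y' X
    by unfold_locales fact+
  interpret S: composable_bisets K H G "biset_sum Y Y'" X
    by unfold_locales (rule biset_sum_is_biset[OF assms(2,3)])
  show ?thesis
    by (rule S.comp_isoI[of "\<lambda>z x. map_sum (\<lambda>y. YX.orb y x) (\<lambda>y. YX'.orb y x) z"])
      (force simp: YX.pts_comp YX'.pts_comp YX.lact_orb YX.ract_orb YX'.lact_orb YX'.ract_orb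
         YX.orb_balanced YX'.orb_balanced YX.orb_eq_iff YX'.orb_eq_iff)+
qed

lemma biset_comp_sum_right:
  assumes "group H" "is_biset K H Y" "is_biset H G X" "is_biset H G X'"
  shows "biset_iso K G (biset_comp H Y (biset_sum X X')) (biset_sum (biset_comp H Y X) (biset_comp H Y X'))"
proof -
  interpret group H by fact
  interpret YX: composable_bisets K H G Y X
    by unfold_locales fact+
  interpret YX': composable_bisets K H G Y X'
    by unfold_locales fact+
  interpret S: composable_bisets K H G Y "biset_sum X X'"
    by unfold_locales (rule biset_sum_is_biset[OF assms(3,4)])
  show ?thesis
    by (rule S.comp_isoI[of "\<lambda>y z. map_sum (\<lambda>x. YX.orb y x) (\<lambda>x. YX'.orb y x) z"])
      (force simp: YX.pts_comp YX'.pts_comp YX.lact_orb YX.ract_orb YX'.lact_orb YX'.ract_orb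
         YX.orb_balanced YX'.orb_balanced YX.orb_eq_iff YX'.orb_eq_iff)+
qed

section \<open>External products of bisets\<close>

lemma biset_ext_simps [simp]:
  "pts (biset_ext Y X) = pts Y \<times> pts X"
  "lact (biset_ext Y X) p (y, x) = (lact Y (pfst p) y, lact X (psnd p) x)"
  "ract (biset_ext Y X) (y, x) p = (ract Y y (pfst p), ract X x (psnd p))"
  by (simp_all add: biset_ext_def)

lemma biset_ext_is_biset:
  assumes "is_biset L K Y" "is_biset H G X"
  shows "is_biset (L \<boxtimes> H) (K \<boxtimes> G) (biset_ext Y X)"
proof -
  interpret Y: biset L K Y by standard fact
  interpret X: biset H G X by standard fact
  show ?thesis
    by (rule is_bisetI) (auto simp: X.finite_pts Y.finite_pts X.act_mult Y.act_mult)
qed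

lemma biset_ext_cong:
  assumes "biset_iso L K Y Y'" "biset_iso H G X X'"
  shows "biset_iso (L \<boxtimes> H) (K \<boxtimes> G) (biset_ext Y X) (biset_ext Y' X')"
proof -
  obtain f where f: "bij_betw f (pts Y) (pts Y')"
    "\<forall>h\<in>carrier L. \<forall>x\<in>pts Y. f (lact Y h x) = lact Y' h (f x)"
    "\<forall>x\<in>pts Y. \<forall>g\<in>carrier K. f (ract Y x g) = ract Y' (f x) g"
    using assms(1) unfolding biset_iso_def by blast
  obtain f' where f': "bij_betw f' (pts X) (pts X')"
    "\<forall>h\<in>carrier H. \<forall>y\<in>pts X. f' (lact X h y) = lact X' h (f' y)"
    "\<forall>y\<in>pts X. \<forall>g\<in>carrier G. f' (ract X y g) = ract X' (f' y) g"
    using assms(2) unfolding biset_iso_def by blast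
  show ?thesis
    by (rule biset_isoI[of "map_prod f f'"]) (use f f' in \<open>auto intro: bij_betw_map_prod\<close>)
qed

lemma biset_ext_sum_left:
  "biset_iso (L \<boxtimes> H) (K \<boxtimes> G)
    (biset_ext (biset_sum Y Y') X) (biset_sum (biset_ext Y X) (biset_ext Y' X))"
proof (rule biset_isoI[of "\<lambda>(z, x). map_sum (\<lambda>y. (y, x)) (\<lambda>y. (y, x)) z"])
  show "bij_betw (\<lambda>(z, x). map_sum (\<lambda>y. (y, x)) (\<lambda>y. (y, x)) z)
      (pts (biset_ext (biset_sum Y Y') X)) (pts (biset_sum (biset_ext Y X) (biset_ext Y' X)))"
    by (rule bij_betw_byWitness[where
          f' = "case_sum (\<lambda>(y, x). (Inl y, x)) (\<lambda>(y, x). (Inr y, x))"]) auto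
qed auto

lemma biset_ext_sum_right:
  "biset_iso (L \<boxtimes> H) (K \<boxtimes> G)
    (biset_ext Y (biset_sum X X')) (biset_sum (biset_ext Y X) (biset_ext Y X'))"
proof (rule biset_isoI[of "\<lambda>(y, z). map_sum (\<lambda>x. (y, x)) (\<lambda>x. (y, x)) z"])
  show "bij_betw (\<lambda>(y, z). map_sum (\<lambda>x. (y, x)) (\<lambda>x. (y, x)) z)
      (pts (biset_ext Y (biset_sum X X'))) (pts (biset_sum (biset_ext Y X) (biset_ext Y X')))"
    by (rule bij_betw_byWitness[where
          f' = "case_sum (\<lambda>(y, x). (y, Inl x)) (\<lambda>(y, x). (y, Inr x))"]) auto
qed auto

text \<open>The interchange law: \<open>H\<close> and \<open>H'\<close> act on separate coordinates, so an orbit of \<open>H \<boxtimes> H'\<close> is a product of an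
  orbit of \<open>H\<close> and an orbit of \<open>H'\<close>.\<close>

lemma biset_ext_comp:
  fixes Y :: "('a, 'y) biset" and X :: "('a, 'x) biset"
    and Y' :: "('a, 'y1) biset" and X' :: "('a, 'x1) biset"
  assumes "group H" "is_biset K H Y" "is_biset H G X"
    and "group H'" "is_biset K' H' Y'" "is_biset H' G' X'"
  shows "biset_iso (K \<boxtimes> K') (G \<boxtimes> G')
    (biset_comp (H \<boxtimes> H') (biset_ext Y Y') (biset_ext X X'))
    (biset_ext (biset_comp H Y X) (biset_comp H' Y' X'))"
proof -
  interpret group H by fact
  interpret H': group H' by fact
  interpret YX: composable_bisets K H G Y X
    by unfold_locales fact+
  interpret YX': composable_bisets K' H' G' Y' X'
    by unfold_locales fact+
  interpret E: composable_bisets "K \<boxtimes> K'" "H \<boxtimes> H'" "G \<boxtimes> G'" "biset_ext Y Y'" "biset_ext X X'"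
    by (intro composable_bisets.intro biset.intro biset_ext_is_biset gprod_group assms)
  show ?thesis
  proof (rule E.comp_isoI[of "\<lambda>(y, y') (x, x'). (YX.orb y x, YX'.orb y' x')"])
    fix p q p' q'
    assume "p \<in> pts (biset_ext Y Y')" "q \<in> pts (biset_ext X X')"
      "p' \<in> pts (biset_ext Y Y')" "q' \<in> pts (biset_ext X X')"
      "(\<lambda>(y, y') (x, x'). (YX.orb y x, YX'.orb y' x')) p q =
       (\<lambda>(y, y') (x, x'). (YX.orb y x, YX'.orb y' x')) p' q'"
    then obtain h h' where "h \<in> carrier H" "ract Y (fst p) h = fst p'" "fst q = lact X h (fst q')"
      "h' \<in> carrier H'" "ract Y' (snd p) h' = snd p'" "snd q = lact X' h' (snd q')"
      by (auto simp: YX.orb_eq_iff YX'.orb_eq_iff)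
    then show "\<exists>h\<in>carrier (H \<boxtimes> H'). ract (biset_ext Y Y') p h = p' \<and> q = lact (biset_ext X X') h q'"
      by (intro bexI[of _ "Pr h h'"]) (auto simp: biset_ext_def prod_eq_iff split: prod.splits)
  qed (force simp: YX.pts_comp YX'.pts_comp YX.lact_orb YX.ract_orb YX'.lact_orb YX'.ract_orb
      YX.orb_balanced YX'.orb_balanced)+
qed

section \<open>Restriction along homomorphisms\<close>

text \<open>Identity, inflation and diagonal bisets, and up to isomorphism those of group isomorphisms, are
  restrictions of regular bisets, and composing with one of them on the left only changes a left action.
  Computations with them therefore become computations with homomorphisms.\<close>

definition restrict_left :: "('a univ \<Rightarrow> 'a univ) \<Rightarrow> ('a, 'x) biset \<Rightarrow> ('a, 'x) biset"
  where "restrict_left \<delta> X = X\<lparr>lact := \<lambda>h. lact X (\<delta> h)\<rparr>"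

abbreviation res_biset :: "'a grp \<Rightarrow> ('a univ \<Rightarrow> 'a univ) \<Rightarrow> ('a, 'a univ) biset"
  where "res_biset B \<delta> \<equiv> restrict_left \<delta> (id_biset B)"

lemma restrict_left_simps [simp]:
  "pts (restrict_left \<delta> X) = pts X"
  "lact (restrict_left \<delta> X) h x = lact X (\<delta> h) x"
  "ract (restrict_left \<delta> X) x g = ract X x g"
  by (simp_all add: restrict_left_def)

lemma id_biset_simps [simp]:
  "pts (id_biset G) = carrier G"
  "lact (id_biset G) g x = g \<otimes>\<^bsub>G\<^esub> x"
  "ract (id_biset G) x g = x \<otimes>\<^bsub>G\<^esub> g"
  by (simp_all add: id_biset_def)

lemma restrict_left_restrict_left:
  "restrict_left \<delta> (restrict_left \<delta>' X) = restrict_left (\<lambda>h. \<delta>' (\<delta> h)) X"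
  by (simp add: restrict_left_def)

lemma restrict_left_is_biset:
  assumes "group A" "group B" "\<delta> \<in> hom A B" "is_biset B G X"
  shows "is_biset A G (restrict_left \<delta> X)"
proof -
  interpret biset B G X by standard fact
  show ?thesis
    by (rule is_bisetI)
      (use assms(3) in \<open>simp_all add: finite_pts act_mult hom_in_carrier hom_mult hom_one[OF assms(3,1,2)]\<close>)
qed

lemma restrict_left_cong:
  assumes "\<And>h. h \<in> carrier A \<Longrightarrow> \<delta> h = \<delta>' h"
  shows "biset_iso A G (restrict_left \<delta> X) (restrict_left \<delta>' X)"
  by (rule biset_isoI[of id]) (simp_all add: assms)

lemma restrict_left_iso:
  assumes "\<And>h. h \<in> carrier A \<Longrightarrow> \<delta> h \<in> carrier B" "biset_iso B G X Y"
  shows "biset_iso A G (restrict_left \<delta> X) (restrict_left \<delta> Y)"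
  using assms(2) unfolding biset_iso_def by (auto intro!: assms(1))

lemma id_is_biset:
  assumes "finite_grp G"
  shows "is_biset G G (id_biset G)"
proof -
  interpret group G using assms by (simp add: finite_grp_def)
  show ?thesis
    by (rule is_bisetI) (use assms in \<open>auto simp: finite_grp_def m_assoc\<close>)
qed

lemma res_is_biset:
  assumes "finite_grp A" "finite_grp B" "\<delta> \<in> hom A B"
  shows "is_biset A B (res_biset B \<delta>)"
  using assms by (intro restrict_left_is_biset[of A B] id_is_biset) (simp_all add: finite_grp_def)

lemma id_biset_res: "id_biset G = res_biset G (\<lambda>g. g)"
  by (simp add: restrict_left_def)

lemma inf_biset_res: "inf_biset H = res_biset H pfst"
  by (simp add: restrict_left_def inf_biset_def id_biset_def)

text \<open>The homomorphism \<open>(K \<boxtimes> H) \<boxtimes> G \<rightarrow> (K \<boxtimes> G) \<boxtimes> (H \<boxtimes> G)\<close> that is diagonal on \<open>G\<close>, and the inverse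
  of the associativity isomorphism.\<close>

definition diag_map :: "'a univ \<Rightarrow> 'a univ"
  where "diag_map p = Pr (Pr (pfst (pfst p)) (psnd p)) (Pr (psnd (pfst p)) (psnd p))"

definition unassoc_map :: "'a univ \<Rightarrow> 'a univ"
  where "unassoc_map p = Pr (pfst (pfst p)) (Pr (psnd (pfst p)) (psnd p))"

definition prod_map :: "('a univ \<Rightarrow> 'a univ) \<Rightarrow> ('a univ \<Rightarrow> 'a univ) \<Rightarrow> 'a univ \<Rightarrow> 'a univ"
  where "prod_map \<delta> \<delta>' p = Pr (\<delta> (pfst p)) (\<delta>' (psnd p))"

lemma diag_biset_res: "diag_biset G K H = res_biset ((K \<boxtimes> G) \<boxtimes> (H \<boxtimes> G)) diag_map"
  by (simp add: restrict_left_def diag_biset_def id_biset_def diag_map_def)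

lemma projection_homs:
  "pfst \<in> hom (K \<boxtimes> H) K" "psnd \<in> hom (K \<boxtimes> H) H"
  by (auto simp: hom_def)

lemma prod_map_hom:
  assumes "\<delta> \<in> hom A B" "\<delta>' \<in> hom A' B'"
  shows "prod_map \<delta> \<delta>' \<in> hom (A \<boxtimes> A') (B \<boxtimes> B')"
  using assms by (auto simp: hom_def prod_map_def Pi_iff)

lemma diag_map_hom: "diag_map \<in> hom ((K \<boxtimes> H) \<boxtimes> G) ((K \<boxtimes> G) \<boxtimes> (H \<boxtimes> G))"
  by (auto simp: hom_def diag_map_def elim!: gprod_carrierE)

lemma unassoc_map_hom: "unassoc_map \<in> hom ((L \<boxtimes> K) \<boxtimes> H) (L \<boxtimes> (K \<boxtimes> H))"
  by (auto simp: hom_def unassoc_map_def elim!: gprod_carrierE)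

lemma assoc_map_hom: "assoc_map \<in> hom (L \<boxtimes> (K \<boxtimes> H)) ((L \<boxtimes> K) \<boxtimes> H)"
  by (auto simp: hom_def assoc_map_def elim!: gprod_carrierE)

text \<open>Since \<open>b \<cdot> 1 = b\<close>, every orbit of \<open>B\<close> on \<open>B \<times> X\<close> contains exactly one point of the form \<open>(1, x)\<close>; the point
  \<open>(b, x)\<close> is moved to \<open>(1, bx)\<close>.\<close>

lemma biset_comp_res:
  assumes "finite_grp A" "finite_grp B" "\<delta> \<in> hom A B" "is_biset B C X"
  shows "biset_iso A C (biset_comp B (res_biset B \<delta>) X) (restrict_left \<delta> X)"
proof -
  interpret group B using assms by (simp add: finite_grp_def)
  interpret composable_bisets A B C "res_biset B \<delta>" X
    by (intro composable_bisets.intro biset.intro res_is_biset assms is_group)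
  show ?thesis
  proof (rule comp_isoI[of "lact X"])
    fix x assume "x \<in> pts (restrict_left \<delta> X)"
    then show "\<exists>b\<in>pts (res_biset B \<delta>). \<exists>x'\<in>pts X. x = lact X b x'"
      by (auto intro!: bexI[of _ "\<one>\<^bsub>B\<^esub>"] bexI[of _ x])
  next
    fix b x b' x'
    assume bx: "b \<in> pts (res_biset B \<delta>)" "x \<in> pts X" "b' \<in> pts (res_biset B \<delta>)" "x' \<in> pts X"
      and eq: "lact X b x = lact X b' x'"
    have "x = lact X (inv\<^bsub>B\<^esub> b) (lact X b x)"
      using bx by (simp flip: X.act_mult(1))
    also have "\<dots> = lact X (inv\<^bsub>B\<^esub> b \<otimes>\<^bsub>B\<^esub> b') x'"
      using bx by (simp add: eq X.act_mult)
    finally show "\<exists>h\<in>carrier B. ract (res_biset B \<delta>) b h = b' \<and> x = lact X h x'"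
      using bx by (intro bexI[of _ "inv\<^bsub>B\<^esub> b \<otimes>\<^bsub>B\<^esub> b'"]) (simp_all flip: m_assoc)
  qed (use assms(3) in \<open>simp_all add: X.act_mult hom_in_carrier\<close>)
qed

lemma biset_ext_restrict_left:
  "biset_ext (restrict_left \<delta> Y) (restrict_left \<delta>' X) = restrict_left (prod_map \<delta> \<delta>') (biset_ext Y X)"
  by (simp add: restrict_left_def biset_ext_def prod_map_def fun_eq_iff)

lemma biset_ext_id: "biset_iso (K \<boxtimes> H) (K \<boxtimes> H) (biset_ext (id_biset K) (id_biset H)) (id_biset (K \<boxtimes> H))"
proof (rule biset_isoI[of "\<lambda>(k, h). Pr k h"])
  show "bij_betw (\<lambda>(k, h). Pr k h) (pts (biset_ext (id_biset K) (id_biset H))) (pts (id_biset (K \<boxtimes> H)))"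
    by (rule bij_betw_byWitness[where f' = "\<lambda>p. (pfst p, psnd p)"]) (auto elim: gprod_carrierE)
qed auto

lemma biset_ext_res:
  assumes "\<delta> \<in> hom A B" "\<delta>' \<in> hom A' B'"
  shows "biset_iso (A \<boxtimes> A') (B \<boxtimes> B') (biset_ext (res_biset B \<delta>) (res_biset B' \<delta>'))
    (res_biset (B \<boxtimes> B') (prod_map \<delta> \<delta>'))"
  unfolding biset_ext_restrict_left
  using hom_in_carrier[OF prod_map_hom[OF assms]] biset_ext_id by (rule restrict_left_iso)

lemma iso_biset_res:
  assumes "\<psi> \<in> hom H G" "\<sigma> \<in> hom G H"
    and "\<And>h. h \<in> carrier H \<Longrightarrow> \<sigma> (\<psi> h) = h" "\<And>g. g \<in> carrier G \<Longrightarrow> \<psi> (\<sigma> g) = g"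
  shows "biset_iso G H (res_biset H \<sigma>) (iso_biset G \<psi>)"
proof (rule biset_isoI[of \<psi>])
  show "bij_betw \<psi> (pts (res_biset H \<sigma>)) (pts (iso_biset G \<psi>))"
    by (rule bij_betw_byWitness[where f' = \<sigma>])
      (use assms in \<open>auto simp: iso_biset_def hom_in_carrier\<close>)
qed (use assms in \<open>auto simp: iso_biset_def hom_in_carrier hom_mult\<close>)

text \<open>The second factor \<open>G\<close> acts trivially on the inflation biset but regularly on the coordinate \<open>g\<close> of
  \<open>((x, g), h)\<close>. So \<open>g\<close> can be moved to \<open>1\<close> without changing \<open>h\<close>, and \<open>xh\<close> is a complete invariant of the
  orbit.\<close>

lemma biset_ext_inf_natural:
  assumes "finite_grp K" "finite_grp H" "finite_grp G" "is_biset K H X"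
  shows "biset_iso (K \<boxtimes> G) H (biset_comp (H \<boxtimes> G) (biset_ext X (id_biset G)) (inf_biset H))
    (restrict_left pfst X)"
proof -
  interpret H: group H using assms by (simp add: finite_grp_def)
  interpret G: group G using assms by (simp add: finite_grp_def)
  interpret X: biset K H X by standard fact
  interpret C: composable_bisets "K \<boxtimes> G" "H \<boxtimes> G" H "biset_ext X (id_biset G)" "inf_biset H"
    unfolding inf_biset_res
    by (intro composable_bisets.intro biset.intro res_is_biset biset_ext_is_biset id_is_biset
        finite_grp_gprod gprod_group projection_homs assms H.is_group G.is_group)
  show ?thesis
  proof (rule C.comp_isoI[of "\<lambda>p h. ract X (fst p) h"])
    fix x assume "x \<in> pts (restrict_left pfst X)"
    then show "\<exists>p\<in>pts (biset_ext X (id_biset G)). \<exists>h\<in>pts (inf_biset H). x = ract X (fst p) h"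
      by (intro bexI[of _ "(x, \<one>\<^bsub>G\<^esub>)"] bexI[of _ "\<one>\<^bsub>H\<^esub>"]) (auto simp: inf_biset_def)
  next
    fix p h p' h'
    assume mem: "p \<in> pts (biset_ext X (id_biset G))" "h \<in> pts (inf_biset H)"
      "p' \<in> pts (biset_ext X (id_biset G))" "h' \<in> pts (inf_biset H)"
      and eq: "ract X (fst p) h = ract X (fst p') h'"
    obtain x g x' g' where p: "p = (x, g)" "p' = (x', g')"
      by (metis surj_pair)
    have "ract X x (h \<otimes>\<^bsub>H\<^esub> inv\<^bsub>H\<^esub> h') = x'"
      by (rule X.ract_cancel[OF H.is_group]) (use mem eq p in \<open>auto simp: inf_biset_def\<close>)
    moreover have "g \<otimes>\<^bsub>G\<^esub> (inv\<^bsub>G\<^esub> g \<otimes>\<^bsub>G\<^esub> g') = g'"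
      using mem p by (simp flip: G.m_assoc)
    ultimately show "\<exists>q\<in>carrier (H \<boxtimes> G). ract (biset_ext X (id_biset G)) p q = p' \<and>
        h = lact (inf_biset H) q h'"
      using mem p
      by (intro bexI[of _ "Pr (h \<otimes>\<^bsub>H\<^esub> inv\<^bsub>H\<^esub> h') (inv\<^bsub>G\<^esub> g \<otimes>\<^bsub>G\<^esub> g')"])
        (auto simp: inf_biset_def H.m_assoc)
  qed (auto simp: inf_biset_def X.act_mult)
qed

text \<open>The group \<open>(K \<boxtimes> H) \<boxtimes> G\<close> acts freely on the coordinates of the diagonal biset. Moving its coordinates in
  \<open>K\<close> and \<open>H\<close> over to \<open>x\<close> and \<open>y\<close>, and the single coordinate \<open>g\<close> of the left factor into the two
  coordinates in \<open>G\<close>, leads to a unique point \<open>(((x, y), 1), ((1, g\<^sub>1), (1, g\<^sub>2)))\<close> in each orbit.\<close>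

lemma biset_ext_diag_natural:
  assumes "finite_grp K" "finite_grp H" "finite_grp T" "finite_grp L" "finite_grp G"
    and "is_biset T K X" "is_biset L H Y"
  shows "biset_iso ((T \<boxtimes> L) \<boxtimes> G) ((K \<boxtimes> G) \<boxtimes> (H \<boxtimes> G))
    (biset_comp ((K \<boxtimes> H) \<boxtimes> G) (biset_ext (biset_ext X Y) (id_biset G)) (diag_biset G K H))
    (restrict_left diag_map (biset_ext (biset_ext X (id_biset G)) (biset_ext Y (id_biset G))))"
proof -
  interpret K: group K using assms by (simp add: finite_grp_def)
  interpret H: group H using assms by (simp add: finite_grp_def)
  interpret G: group G using assms by (simp add: finite_grp_def)
  interpret X: biset T K X by standard fact
  interpret Y: biset L H Y by standard fact
  interpret C: composable_bisets "(T \<boxtimes> L) \<boxtimes> G" "(K \<boxtimes> H) \<boxtimes> G" "(K \<boxtimes> G) \<boxtimes> (H \<boxtimes> G)"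
    "biset_ext (biset_ext X Y) (id_biset G)" "diag_biset G K H"
    unfolding diag_biset_res
    by (intro composable_bisets.intro biset.intro res_is_biset biset_ext_is_biset id_is_biset
        finite_grp_gprod gprod_group diag_map_hom assms K.is_group H.is_group G.is_group)
  let ?\<phi> = "\<lambda>((x, y), g) q. ((ract X x (pfst (pfst q)), g \<otimes>\<^bsub>G\<^esub> psnd (pfst q)),
    (ract Y y (pfst (psnd q)), g \<otimes>\<^bsub>G\<^esub> psnd (psnd q)))"
  show ?thesis
  proof (rule C.comp_isoI[of ?\<phi>])
    fix z
    assume "z \<in> pts (restrict_left diag_map
      (biset_ext (biset_ext X (id_biset G)) (biset_ext Y (id_biset G))))"
    then obtain x g y g' where z: "z = ((x, g), (y, g'))"
      "x \<in> pts X" "y \<in> pts Y" "g \<in> carrier G" "g' \<in> carrier G"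
      by auto
    show "\<exists>p\<in>pts (biset_ext (biset_ext X Y) (id_biset G)). \<exists>q\<in>pts (diag_biset G K H). z = ?\<phi> p q"
      using z
      by (intro bexI[of _ "((x, y), \<one>\<^bsub>G\<^esub>)"] bexI[of _ "Pr (Pr \<one>\<^bsub>K\<^esub> g) (Pr \<one>\<^bsub>H\<^esub> g')"])
        (auto simp: diag_biset_def)
  next
    fix p q p' q'
    assume "p \<in> pts (biset_ext (biset_ext X Y) (id_biset G))" "q \<in> pts (diag_biset G K H)"
      "p' \<in> pts (biset_ext (biset_ext X Y) (id_biset G))" "q' \<in> pts (diag_biset G K H)"
      and eq: "?\<phi> p q = ?\<phi> p' q'"
    then obtain x y g k g1 h g2 x' y' g' k' g1' h' g2' where
      p: "p = ((x, y), g)" "p' = ((x', y'), g')"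
        "q = Pr (Pr k g1) (Pr h g2)" "q' = Pr (Pr k' g1') (Pr h' g2')" and
      mem: "x \<in> pts X" "y \<in> pts Y" "g \<in> carrier G" "x' \<in> pts X" "y' \<in> pts Y" "g' \<in> carrier G"
        "k \<in> carrier K" "g1 \<in> carrier G" "h \<in> carrier H" "g2 \<in> carrier G"
        "k' \<in> carrier K" "g1' \<in> carrier G" "h' \<in> carrier H" "g2' \<in> carrier G"
      by (auto simp: diag_biset_def elim!: gprod_carrierE)
    have e: "ract X x k = ract X x' k'" "ract Y y h = ract Y y' h'"
      "g \<otimes>\<^bsub>G\<^esub> g1 = g' \<otimes>\<^bsub>G\<^esub> g1'" "g \<otimes>\<^bsub>G\<^esub> g2 = g' \<otimes>\<^bsub>G\<^esub> g2'"
      using eq p by simp_all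
    \<comment> \<open>The second coordinates force \<open>a\<close> and \<open>b\<close>, and the coordinates \<open>g\<close> and \<open>g'\<close> force \<open>c\<close>.\<close>
    define a where "a = k \<otimes>\<^bsub>K\<^esub> inv\<^bsub>K\<^esub> k'"
    define b where "b = h \<otimes>\<^bsub>H\<^esub> inv\<^bsub>H\<^esub> h'"
    define c where "c = inv\<^bsub>G\<^esub> g \<otimes>\<^bsub>G\<^esub> g'"
    have "ract X x a = x'"
      unfolding a_def by (rule X.ract_cancel[OF K.is_group]) (use mem e(1) in auto)
    moreover have "ract Y y b = y'"
      unfolding b_def by (rule Y.ract_cancel[OF H.is_group]) (use mem e(2) in auto)
    moreover have "g \<otimes>\<^bsub>G\<^esub> c = g'"
      using mem by (simp add: c_def flip: G.m_assoc)
    moreover have "a \<otimes>\<^bsub>K\<^esub> k' = k" "b \<otimes>\<^bsub>H\<^esub> h' = h"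
      using mem by (simp_all add: a_def b_def K.m_assoc H.m_assoc)
    moreover have "c \<otimes>\<^bsub>G\<^esub> g1' = g1" "c \<otimes>\<^bsub>G\<^esub> g2' = g2"
      using mem e(3,4) by (simp_all add: c_def G.m_assoc flip: e(3,4)) (simp_all flip: G.m_assoc)
    moreover have "a \<in> carrier K" "b \<in> carrier H" "c \<in> carrier G"
      using mem by (simp_all add: a_def b_def c_def)
    ultimately show "\<exists>r\<in>carrier ((K \<boxtimes> H) \<boxtimes> G).
        ract (biset_ext (biset_ext X Y) (id_biset G)) p r = p' \<and> q = lact (diag_biset G K H) r q'"
      using p by (intro bexI[of _ "Pr (Pr a b) c"]) (auto simp: diag_biset_def)
  qed (auto simp: diag_biset_def diag_map_def X.act_mult Y.act_mult G.m_assoc elim!: gprod_carrierE)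
qed

section \<open>Composition and external product of classes\<close>

definition sum_triples :: "'a grp \<Rightarrow> 'a grp \<Rightarrow> ('a bclass \<times> 'a bclass \<times> 'a bclass) set"
  where "sum_triples H G =
    {(iso_class H G (biset_sum X Y), iso_class H G X, iso_class H G Y)
     | (X :: ('a, nat) biset) (Y :: ('a, nat) biset). is_biset H G X \<and> is_biset H G Y}"

definition add_triples :: "('k, 'm, 'p) module_scheme \<Rightarrow> ('m \<times> 'm \<times> 'm) set"
  where "add_triples M = {(b \<oplus>\<^bsub>M\<^esub> b', b, b') | b b'. b \<in> carrier M \<and> b' \<in> carrier M}"

text \<open>The relators are indexed by bisets with natural numbers as points; passing to models makes them
  available for composites and products.\<close>

lemma sum_triplesI:
  assumes X: "is_biset H G X" and Y: "is_biset H G Y"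
  shows "(iso_class H G (biset_sum X Y), iso_class H G X, iso_class H G Y) \<in> sum_triples H G"
proof -
  obtain X' :: "('a, nat) biset" where X': "is_biset H G X'" "biset_iso H G X' X"
    using X by (rule biset_nat_model)
  obtain Y' :: "('a, nat) biset" where Y': "is_biset H G Y'" "biset_iso H G Y' Y"
    using Y by (rule biset_nat_model)
  have "iso_class H G (biset_sum X' Y') = iso_class H G (biset_sum X Y)"
    "iso_class H G X' = iso_class H G X" "iso_class H G Y' = iso_class H G Y"
    using X' Y' by (simp_all add: iso_class_eq biset_sum_is_biset biset_sum_cong)
  then show ?thesis
    using X'(1) Y'(1) unfolding sum_triples_def by fastforce
qed

lemma sum_triplesE:
  assumes "(c0, c1, c2) \<in> sum_triples H G"
  obtains X Y :: "('a, nat) biset" where "is_biset H G X" "is_biset H G Y"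
    "c0 = iso_class H G (biset_sum X Y)" "c1 = iso_class H G X" "c2 = iso_class H G Y"
  using assms by (auto simp: sum_triples_def)

lemma burnside_presentation: "additive_presentation \<Z> (iso_classes H G) (sum_triples H G)"
  by (intro additive_presentation.intro additive_presentation_axioms.intro int_is_cring)
    (auto elim!: sum_triplesE intro!: iso_class_closed biset_sum_is_biset)

lemma burnside_rels_additive:
  "burnside_rels H G = additive_rels \<Z> (iso_classes H G) (sum_triples H G)"
  unfolding burnside_rels_def additive_rels_def sum_triples_def by blast

lemma kburnside_rels_additive:
  "kburnside_rels R H G = additive_rels R (carrier (burnside H G)) (add_triples (burnside H G))"
  unfolding kburnside_rels_def additive_rels_def add_triples_def by blast

lemma burnside_module: "module \<Z> (burnside H G)"
proof -
  interpret additive_presentation \<Z> "iso_classes H G" "sum_triples H G"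
    by (rule burnside_presentation)
  show ?thesis
    using pres_mod_module by (simp add: burnside_def burnside_rels_additive)
qed

lemma burn_class_closed: "is_biset H G X \<Longrightarrow> burn_class H G X \<in> carrier (burnside H G)"
proof -
  interpret additive_presentation \<Z> "iso_classes H G" "sum_triples H G"
    by (rule burnside_presentation)
  show "is_biset H G X \<Longrightarrow> burn_class H G X \<in> carrier (burnside H G)"
    unfolding burn_class_def burnside_def burnside_rels_additive
    by (intro cls_closed cring.gen_closed[OF int_is_cring] iso_class_closed)
qed

lemma kburnside_presentation:
  assumes "cring R"
  shows "additive_presentation R (carrier (burnside H G)) (add_triples (burnside H G))"
proof -
  interpret module \<Z> "burnside H G" by (rule burnside_module)
  show ?thesis
    by (intro additive_presentation.intro additive_presentation_axioms.intro assms)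
      (auto simp: add_triples_def)
qed

lemma kburnside_module:
  assumes "cring R"
  shows "module R (kburnside R H G)"
proof -
  interpret additive_presentation R "carrier (burnside H G)" "add_triples (burnside H G)"
    using assms by (rule kburnside_presentation)
  show ?thesis
    using pres_mod_module by (simp add: kburnside_def kburnside_rels_additive)
qed

lemma kclass_closed:
  assumes "cring R" "is_biset H G X"
  shows "kclass R H G X \<in> carrier (kburnside R H G)"
proof -
  interpret additive_presentation R "carrier (burnside H G)" "add_triples (burnside H G)"
    using assms(1) by (rule kburnside_presentation)
  show ?thesis
    unfolding kclass_def kburnside_def kburnside_rels_additive
    by (intro cls_closed gen_closed burn_class_closed assms)
qed

lemma kclass_eq: "is_biset H G X \<Longrightarrow> biset_iso H G X Y \<Longrightarrow> kclass R H G X = kclass R H G Y"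
  by (simp add: kclass_def burn_class_def iso_class_eq)

lemma subgroup_imp_int_submodule:
  assumes "module \<Z> M" "subgroup N (add_monoid M)"
  shows "submodule N \<Z> M"
proof -
  interpret M: module \<Z> M by fact
  interpret N: subgroup N "add_monoid M" by fact
  have sub: "x \<in> carrier M" if "x \<in> N" for x
    using that N.subset by auto
  have neg: "\<ominus>\<^bsub>M\<^esub> x \<in> N" if "x \<in> N" for x
    using N.m_inv_closed[OF that] by (simp add: a_inv_def)
  have "n \<odot>\<^bsub>M\<^esub> x \<in> N" if "x \<in> N" for n x
  proof (induction n rule: int_induct[where k = 0])
    case base
    then show ?case
      using M.smult_l_null[OF sub[OF that]] N.one_closed by simp
  next
    case (step1 i)
    have "(i + 1) \<odot>\<^bsub>M\<^esub> x = i \<odot>\<^bsub>M\<^esub> x \<oplus>\<^bsub>M\<^esub> x"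
      using M.smult_l_distr[of i 1 x] M.smult_one[OF sub[OF that]] sub[OF that] by simp
    then show ?case
      using step1 that N.m_closed by simp
  next
    case (step2 i)
    have "(i - 1) \<odot>\<^bsub>M\<^esub> x = i \<odot>\<^bsub>M\<^esub> x \<oplus>\<^bsub>M\<^esub> (- 1) \<odot>\<^bsub>M\<^esub> x"
      using M.smult_l_distr[of i "- 1" x] sub[OF that] by simp
    moreover have "(- 1) \<odot>\<^bsub>M\<^esub> x = \<ominus>\<^bsub>M\<^esub> x"
      using M.smult_l_minus[of 1 x] M.smult_one[OF sub[OF that]] sub[OF that] by simp
    ultimately show ?case
      using step2 neg[OF that] N.m_closed by simp
  qed
  then show ?thesis
    using assms(2) by (intro submodule.intro submodule_axioms.intro) auto
qed

text \<open>The generators of the scalar extension are all elements \<open>b\<close> of the Burnside group. Their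
  classes depend additively on \<open>b\<close>, so those \<open>b\<close> whose generator lies in a given submodule form a subgroup, and it is
  enough that this subgroup contains the classes of bisets.\<close>

lemma kburnside_generated:
  assumes R: "cring R" and K: "submodule K R (kburnside R H G)"
    and gens: "\<And>X :: ('a, nat) biset. is_biset H G X \<Longrightarrow> kclass R H G X \<in> K"
  shows "carrier (kburnside R H G) \<subseteq> K"
proof -
  interpret P: additive_presentation \<Z> "iso_classes H G" "sum_triples H G"
    by (rule burnside_presentation)
  interpret B: module \<Z> "burnside H G" by (rule burnside_module)
  interpret additive_presentation R "carrier (burnside H G)" "add_triples (burnside H G)"
    using R by (rule kburnside_presentation)
  interpret Q: module R Q by (rule pres_mod_module)
  have Q: "kburnside R H G = Q"
    by (simp add: kburnside_def kburnside_rels_additive)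
  have PQ: "burnside H G = P.Q"
    by (simp add: burnside_def burnside_rels_additive)
  note KE = Q.submoduleE[OF K[unfolded Q]]
  define c where "c = (\<lambda>b. cls (gen R b))"
  have c_closed: "c b \<in> carrier Q" if "b \<in> carrier (burnside H G)" for b
    unfolding c_def using that by (intro cls_closed gen_closed)
  have c_add: "c (b \<oplus>\<^bsub>burnside H G\<^esub> b') = c b \<oplus>\<^bsub>Q\<^esub> c b'"
    if "b \<in> carrier (burnside H G)" "b' \<in> carrier (burnside H G)" for b b'
    unfolding c_def using that by (intro cls_gen_add) (auto simp: add_triples_def)
  have c_zero: "c \<zero>\<^bsub>burnside H G\<^esub> = \<zero>\<^bsub>Q\<^esub>"
    using c_add[of "\<zero>\<^bsub>burnside H G\<^esub>" "\<zero>\<^bsub>burnside H G\<^esub>"] c_closed[of "\<zero>\<^bsub>burnside H G\<^esub>"]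
    by (simp add: Q.add.l_cancel_one')
  have c_minus: "c (\<ominus>\<^bsub>burnside H G\<^esub> b) = \<ominus>\<^bsub>Q\<^esub> c b" if "b \<in> carrier (burnside H G)" for b
  proof -
    have "c (\<ominus>\<^bsub>burnside H G\<^esub> b) \<oplus>\<^bsub>Q\<^esub> c b = \<zero>\<^bsub>Q\<^esub>"
      using that c_add[of "\<ominus>\<^bsub>burnside H G\<^esub> b" b] by (simp add: B.l_neg c_zero)
    then show ?thesis
      using that c_closed Q.minus_equality by simp
  qed
  have "\<zero>\<^bsub>Q\<^esub> \<in> K"
    using subgroup.one_closed[OF submodule.axioms(1)[OF K]] by (simp add: Q)
  then have "submodule {b \<in> carrier (burnside H G). c b \<in> K} \<Z> (burnside H G)"
    by (intro subgroup_imp_int_submodule B.module_axioms B.add.subgroupI)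
      (auto simp: c_add c_zero c_minus KE simp flip: a_inv_def intro!: exI[of _ "\<zero>\<^bsub>burnside H G\<^esub>"])
  then have "carrier P.Q \<subseteq> {b \<in> carrier (burnside H G). c b \<in> K}"
    unfolding PQ
  proof (rule P.pres_mod_generated)
    fix s assume "s \<in> iso_classes H G"
    then obtain X :: "('a, nat) biset" where X: "is_biset H G X" "s = iso_class H G X"
      by (rule iso_classesE)
    then show "P.cls (gen \<Z> s) \<in> {b \<in> carrier P.Q. c b \<in> K}"
      using gens[OF X(1)] burn_class_closed[OF X(1)]
      by (simp add: PQ kclass_def burn_class_def burnside_rels_additive kburnside_rels_additive c_def)
  qed
  then show ?thesis
    using K unfolding Q by (intro pres_mod_generated) (auto simp: PQ c_def)
qed

lemma kburnside_linear_eq: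
  assumes "cring R" "module R M" "f \<in> linear_maps R (kburnside R H G) M"
    "g \<in> linear_maps R (kburnside R H G) M"
    and "\<And>X :: ('a, nat) biset. is_biset H G X \<Longrightarrow> f (kclass R H G X) = g (kclass R H G X)"
    and "\<alpha> \<in> carrier (kburnside R H G)"
  shows "f \<alpha> = g \<alpha>"
proof -
  have "carrier (kburnside R H G) \<subseteq> {\<alpha> \<in> carrier (kburnside R H G). f \<alpha> = g \<alpha>}"
    using assms(1-5)
    by (intro kburnside_generated submodule_equalizer kburnside_module) (auto simp: kclass_closed)
  then show ?thesis
    using assms(6) by blast
qed

lemma kburnside_bilinear_eq:
  assumes R: "cring R" and M: "module R M"
    and f: "f \<in> bilinear_maps R (kburnside R K H) (kburnside R L G) M"
    and g: "g \<in> bilinear_maps R (kburnside R K H) (kburnside R L G) M"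
    and eq: "\<And>(Y :: ('a, nat) biset) (X :: ('a, nat) biset). is_biset K H Y \<Longrightarrow> is_biset L G X \<Longrightarrow>
      f (kclass R K H Y) (kclass R L G X) = g (kclass R K H Y) (kclass R L G X)"
    and \<beta>: "\<beta> \<in> carrier (kburnside R K H)" and \<alpha>: "\<alpha> \<in> carrier (kburnside R L G)"
  shows "f \<beta> \<alpha> = g \<beta> \<alpha>"
proof -
  have "f \<beta> (kclass R L G X) = g \<beta> (kclass R L G X)" if "is_biset L G X" for X :: "('a, nat) biset"
    using kburnside_linear_eq[OF R M bilinear_mapsD(2)[OF f] bilinear_mapsD(2)[OF g] eq \<beta>]
      kclass_closed[OF R that] that by blast
  then show ?thesis
    using kburnside_linear_eq[OF R M bilinear_mapsD(1)[OF f \<beta>] bilinear_mapsD(1)[OF g \<beta>] _ \<alpha>]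
    by blast
qed

lemma bilinear_maps_comp_linear:
  assumes "f \<in> bilinear_maps R L M N" "g \<in> linear_maps R N P"
  shows "(\<lambda>x y. g (f x y)) \<in> bilinear_maps R L M P"
  using linear_maps_comp[OF bilinear_mapsD(1)[OF assms(1)] assms(2)]
    linear_maps_comp[OF bilinear_mapsD(2)[OF assms(1)] assms(2)] by (simp add: bilinear_maps_def)

lemma bilinear_maps_precomp_linear:
  assumes "f \<in> bilinear_maps R L M N" "g \<in> linear_maps R L' L" "h \<in> linear_maps R M' M"
  shows "(\<lambda>x y. f (g x) (h y)) \<in> bilinear_maps R L' M' N"
proof -
  have "(\<lambda>y. f (g x) (h y)) \<in> linear_maps R M' N" if "x \<in> carrier L'" for x
    using linear_maps_comp[OF assms(3) bilinear_mapsD(1)[OF assms(1) linear_mapsD(1)[OF assms(2) that]]] .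
  moreover have "(\<lambda>x. f (g x) (h y)) \<in> linear_maps R L' N" if "y \<in> carrier M'" for y
    using linear_maps_comp[OF assms(2) bilinear_mapsD(2)[OF assms(1) linear_mapsD(1)[OF assms(3) that]]] .
  ultimately show ?thesis
    by (simp add: bilinear_maps_def)
qed

text \<open>All members of the two classes have isomorphic composites, so the union in the definition of
  \<open>class_comp\<close> is the union of a constant nonempty family.\<close>

lemma class_comp_iso_class:
  assumes "group H" and Y: "is_biset K H Y" and X: "is_biset H G X"
  shows "class_comp K H G (iso_class K H Y) (iso_class H G X) = iso_class K G (biset_comp H Y X)"
proof -
  interpret group H by fact
  have eq: "iso_class K G (biset_comp H Y' X') = iso_class K G (biset_comp H Y X)"
    if "Y' \<in> iso_class K H Y" "X' \<in> iso_class H G X" for Y' X'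
  proof (rule iso_class_eq)
    have YX': "is_biset K H Y'" "biset_iso K H Y' Y" "is_biset H G X'" "biset_iso H G X' X"
      using that by (auto simp: iso_class_def)
    interpret composable_bisets K H G Y' X'
      by unfold_locales (fact YX')+
    show "is_biset K G (biset_comp H Y' X')"
      by (rule comp_is_biset)
    show "biset_iso K G (biset_comp H Y' X') (biset_comp H Y X)"
      using YX' assms by (intro biset_comp_cong) auto
  qed
  show ?thesis
    unfolding class_comp_def using eq iso_class_nonempty[OF Y] iso_class_nonempty[OF X] by blast
qed

lemma class_ext_iso_class:
  assumes Y: "is_biset L K Y" and X: "is_biset H G X"
  shows "class_ext L K H G (iso_class L K Y) (iso_class H G X) =
    iso_class (L \<boxtimes> H) (K \<boxtimes> G) (biset_ext Y X)"
proof -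
  have eq: "iso_class (L \<boxtimes> H) (K \<boxtimes> G) (biset_ext Y' X') = iso_class (L \<boxtimes> H) (K \<boxtimes> G) (biset_ext Y X)"
    if "Y' \<in> iso_class L K Y" "X' \<in> iso_class H G X" for Y' X'
    using that by (intro iso_class_eq biset_ext_is_biset biset_ext_cong) (auto simp: iso_class_def)
  show ?thesis
    unfolding class_ext_def using eq iso_class_nonempty[OF Y] iso_class_nonempty[OF X] by blast
qed

lemma comp_is_biset:
  assumes "group H" "is_biset K H Y" "is_biset H G X"
  shows "is_biset K G (biset_comp H Y X)"
  using assms by (intro composable_bisets.comp_is_biset composable_bisets.intro biset.intro)

lemma class_comp_extension:
  assumes "group H"
  shows "bilinear_extension \<Z> (iso_classes K H) (sum_triples K H) (iso_classes H G) (sum_triples H G)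
    (iso_classes K G) (sum_triples K G) (class_comp K H G)"
proof (intro bilinear_extension.intro bilinear_extension_axioms.intro burnside_presentation int_is_cring)
  note [simp] = class_comp_iso_class[OF assms] biset_sum_is_biset comp_is_biset[OF assms]
  fix s t assume "s \<in> iso_classes K H" "t \<in> iso_classes H G"
  then show "class_comp K H G s t \<in> iso_classes K G"
    by (auto elim!: iso_classesE intro!: iso_class_closed)
next
  note [simp] = class_comp_iso_class[OF assms] biset_sum_is_biset comp_is_biset[OF assms]
  fix s0 s1 s2 t assume "(s0, s1, s2) \<in> sum_triples K H" "t \<in> iso_classes H G"
  then obtain Y Y' X :: "('a, nat) biset"
    where b: "is_biset K H Y" "is_biset K H Y'" "is_biset H G X"
      and "s0 = iso_class K H (biset_sum Y Y')" "s1 = iso_class K H Y" "s2 = iso_class K H Y'"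
        "t = iso_class H G X"
    by (auto elim!: sum_triplesE iso_classesE)
  moreover have "iso_class K G (biset_comp H (biset_sum Y Y') X) =
      iso_class K G (biset_sum (biset_comp H Y X) (biset_comp H Y' X))"
    using b by (intro iso_class_eq biset_comp_sum_left assms) auto
  ultimately show "(class_comp K H G s0 t, class_comp K H G s1 t, class_comp K H G s2 t) \<in> sum_triples K G"
    by (simp add: sum_triplesI)
next
  note [simp] = class_comp_iso_class[OF assms] biset_sum_is_biset comp_is_biset[OF assms]
  fix s t0 t1 t2 assume "s \<in> iso_classes K H" "(t0, t1, t2) \<in> sum_triples H G"
  then obtain Y X X' :: "('a, nat) biset"
    where b: "is_biset K H Y" "is_biset H G X" "is_biset H G X'"
      and "s = iso_class K H Y"
        "t0 = iso_class H G (biset_sum X X')" "t1 = iso_class H G X" "t2 = iso_class H G X'"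
    by (auto elim!: sum_triplesE iso_classesE)
  moreover have "iso_class K G (biset_comp H Y (biset_sum X X')) =
      iso_class K G (biset_sum (biset_comp H Y X) (biset_comp H Y X'))"
    using b by (intro iso_class_eq biset_comp_sum_right assms) auto
  ultimately show "(class_comp K H G s t0, class_comp K H G s t1, class_comp K H G s t2) \<in> sum_triples K G"
    by (simp add: sum_triplesI)
qed

lemma class_ext_extension:
  "bilinear_extension \<Z> (iso_classes L K) (sum_triples L K) (iso_classes H G) (sum_triples H G)
    (iso_classes (L \<boxtimes> H) (K \<boxtimes> G)) (sum_triples (L \<boxtimes> H) (K \<boxtimes> G)) (class_ext L K H G)"
proof (intro bilinear_extension.intro bilinear_extension_axioms.intro burnside_presentation int_is_cring)
  note [simp] = class_ext_iso_class biset_sum_is_biset biset_ext_is_biset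
  fix s t assume "s \<in> iso_classes L K" "t \<in> iso_classes H G"
  then show "class_ext L K H G s t \<in> iso_classes (L \<boxtimes> H) (K \<boxtimes> G)"
    by (auto elim!: iso_classesE intro!: iso_class_closed)
next
  note [simp] = class_ext_iso_class biset_sum_is_biset biset_ext_is_biset
  fix s0 s1 s2 t assume "(s0, s1, s2) \<in> sum_triples L K" "t \<in> iso_classes H G"
  then obtain Y Y' X :: "('a, nat) biset"
    where b: "is_biset L K Y" "is_biset L K Y'" "is_biset H G X"
      and "s0 = iso_class L K (biset_sum Y Y')" "s1 = iso_class L K Y" "s2 = iso_class L K Y'"
        "t = iso_class H G X"
    by (auto elim!: sum_triplesE iso_classesE)
  moreover have "iso_class (L \<boxtimes> H) (K \<boxtimes> G) (biset_ext (biset_sum Y Y') X) =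
      iso_class (L \<boxtimes> H) (K \<boxtimes> G) (biset_sum (biset_ext Y X) (biset_ext Y' X))"
    using b by (intro iso_class_eq biset_ext_sum_left) auto
  ultimately show "(class_ext L K H G s0 t, class_ext L K H G s1 t, class_ext L K H G s2 t)
      \<in> sum_triples (L \<boxtimes> H) (K \<boxtimes> G)"
    by (simp add: sum_triplesI)
next
  note [simp] = class_ext_iso_class biset_sum_is_biset biset_ext_is_biset
  fix s t0 t1 t2 assume "s \<in> iso_classes L K" "(t0, t1, t2) \<in> sum_triples H G"
  then obtain Y X X' :: "('a, nat) biset"
    where b: "is_biset L K Y" "is_biset H G X" "is_biset H G X'"
      and "s = iso_class L K Y"
        "t0 = iso_class H G (biset_sum X X')" "t1 = iso_class H G X" "t2 = iso_class H G X'"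
    by (auto elim!: sum_triplesE iso_classesE)
  moreover have "iso_class (L \<boxtimes> H) (K \<boxtimes> G) (biset_ext Y (biset_sum X X')) =
      iso_class (L \<boxtimes> H) (K \<boxtimes> G) (biset_sum (biset_ext Y X) (biset_ext Y X'))"
    using b by (intro iso_class_eq biset_ext_sum_right) auto
  ultimately show "(class_ext L K H G s t0, class_ext L K H G s t1, class_ext L K H G s t2)
      \<in> sum_triples (L \<boxtimes> H) (K \<boxtimes> G)"
    by (simp add: sum_triplesI)
qed

text \<open>The relators of the scalar extension express nothing but addition in the Burnside group, so the second
  stage asks only for biadditivity, which the first stage supplies.\<close>

lemma biadditive_extension:
  assumes R: "cring R"
    and f: "f \<in> bilinear_maps \<Z> (burnside K1 H1) (burnside K2 H2) (burnside K H)"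
  shows "bilinear_extension R (carrier (burnside K1 H1)) (add_triples (burnside K1 H1))
    (carrier (burnside K2 H2)) (add_triples (burnside K2 H2))
    (carrier (burnside K H)) (add_triples (burnside K H)) f"
proof (intro bilinear_extension.intro bilinear_extension_axioms.intro kburnside_presentation R)
  note lin = bilinear_mapsD[OF f]
  show "f s t \<in> carrier (burnside K H)"
    if "s \<in> carrier (burnside K1 H1)" "t \<in> carrier (burnside K2 H2)" for s t
    using lin(3) that .
  show "(f s0 t, f s1 t, f s2 t) \<in> add_triples (burnside K H)"
    if "(s0, s1, s2) \<in> add_triples (burnside K1 H1)" "t \<in> carrier (burnside K2 H2)" for s0 s1 s2 t
    using that linear_mapsD(2)[OF lin(2)] lin(3) unfolding add_triples_def by blast
  show "(f s t0, f s t1, f s t2) \<in> add_triples (burnside K H)"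
    if "s \<in> carrier (burnside K1 H1)" "(t0, t1, t2) \<in> add_triples (burnside K2 H2)" for s t0 t1 t2
    using that linear_mapsD(2)[OF lin(1)] lin(3) unfolding add_triples_def by blast
qed

lemma burn_comp_bilinear:
  assumes "group H"
  shows "burn_comp K H G \<in> bilinear_maps \<Z> (burnside K H) (burnside H G) (burnside K G)"
  using bilinear_extension.bilinear_ext_bilinear[OF class_comp_extension[OF assms]]
  by (simp add: burn_comp_def burnside_def burnside_rels_additive)

lemma burn_ext_bilinear:
  "burn_ext L K H G \<in> bilinear_maps \<Z> (burnside L K) (burnside H G) (burnside (L \<boxtimes> H) (K \<boxtimes> G))"
  using bilinear_extension.bilinear_ext_bilinear[OF class_ext_extension]
  by (simp add: burn_ext_def burnside_def burnside_rels_additive)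

lemma burn_comp_class:
  assumes "group H" "is_biset K H Y" "is_biset H G X"
  shows "burn_comp K H G (burn_class K H Y) (burn_class H G X) = burn_class K G (biset_comp H Y X)"
  using bilinear_extension.bilinear_ext_gen[OF class_comp_extension[OF assms(1)]
      iso_class_closed[OF assms(2)] iso_class_closed[OF assms(3)]]
  by (simp add: burn_comp_def burn_class_def burnside_rels_additive class_comp_iso_class assms)

lemma burn_ext_class:
  assumes "is_biset L K Y" "is_biset H G X"
  shows "burn_ext L K H G (burn_class L K Y) (burn_class H G X) =
    burn_class (L \<boxtimes> H) (K \<boxtimes> G) (biset_ext Y X)"
  using bilinear_extension.bilinear_ext_gen[OF class_ext_extension
      iso_class_closed[OF assms(1)] iso_class_closed[OF assms(2)]]
  by (simp add: burn_ext_def burn_class_def burnside_rels_additive class_ext_iso_class assms)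

lemma kcomp_bilinear:
  assumes "cring R" "group H"
  shows "kcomp R K H G \<in> bilinear_maps R (kburnside R K H) (kburnside R H G) (kburnside R K G)"
  using bilinear_extension.bilinear_ext_bilinear[OF biadditive_extension[OF assms(1)
        burn_comp_bilinear[OF assms(2)]]]
  by (simp add: kcomp_def kburnside_def kburnside_rels_additive)

lemma kext_bilinear:
  assumes "cring R"
  shows "kext R L K H G \<in>
    bilinear_maps R (kburnside R L K) (kburnside R H G) (kburnside R (L \<boxtimes> H) (K \<boxtimes> G))"
  using bilinear_extension.bilinear_ext_bilinear[OF biadditive_extension[OF assms burn_ext_bilinear]]
  by (simp add: kext_def kburnside_def kburnside_rels_additive)

lemma kcomp_class:
  assumes "cring R" "group H" "is_biset K H Y" "is_biset H G X"
  shows "kcomp R K H G (kclass R K H Y) (kclass R H G X) = kclass R K G (biset_comp H Y X)"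
  using bilinear_extension.bilinear_ext_gen[OF biadditive_extension[OF assms(1)
        burn_comp_bilinear[OF assms(2)]] burn_class_closed[OF assms(3)] burn_class_closed[OF assms(4)]]
  by (simp add: kcomp_def kclass_def kburnside_rels_additive burn_comp_class assms)

lemma kext_class:
  assumes "cring R" "is_biset L K Y" "is_biset H G X"
  shows "kext R L K H G (kclass R L K Y) (kclass R H G X) =
    kclass R (L \<boxtimes> H) (K \<boxtimes> G) (biset_ext Y X)"
  using bilinear_extension.bilinear_ext_gen[OF biadditive_extension[OF assms(1) burn_ext_bilinear]
        burn_class_closed[OF assms(2)] burn_class_closed[OF assms(3)]]
  by (simp add: kext_def kclass_def kburnside_rels_additive burn_ext_class assms)

section \<open>The objects\<close>

lemma (in biset_functor) finite_object: "H \<in> D \<Longrightarrow> finite_grp H"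
  using objects unfolding admissible_def finite_grp_def by blast

lemma (in biset_functor) gprod_object:
  assumes "K \<in> D" "H \<in> D"
  shows "K \<boxtimes> H \<in> D"
proof -
  have "(\<lambda>p. (pfst p, psnd p)) \<in> iso (K \<boxtimes> H) (K \<times>\<times> H)"
    by (rule isoI)
      (auto simp: hom_def DirProd_def elim!: gprod_carrierE
        intro!: bij_betw_byWitness[where f' = "\<lambda>(k, h). Pr k h"])
  then have "K \<boxtimes> H \<cong> K \<times>\<times> H"
    by (auto simp: is_iso_def)
  moreover have "group (K \<boxtimes> H)"
    using assms finite_object by (simp add: finite_grp_def gprod_group)
  ultimately show ?thesis
    using assms objects unfolding admissible_def by blast
qed

text \<open>The trivial group enters as the subquotient \<open>{1}/{1}\<close> of any object.\<close>

lemma (in biset_functor) triv_object: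
  assumes "G \<in> D"
  shows "triv \<in> D"
proof -
  interpret G: group G using finite_object[OF assms] by (simp add: finite_grp_def)
  let ?T = "G\<lparr>carrier := {\<one>\<^bsub>G\<^esub>}\<rparr>"
  have sub: "subgroup {\<one>\<^bsub>G\<^esub>} G"
    by (rule G.triv_subgroup)
  interpret T: group ?T
    using sub G.is_group by (rule subgroup.subgroup_is_group)
  have "{\<one>\<^bsub>G\<^esub>} \<lhd> ?T"
    using T.one_is_normal by simp
  moreover have "(\<lambda>_. {\<one>\<^bsub>G\<^esub>}) \<in> iso triv (?T Mod {\<one>\<^bsub>G\<^esub>})"
    by (auto simp: iso_def hom_def triv_def FactGroup_def RCOSETS_def r_coset_def set_mult_def bij_betw_def)
  then have "triv \<cong> ?T Mod {\<one>\<^bsub>G\<^esub>}"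
    by (auto simp: is_iso_def)
  moreover have "group (triv :: 'a grp)"
    using finite_grp_triv[where 'a = 'a] by (simp add: finite_grp_def)
  ultimately show ?thesis
    using assms sub objects unfolding admissible_def by blast
qed

section \<open>Pulling back along homomorphisms\<close>

context biset_functor
begin

lemma object_group: "H \<in> D \<Longrightarrow> group H"
  using finite_object by (simp add: finite_grp_def)

lemma fmor_linear:
  "H \<in> D \<Longrightarrow> K \<in> D \<Longrightarrow> \<alpha> \<in> carrier (kburnside R K H) \<Longrightarrow>
    fmor A H K \<alpha> \<in> linear_maps R (fobj A H) (fobj A K)"
  using bilinear_mapsD(1)[OF fmor_bilinear] .

abbreviation kres :: "'a grp \<Rightarrow> 'a grp \<Rightarrow> ('a univ \<Rightarrow> 'a univ) \<Rightarrow> ('a, 'k) kburn"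
  where "kres K H \<delta> \<equiv> kclass R K H (res_biset H \<delta>)"

text \<open>Restriction along \<open>\<delta> : K \<rightarrow> H\<close> as a map \<open>A(H) \<rightarrow> A(K)\<close>. It is contravariant in \<open>\<delta>\<close>.\<close>

definition pull :: "'a grp \<Rightarrow> 'a grp \<Rightarrow> ('a univ \<Rightarrow> 'a univ) \<Rightarrow> 'm \<Rightarrow> 'm"
  where "pull H K \<delta> = fmor A H K (kres K H \<delta>)"

lemma kres_closed: "H \<in> D \<Longrightarrow> K \<in> D \<Longrightarrow> \<delta> \<in> hom K H \<Longrightarrow> kres K H \<delta> \<in> carrier (kburnside R K H)"
  by (intro kclass_closed is_cring res_is_biset finite_object)

lemma pull_linear:
  "H \<in> D \<Longrightarrow> K \<in> D \<Longrightarrow> \<delta> \<in> hom K H \<Longrightarrow> pull H K \<delta> \<in> linear_maps R (fobj A H) (fobj A K)"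
  unfolding pull_def by (intro fmor_linear kres_closed)

lemma pull_closed:
  "H \<in> D \<Longrightarrow> K \<in> D \<Longrightarrow> \<delta> \<in> hom K H \<Longrightarrow> a \<in> carrier (fobj A H) \<Longrightarrow>
    pull H K \<delta> a \<in> carrier (fobj A K)"
  using linear_mapsD(1)[OF pull_linear] .

lemma kres_kcomp:
  assumes "H \<in> D" "K \<in> D" "\<delta> \<in> hom K H" "is_biset H G X"
  shows "kcomp R K H G (kres K H \<delta>) (kclass R H G X) = kclass R K G (restrict_left \<delta> X)"
proof -
  have "kcomp R K H G (kres K H \<delta>) (kclass R H G X) = kclass R K G (biset_comp H (res_biset H \<delta>) X)"
    using assms by (intro kcomp_class is_cring object_group res_is_biset finite_object)
  also have "\<dots> = kclass R K G (restrict_left \<delta> X)"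
    using assms
    by (intro kclass_eq comp_is_biset biset_comp_res object_group res_is_biset finite_object)
  finally show ?thesis .
qed

lemma pull_pull:
  assumes "G \<in> D" "H \<in> D" "K \<in> D" "\<delta> \<in> hom H G" "\<delta>' \<in> hom K H" "a \<in> carrier (fobj A G)"
  shows "pull H K \<delta>' (pull G H \<delta> a) = pull G K (\<lambda>k. \<delta> (\<delta>' k)) a"
proof -
  have "kcomp R K H G (kres K H \<delta>') (kres H G \<delta>) = kres K G (\<lambda>k. \<delta> (\<delta>' k))"
    using assms by (simp add: kres_kcomp res_is_biset finite_object restrict_left_restrict_left)
  then show ?thesis
    using assms fmor_comp[OF assms(1-3), of "kres K H \<delta>'" "kres H G \<delta>" a]
    by (simp add: pull_def kres_closed)
qed

lemma pull_pull_pull: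
  assumes "G \<in> D" "H \<in> D" "K \<in> D" "L \<in> D" "\<delta> \<in> hom H G" "\<delta>' \<in> hom K H" "\<delta>'' \<in> hom L K"
    and "a \<in> carrier (fobj A G)"
  shows "pull K L \<delta>'' (pull H K \<delta>' (pull G H \<delta> a)) = pull G L (\<lambda>l. \<delta> (\<delta>' (\<delta>'' l))) a"
proof -
  have "(\<lambda>k. \<delta> (\<delta>' k)) \<in> hom K G"
    using hom_compose[OF assms(6,5)] by (simp add: comp_def)
  then show ?thesis
    using assms by (simp add: pull_pull)
qed

lemma pull_cong:
  assumes "H \<in> D" "K \<in> D" "\<delta> \<in> hom K H" "\<And>k. k \<in> carrier K \<Longrightarrow> \<delta> k = \<delta>' k"
  shows "pull H K \<delta> = pull H K \<delta>'"
proof -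
  have "kres K H \<delta> = kres K H \<delta>'"
    using assms by (intro kclass_eq restrict_left_cong res_is_biset finite_object)
  then show ?thesis
    by (simp add: pull_def)
qed

lemma pull_id: "H \<in> D \<Longrightarrow> a \<in> carrier (fobj A H) \<Longrightarrow> pull H H (\<lambda>h. h) a = a"
  using fmor_id by (simp add: pull_def flip: id_biset_res)

lemma kclass_iso_biset:
  assumes "H \<in> D" "K \<in> D" "\<psi> \<in> hom H K" "\<sigma> \<in> hom K H"
    and "\<And>h. h \<in> carrier H \<Longrightarrow> \<sigma> (\<psi> h) = h" "\<And>g. g \<in> carrier K \<Longrightarrow> \<psi> (\<sigma> g) = g"
  shows "kclass R K H (iso_biset K \<psi>) = kres K H \<sigma>"
  using assms by (intro kclass_eq[symmetric] res_is_biset finite_object iso_biset_res)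

end

section \<open>The shifted functor\<close>

locale shifted_green_functor = green_biset_functor R D A
  for R :: "'k ring" (structure) and D :: "'a grp set" and A :: "('a, 'k, 'm) green_data" +
  fixes G :: "'a grp"
  assumes G_object: "G \<in> D"
begin

abbreviation A\<^sub>G :: "('a, 'k, 'm) green_data"
  where "A\<^sub>G \<equiv> shift R A G"

abbreviation ext_id :: "'a grp \<Rightarrow> 'a grp \<Rightarrow> ('a, 'k) kburn \<Rightarrow> ('a, 'k) kburn"
  where "ext_id K H \<alpha> \<equiv> kext R K H G G \<alpha> (kclass R G G (id_biset G))"

lemmas object_simps = gprod_object triv_object[OF G_object] G_object

lemma ext_id_linear:
  "H \<in> D \<Longrightarrow> K \<in> D \<Longrightarrow> ext_id K H \<in> linear_maps R (kburnside R K H) (kburnside R (K \<boxtimes> G) (H \<boxtimes> G))"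
  by (rule bilinear_mapsD(2)[OF kext_bilinear])
    (intro is_cring kclass_closed id_is_biset finite_object G_object)+

lemma ext_id_closed:
  "H \<in> D \<Longrightarrow> K \<in> D \<Longrightarrow> \<alpha> \<in> carrier (kburnside R K H) \<Longrightarrow>
    ext_id K H \<alpha> \<in> carrier (kburnside R (K \<boxtimes> G) (H \<boxtimes> G))"
  using linear_mapsD(1)[OF ext_id_linear] .

lemma ext_id_class:
  "is_biset K H X \<Longrightarrow>
    ext_id K H (kclass R K H X) = kclass R (K \<boxtimes> G) (H \<boxtimes> G) (biset_ext X (id_biset G))"
  by (intro kext_class is_cring id_is_biset finite_object G_object)

lemma kext_kres:
  assumes "K \<in> D" "H \<in> D" "K' \<in> D" "H' \<in> D" "\<delta> \<in> hom K H" "\<delta>' \<in> hom K' H'"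
  shows "kext R K H K' H' (kres K H \<delta>) (kres K' H' \<delta>') = kres (K \<boxtimes> K') (H \<boxtimes> H') (prod_map \<delta> \<delta>')"
proof -
  have "kext R K H K' H' (kres K H \<delta>) (kres K' H' \<delta>') =
      kclass R (K \<boxtimes> K') (H \<boxtimes> H') (biset_ext (res_biset H \<delta>) (res_biset H' \<delta>'))"
    using assms by (intro kext_class is_cring res_is_biset finite_object)
  also have "\<dots> = kres (K \<boxtimes> K') (H \<boxtimes> H') (prod_map \<delta> \<delta>')"
    using assms by (intro kclass_eq biset_ext_is_biset biset_ext_res res_is_biset finite_object)
  finally show ?thesis .
qed

lemma ext_id_kres:
  assumes "K \<in> D" "H \<in> D" "\<delta> \<in> hom K H"
  shows "ext_id K H (kres K H \<delta>) = kres (K \<boxtimes> G) (H \<boxtimes> G) (prod_map \<delta> (\<lambda>g. g))"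
  using kext_kres[OF assms(1,2) G_object G_object assms(3), of "\<lambda>g. g"]
  by (simp add: hom_def flip: id_biset_res)

lemma ext_prod_closed:
  "K \<in> D \<Longrightarrow> H \<in> D \<Longrightarrow> a \<in> carrier (fobj A K) \<Longrightarrow> b \<in> carrier (fobj A H) \<Longrightarrow>
    ext_prod A K H a b \<in> carrier (fobj A (K \<boxtimes> H))"
  using bilinear_mapsD(3)[OF ext_prod_bilinear] .

lemma ext_prod_pull:
  assumes "K \<in> D" "H \<in> D" "T \<in> D" "L \<in> D" "\<delta> \<in> hom T K" "\<delta>' \<in> hom L H"
    and "a \<in> carrier (fobj A K)" "b \<in> carrier (fobj A H)"
  shows "ext_prod A T L (pull K T \<delta> a) (pull H L \<delta>' b) =
    pull (K \<boxtimes> H) (T \<boxtimes> L) (prod_map \<delta> \<delta>') (ext_prod A K H a b)"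
  using ext_prod_functorial[of K T H L "kres T K \<delta>" "kres L H \<delta>'" a b] assms
  by (simp add: pull_def kext_kres kres_closed)

lemma shift_simps:
  "fobj A\<^sub>G H = fobj A (H \<boxtimes> G)"
  "fmor A\<^sub>G H K \<alpha> = fmor A (H \<boxtimes> G) (K \<boxtimes> G) (ext_id K H \<alpha>)"
  "ext_prod A\<^sub>G K H a b =
    pull ((K \<boxtimes> G) \<boxtimes> (H \<boxtimes> G)) ((K \<boxtimes> H) \<boxtimes> G) diag_map (ext_prod A (K \<boxtimes> G) (H \<boxtimes> G) a b)"
  "unit_elt A\<^sub>G = pull triv (triv \<boxtimes> G) pfst (unit_elt A)"
  by (simp_all add: shift_def pull_def diag_biset_res inf_biset_res)

lemma shift_fmor_kres:
  assumes "H \<in> D" "K \<in> D" "\<delta> \<in> hom K H"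
  shows "fmor A\<^sub>G H K (kres K H \<delta>) = pull (H \<boxtimes> G) (K \<boxtimes> G) (prod_map \<delta> (\<lambda>g. g))"
  using assms by (simp add: shift_simps ext_id_kres pull_def)

lemma id_hom: "(\<lambda>g. g) \<in> hom H H"
  by (simp add: hom_def)

text \<open>For bisets this is the interchange law together with \<open>G \<times>\<^sub>G G \<cong> G\<close>.\<close>

lemma ext_id_kcomp:
  assumes D: "H \<in> D" "K \<in> D" "L \<in> D"
    and \<beta>: "\<beta> \<in> carrier (kburnside R L K)" and \<alpha>: "\<alpha> \<in> carrier (kburnside R K H)"
  shows "ext_id L H (kcomp R L K H \<beta> \<alpha>) =
    kcomp R (L \<boxtimes> G) (K \<boxtimes> G) (H \<boxtimes> G) (ext_id L K \<beta>) (ext_id K H \<alpha>)"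
proof (rule kburnside_bilinear_eq[OF is_cring kburnside_module[OF is_cring] _ _ _ \<beta> \<alpha>])
  show "(\<lambda>\<beta> \<alpha>. ext_id L H (kcomp R L K H \<beta> \<alpha>))
      \<in> bilinear_maps R (kburnside R L K) (kburnside R K H) (kburnside R (L \<boxtimes> G) (H \<boxtimes> G))"
    using D by (intro bilinear_maps_comp_linear[OF kcomp_bilinear] ext_id_linear is_cring object_group)
  show "(\<lambda>\<beta> \<alpha>. kcomp R (L \<boxtimes> G) (K \<boxtimes> G) (H \<boxtimes> G) (ext_id L K \<beta>) (ext_id K H \<alpha>))
      \<in> bilinear_maps R (kburnside R L K) (kburnside R K H) (kburnside R (L \<boxtimes> G) (H \<boxtimes> G))"
    using D by (intro bilinear_maps_precomp_linear[OF kcomp_bilinear] ext_id_linear is_cring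
        object_group object_simps)
  fix Y X :: "('a, nat) biset"
  assume YX: "is_biset L K Y" "is_biset K H X"
  note fin = D[THEN finite_object] D[THEN object_group] finite_object[OF G_object] object_group[OF G_object]
  have X: "is_biset K H X" "is_biset L K Y" "is_biset G G (id_biset G)"
    by (intro YX id_is_biset fin)+
  let ?I = "id_biset G"
  have "ext_id L H (kcomp R L K H (kclass R L K Y) (kclass R K H X)) =
      kclass R (L \<boxtimes> G) (H \<boxtimes> G) (biset_ext (biset_comp K Y X) ?I)"
    using X by (simp add: kcomp_class is_cring fin ext_id_class comp_is_biset)
  also have "\<dots> = kclass R (L \<boxtimes> G) (H \<boxtimes> G) (biset_ext (biset_comp K Y X) (biset_comp G ?I ?I))"
  proof (rule kclass_eq[symmetric])
    have "biset_iso G G (biset_comp G ?I ?I) ?I"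
      using biset_comp_res[OF fin(7,7) id_hom X(3)] by (simp flip: id_biset_res)
    then show "biset_iso (L \<boxtimes> G) (H \<boxtimes> G) (biset_ext (biset_comp K Y X) (biset_comp G ?I ?I))
        (biset_ext (biset_comp K Y X) ?I)"
      by (intro biset_ext_cong biset_iso_refl)
    show "is_biset (L \<boxtimes> G) (H \<boxtimes> G) (biset_ext (biset_comp K Y X) (biset_comp G ?I ?I))"
      by (intro biset_ext_is_biset comp_is_biset X fin)
  qed
  also have "\<dots> = kclass R (L \<boxtimes> G) (H \<boxtimes> G) (biset_comp (K \<boxtimes> G) (biset_ext Y ?I) (biset_ext X ?I))"
    by (rule kclass_eq[symmetric])
      (intro biset_ext_comp comp_is_biset gprod_group biset_ext_is_biset X fin)+
  also have "\<dots> = kcomp R (L \<boxtimes> G) (K \<boxtimes> G) (H \<boxtimes> G) (ext_id L K (kclass R L K Y)) (ext_id K H (kclass R K H X))"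
    using X by (simp add: kcomp_class is_cring fin ext_id_class biset_ext_is_biset gprod_group)
  finally show "ext_id L H (kcomp R L K H (kclass R L K Y) (kclass R K H X)) = \<dots>" .
qed

lemma shift_biset_functor: "biset_functor R D A\<^sub>G"
proof (intro biset_functor.intro biset_functor_axioms.intro is_cring objects)
  fix H assume H: "H \<in> D"
  then show "module R (fobj A\<^sub>G H)"
    by (simp add: shift_simps fobj_module object_simps)
  fix a assume a: "a \<in> carrier (fobj A\<^sub>G H)"
  have "pull (H \<boxtimes> G) (H \<boxtimes> G) (prod_map (\<lambda>h. h) (\<lambda>g. g)) = pull (H \<boxtimes> G) (H \<boxtimes> G) (\<lambda>h. h)"
    using H by (intro pull_cong prod_map_hom id_hom object_simps) (auto simp: prod_map_def gprod_eta)
  then show "fmor A\<^sub>G H H (kclass R H H (id_biset H)) a = a"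
    using H a by (subst id_biset_res) (simp add: shift_fmor_kres shift_simps(1) id_hom object_simps pull_id)
next
  fix H K assume HK: "H \<in> D" "K \<in> D"
  have "(\<lambda>\<alpha> a. fmor A (H \<boxtimes> G) (K \<boxtimes> G) (ext_id K H \<alpha>) a)
      \<in> bilinear_maps R (kburnside R K H) (fobj A (H \<boxtimes> G)) (fobj A (K \<boxtimes> G))"
    using HK
    by (intro bilinear_maps_precomp_linear[OF fmor_bilinear, where h = "\<lambda>a. a"] ext_id_linear object_simps)
      (simp_all add: linear_maps_def)
  then show "fmor A\<^sub>G H K \<in> bilinear_maps R (kburnside R K H) (fobj A\<^sub>G H) (fobj A\<^sub>G K)"
    by (simp add: shift_def)
next
  fix H K L \<beta> \<alpha> a
  assume "H \<in> D" "K \<in> D" "L \<in> D" "\<beta> \<in> carrier (kburnside R L K)" "\<alpha> \<in> carrier (kburnside R K H)"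
    "a \<in> carrier (fobj A\<^sub>G H)"
  then show "fmor A\<^sub>G H L (kcomp R L K H \<beta> \<alpha>) a = fmor A\<^sub>G K L \<beta> (fmor A\<^sub>G H K \<alpha> a)"
    by (simp add: shift_simps ext_id_kcomp fmor_comp ext_id_closed object_simps)
qed

text \<open>Naturality of the diagonal biset. Both sides are bilinear in \<open>\<alpha>\<close> and \<open>\<beta>\<close>, so it suffices to compare them on
  bisets, where both are the restriction of \<open>(X \<times> G) \<times> (Y \<times> G)\<close> along the diagonal map.\<close>

lemma ext_id_kext_diag:
  assumes D: "K \<in> D" "T \<in> D" "H \<in> D" "L \<in> D"
    and \<alpha>: "\<alpha> \<in> carrier (kburnside R T K)" and \<beta>: "\<beta> \<in> carrier (kburnside R L H)"
  shows "kcomp R ((T \<boxtimes> L) \<boxtimes> G) ((K \<boxtimes> H) \<boxtimes> G) ((K \<boxtimes> G) \<boxtimes> (H \<boxtimes> G))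
      (ext_id (T \<boxtimes> L) (K \<boxtimes> H) (kext R T K L H \<alpha> \<beta>))
      (kres ((K \<boxtimes> H) \<boxtimes> G) ((K \<boxtimes> G) \<boxtimes> (H \<boxtimes> G)) diag_map) =
    kcomp R ((T \<boxtimes> L) \<boxtimes> G) ((T \<boxtimes> G) \<boxtimes> (L \<boxtimes> G)) ((K \<boxtimes> G) \<boxtimes> (H \<boxtimes> G))
      (kres ((T \<boxtimes> L) \<boxtimes> G) ((T \<boxtimes> G) \<boxtimes> (L \<boxtimes> G)) diag_map)
      (kext R (T \<boxtimes> G) (K \<boxtimes> G) (L \<boxtimes> G) (H \<boxtimes> G) (ext_id T K \<alpha>) (ext_id L H \<beta>))"
    (is "?f \<alpha> \<beta> = ?g \<alpha> \<beta>")
proof (rule kburnside_bilinear_eq[OF is_cring kburnside_module[OF is_cring] _ _ _ \<alpha> \<beta>, of ?f _ _ ?g])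
  note fin = D[THEN finite_object] finite_object[OF G_object]
  note obj = D G_object
  show "?f \<in> bilinear_maps R (kburnside R T K) (kburnside R L H)
      (kburnside R ((T \<boxtimes> L) \<boxtimes> G) ((K \<boxtimes> G) \<boxtimes> (H \<boxtimes> G)))"
    by (intro bilinear_maps_comp_linear[OF bilinear_maps_comp_linear[OF kext_bilinear ext_id_linear]
          bilinear_mapsD(2)[OF kcomp_bilinear]]
        is_cring object_group gprod_object obj kres_closed diag_map_hom)
  show "?g \<in> bilinear_maps R (kburnside R T K) (kburnside R L H)
      (kburnside R ((T \<boxtimes> L) \<boxtimes> G) ((K \<boxtimes> G) \<boxtimes> (H \<boxtimes> G)))"
    by (intro bilinear_maps_comp_linear[OF bilinear_maps_precomp_linear[OF kext_bilinear
            ext_id_linear ext_id_linear] bilinear_mapsD(1)[OF kcomp_bilinear]]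
        is_cring object_group gprod_object obj kres_closed diag_map_hom)
  fix X Y :: "('a, nat) biset"
  assume XY: "is_biset T K X" "is_biset L H Y"
  have bis: "is_biset T K X" "is_biset L H Y" "is_biset G G (id_biset G)"
    "is_biset ((K \<boxtimes> H) \<boxtimes> G) ((K \<boxtimes> G) \<boxtimes> (H \<boxtimes> G)) (res_biset ((K \<boxtimes> G) \<boxtimes> (H \<boxtimes> G)) diag_map)"
    by (intro XY id_is_biset res_is_biset finite_object gprod_object obj diag_map_hom)+
  note [simp] = bis biset_ext_is_biset is_cring object_group gprod_object obj
  have "?f (kclass R T K X) (kclass R L H Y) =
      kclass R ((T \<boxtimes> L) \<boxtimes> G) ((K \<boxtimes> G) \<boxtimes> (H \<boxtimes> G))
        (biset_comp ((K \<boxtimes> H) \<boxtimes> G) (biset_ext (biset_ext X Y) (id_biset G)) (diag_biset G K H))"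
    by (simp add: kext_class ext_id_class kcomp_class diag_biset_res)
  also have "\<dots> = kclass R ((T \<boxtimes> L) \<boxtimes> G) ((K \<boxtimes> G) \<boxtimes> (H \<boxtimes> G))
      (restrict_left diag_map (biset_ext (biset_ext X (id_biset G)) (biset_ext Y (id_biset G))))"
    by (intro kclass_eq biset_ext_diag_natural comp_is_biset fin)
      (simp_all add: diag_biset_res)
  also have "\<dots> = ?g (kclass R T K X) (kclass R L H Y)"
    by (simp add: kext_class ext_id_class kres_kcomp diag_map_hom)
  finally show "?f (kclass R T K X) (kclass R L H Y) = ?g (kclass R T K X) (kclass R L H Y)" .
qed

lemma shift_functorial:
  assumes D: "K \<in> D" "T \<in> D" "H \<in> D" "L \<in> D"
    and \<alpha>: "\<alpha> \<in> carrier (kburnside R T K)" and \<beta>: "\<beta> \<in> carrier (kburnside R L H)"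
    and a: "a \<in> carrier (fobj A\<^sub>G K)" and b: "b \<in> carrier (fobj A\<^sub>G H)"
  shows "fmor A\<^sub>G (K \<boxtimes> H) (T \<boxtimes> L) (kext R T K L H \<alpha> \<beta>) (ext_prod A\<^sub>G K H a b) =
    ext_prod A\<^sub>G T L (fmor A\<^sub>G K T \<alpha> a) (fmor A\<^sub>G H L \<beta> b)"
proof -
  note obj = D G_object gprod_object
  let ?ab = "ext_prod A (K \<boxtimes> G) (H \<boxtimes> G) a b"
  have ab: "?ab \<in> carrier (fobj A ((K \<boxtimes> G) \<boxtimes> (H \<boxtimes> G)))"
    using a b by (intro ext_prod_closed obj) (simp_all add: shift_simps)
  have \<alpha>\<beta>: "kext R T K L H \<alpha> \<beta> \<in> carrier (kburnside R (T \<boxtimes> L) (K \<boxtimes> H))"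
    by (rule bilinear_mapsD(3)[OF kext_bilinear[OF is_cring] \<alpha> \<beta>])
  have \<alpha>\<beta>G: "kext R (T \<boxtimes> G) (K \<boxtimes> G) (L \<boxtimes> G) (H \<boxtimes> G) (ext_id T K \<alpha>) (ext_id L H \<beta>)
      \<in> carrier (kburnside R ((T \<boxtimes> G) \<boxtimes> (L \<boxtimes> G)) ((K \<boxtimes> G) \<boxtimes> (H \<boxtimes> G)))"
    by (rule bilinear_mapsD(3)[OF kext_bilinear[OF is_cring]]) (intro ext_id_closed obj \<alpha> \<beta>)+
  have "fmor A\<^sub>G (K \<boxtimes> H) (T \<boxtimes> L) (kext R T K L H \<alpha> \<beta>) (ext_prod A\<^sub>G K H a b) =
      fmor A ((K \<boxtimes> G) \<boxtimes> (H \<boxtimes> G)) ((T \<boxtimes> L) \<boxtimes> G)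
        (kcomp R ((T \<boxtimes> L) \<boxtimes> G) ((K \<boxtimes> H) \<boxtimes> G) ((K \<boxtimes> G) \<boxtimes> (H \<boxtimes> G))
          (ext_id (T \<boxtimes> L) (K \<boxtimes> H) (kext R T K L H \<alpha> \<beta>))
          (kres ((K \<boxtimes> H) \<boxtimes> G) ((K \<boxtimes> G) \<boxtimes> (H \<boxtimes> G)) diag_map)) ?ab"
    unfolding shift_simps pull_def
    by (rule fmor_comp[symmetric]) (intro obj kres_closed diag_map_hom ext_id_closed \<alpha>\<beta> ab)+
  also have "\<dots> = fmor A ((K \<boxtimes> G) \<boxtimes> (H \<boxtimes> G)) ((T \<boxtimes> L) \<boxtimes> G)
      (kcomp R ((T \<boxtimes> L) \<boxtimes> G) ((T \<boxtimes> G) \<boxtimes> (L \<boxtimes> G)) ((K \<boxtimes> G) \<boxtimes> (H \<boxtimes> G))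
        (kres ((T \<boxtimes> L) \<boxtimes> G) ((T \<boxtimes> G) \<boxtimes> (L \<boxtimes> G)) diag_map)
        (kext R (T \<boxtimes> G) (K \<boxtimes> G) (L \<boxtimes> G) (H \<boxtimes> G) (ext_id T K \<alpha>) (ext_id L H \<beta>))) ?ab"
    using ext_id_kext_diag[OF D \<alpha> \<beta>] by simp
  also have "\<dots> = pull ((T \<boxtimes> G) \<boxtimes> (L \<boxtimes> G)) ((T \<boxtimes> L) \<boxtimes> G) diag_map
      (fmor A ((K \<boxtimes> G) \<boxtimes> (H \<boxtimes> G)) ((T \<boxtimes> G) \<boxtimes> (L \<boxtimes> G))
        (kext R (T \<boxtimes> G) (K \<boxtimes> G) (L \<boxtimes> G) (H \<boxtimes> G) (ext_id T K \<alpha>) (ext_id L H \<beta>)) ?ab)"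
    unfolding pull_def by (rule fmor_comp) (intro obj kres_closed diag_map_hom \<alpha>\<beta>G ab)+
  also have "\<dots> = ext_prod A\<^sub>G T L (fmor A\<^sub>G K T \<alpha> a) (fmor A\<^sub>G H L \<beta> b)"
    unfolding shift_simps
    by (subst ext_prod_functorial)
      (use a b in \<open>simp_all add: obj ext_id_closed \<alpha> \<beta> shift_simps\<close>)
  finally show ?thesis .
qed

lemma assoc_unassoc:
  "x \<in> carrier (L \<boxtimes> (K \<boxtimes> H)) \<Longrightarrow> unassoc_map (assoc_map x) = x"
  "y \<in> carrier ((L \<boxtimes> K) \<boxtimes> H) \<Longrightarrow> assoc_map (unassoc_map y) = y"
  by (auto simp: assoc_map_def unassoc_map_def elim!: gprod_carrierE)

lemma ext_prod_assoc_pull: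
  assumes "L \<in> D" "K \<in> D" "H \<in> D"
    and "a \<in> carrier (fobj A L)" "b \<in> carrier (fobj A K)" "c \<in> carrier (fobj A H)"
  shows "ext_prod A (L \<boxtimes> K) H (ext_prod A L K a b) c =
    pull (L \<boxtimes> (K \<boxtimes> H)) ((L \<boxtimes> K) \<boxtimes> H) unassoc_map (ext_prod A L (K \<boxtimes> H) a (ext_prod A K H b c))"
  using kclass_iso_biset[of "L \<boxtimes> (K \<boxtimes> H)" "(L \<boxtimes> K) \<boxtimes> H" assoc_map unassoc_map] ext_prod_assoc[OF assms] assms
  by (simp add: gprod_object assoc_map_hom unassoc_map_hom assoc_unassoc pull_def)

text \<open>Functoriality of the product of \<open>A\<close> moves all bisets in front of one triple product, and the two sides
  become restrictions along two maps, both of which send \<open>(((l, k), h), g)\<close> to \<open>((l, g), ((k, g), (h, g)))\<close>.\<close>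

lemma shift_assoc:
  assumes D: "L \<in> D" "K \<in> D" "H \<in> D"
    and a: "a \<in> carrier (fobj A\<^sub>G L)" and b: "b \<in> carrier (fobj A\<^sub>G K)" and c: "c \<in> carrier (fobj A\<^sub>G H)"
  shows "ext_prod A\<^sub>G (L \<boxtimes> K) H (ext_prod A\<^sub>G L K a b) c =
    fmor A\<^sub>G (L \<boxtimes> (K \<boxtimes> H)) ((L \<boxtimes> K) \<boxtimes> H)
      (kclass R ((L \<boxtimes> K) \<boxtimes> H) (L \<boxtimes> (K \<boxtimes> H)) (iso_biset ((L \<boxtimes> K) \<boxtimes> H) assoc_map))
      (ext_prod A\<^sub>G L (K \<boxtimes> H) a (ext_prod A\<^sub>G K H b c))"
proof -
  note obj = D G_object gprod_object
  note homs = diag_map_hom unassoc_map_hom prod_map_hom id_hom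
  note abc = a[unfolded shift_simps] b[unfolded shift_simps] c[unfolded shift_simps]
  let ?L = "L \<boxtimes> G" and ?K = "K \<boxtimes> G" and ?H = "H \<boxtimes> G"
  let ?bc = "ext_prod A ?K ?H b c"
  let ?abc = "ext_prod A ?L (?K \<boxtimes> ?H) a ?bc"
  have bc: "?bc \<in> carrier (fobj A (?K \<boxtimes> ?H))" and ab: "ext_prod A ?L ?K a b \<in> carrier (fobj A (?L \<boxtimes> ?K))"
    by (intro ext_prod_closed obj abc)+
  have abc': "?abc \<in> carrier (fobj A (?L \<boxtimes> (?K \<boxtimes> ?H)))"
    and abc'': "ext_prod A (?L \<boxtimes> ?K) ?H (ext_prod A ?L ?K a b) c \<in> carrier (fobj A ((?L \<boxtimes> ?K) \<boxtimes> ?H))"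
    by (intro ext_prod_closed obj abc ab bc)+
  have "ext_prod A\<^sub>G (L \<boxtimes> K) H (ext_prod A\<^sub>G L K a b) c =
      pull (((L \<boxtimes> K) \<boxtimes> G) \<boxtimes> ?H) (((L \<boxtimes> K) \<boxtimes> H) \<boxtimes> G) diag_map
        (ext_prod A ((L \<boxtimes> K) \<boxtimes> G) ?H
          (pull (?L \<boxtimes> ?K) ((L \<boxtimes> K) \<boxtimes> G) diag_map (ext_prod A ?L ?K a b)) (pull ?H ?H (\<lambda>h. h) c))"
    by (simp add: shift_simps pull_id obj abc)
  also have "\<dots> = pull (((L \<boxtimes> K) \<boxtimes> G) \<boxtimes> ?H) (((L \<boxtimes> K) \<boxtimes> H) \<boxtimes> G) diag_map
      (pull ((?L \<boxtimes> ?K) \<boxtimes> ?H) (((L \<boxtimes> K) \<boxtimes> G) \<boxtimes> ?H) (prod_map diag_map (\<lambda>h. h))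
        (pull (?L \<boxtimes> (?K \<boxtimes> ?H)) ((?L \<boxtimes> ?K) \<boxtimes> ?H) unassoc_map ?abc))"
    by (simp add: ext_prod_pull obj homs ab abc ext_prod_assoc_pull)
  also have "\<dots> = pull (?L \<boxtimes> (?K \<boxtimes> ?H)) (((L \<boxtimes> K) \<boxtimes> H) \<boxtimes> G)
      (\<lambda>p. unassoc_map (prod_map diag_map (\<lambda>h. h) (diag_map p))) ?abc"
    using abc' by (simp add: pull_pull_pull obj homs)
  \<comment> \<open>The two maps agree on all arguments, as both are built from projections and pairing.\<close>
  also have "\<dots> = pull (?L \<boxtimes> (?K \<boxtimes> ?H)) (((L \<boxtimes> K) \<boxtimes> H) \<boxtimes> G)
      (\<lambda>p. prod_map (\<lambda>h. h) diag_map (diag_map (prod_map unassoc_map (\<lambda>g. g) p))) ?abc"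
    by (simp add: unassoc_map_def prod_map_def diag_map_def)
  also have "\<dots> = pull ((L \<boxtimes> (K \<boxtimes> H)) \<boxtimes> G) (((L \<boxtimes> K) \<boxtimes> H) \<boxtimes> G) (prod_map unassoc_map (\<lambda>g. g))
      (pull (?L \<boxtimes> ((K \<boxtimes> H) \<boxtimes> G)) ((L \<boxtimes> (K \<boxtimes> H)) \<boxtimes> G) diag_map
        (pull (?L \<boxtimes> (?K \<boxtimes> ?H)) (?L \<boxtimes> ((K \<boxtimes> H) \<boxtimes> G)) (prod_map (\<lambda>h. h) diag_map) ?abc))"
    using abc' by (simp add: pull_pull_pull obj homs)
  also have "\<dots> = pull ((L \<boxtimes> (K \<boxtimes> H)) \<boxtimes> G) (((L \<boxtimes> K) \<boxtimes> H) \<boxtimes> G) (prod_map unassoc_map (\<lambda>g. g))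
      (pull (?L \<boxtimes> ((K \<boxtimes> H) \<boxtimes> G)) ((L \<boxtimes> (K \<boxtimes> H)) \<boxtimes> G) diag_map
        (ext_prod A ?L ((K \<boxtimes> H) \<boxtimes> G) (pull ?L ?L (\<lambda>h. h) a)
          (pull (?K \<boxtimes> ?H) ((K \<boxtimes> H) \<boxtimes> G) diag_map ?bc)))"
    by (subst ext_prod_pull) (simp_all add: obj homs abc bc)
  also have "\<dots> = fmor A\<^sub>G (L \<boxtimes> (K \<boxtimes> H)) ((L \<boxtimes> K) \<boxtimes> H)
      (kclass R ((L \<boxtimes> K) \<boxtimes> H) (L \<boxtimes> (K \<boxtimes> H)) (iso_biset ((L \<boxtimes> K) \<boxtimes> H) assoc_map))
      (ext_prod A\<^sub>G L (K \<boxtimes> H) a (ext_prod A\<^sub>G K H b c))"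
    by (subst kclass_iso_biset[where \<sigma> = unassoc_map])
      (simp_all add: shift_fmor_kres obj assoc_map_hom unassoc_map_hom assoc_unassoc shift_simps(1,3,4) pull_id abc)
  finally show ?thesis .
qed

lemma triv_homs:
  "Pr Point \<in> hom H (triv \<boxtimes> H)" "(\<lambda>h. Pr h Point) \<in> hom H (H \<boxtimes> triv)"
  by (auto simp: hom_def triv_def)

lemma triv_gprod_inverse:
  "x \<in> carrier (triv \<boxtimes> H) \<Longrightarrow> Pr Point (psnd x) = x"
  "x \<in> carrier (H \<boxtimes> triv) \<Longrightarrow> Pr (pfst x) Point = x"
  by (auto simp: triv_def elim!: gprod_carrierE)

lemma ext_prod_unit_pull:
  assumes "H \<in> D" "a \<in> carrier (fobj A H)"
  shows "pull (triv \<boxtimes> H) H (Pr Point) (ext_prod A triv H (unit_elt A) a) = a"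
    and "pull (H \<boxtimes> triv) H (\<lambda>h. Pr h Point) (ext_prod A H triv a (unit_elt A)) = a"
  using ext_prod_unit_left[OF assms] ext_prod_unit_right[OF assms] assms
    kclass_iso_biset[of "triv \<boxtimes> H" H psnd "Pr Point"]
    kclass_iso_biset[of "H \<boxtimes> triv" H pfst "\<lambda>h. Pr h Point"]
  by (simp_all add: object_simps projection_homs triv_homs triv_gprod_inverse pull_def)

text \<open>The composite map sends \<open>(h, g)\<close> through \<open>((1, h), g)\<close> and \<open>((1, g), (h, g))\<close> to \<open>(1, (h, g))\<close>, which is the map
  in the unit law of \<open>A\<close> at \<open>H \<boxtimes> G\<close>.\<close>

lemma shift_unit_left:
  assumes H: "H \<in> D" and a: "a \<in> carrier (fobj A\<^sub>G H)"
  shows "fmor A\<^sub>G (triv \<boxtimes> H) H (kclass R H (triv \<boxtimes> H) (iso_biset H psnd))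
    (ext_prod A\<^sub>G triv H (unit_elt A\<^sub>G) a) = a"
proof -
  note obj = H object_simps
  note homs = diag_map_hom prod_map_hom projection_homs triv_homs id_hom
  have a': "a \<in> carrier (fobj A (H \<boxtimes> G))"
    using a by (simp add: shift_simps)
  let ?e = "ext_prod A triv (H \<boxtimes> G) (unit_elt A) a"
  have e: "?e \<in> carrier (fobj A (triv \<boxtimes> (H \<boxtimes> G)))"
    by (intro ext_prod_closed obj unit_closed a')
  have "fmor A\<^sub>G (triv \<boxtimes> H) H (kclass R H (triv \<boxtimes> H) (iso_biset H psnd))
      (ext_prod A\<^sub>G triv H (unit_elt A\<^sub>G) a) =
    pull ((triv \<boxtimes> H) \<boxtimes> G) (H \<boxtimes> G) (prod_map (Pr Point) (\<lambda>g. g))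
      (pull ((triv \<boxtimes> G) \<boxtimes> (H \<boxtimes> G)) ((triv \<boxtimes> H) \<boxtimes> G) diag_map
        (ext_prod A (triv \<boxtimes> G) (H \<boxtimes> G) (pull triv (triv \<boxtimes> G) pfst (unit_elt A))
          (pull (H \<boxtimes> G) (H \<boxtimes> G) (\<lambda>h. h) a)))"
    by (subst kclass_iso_biset[where \<sigma> = "Pr Point"])
      (simp_all add: shift_fmor_kres obj homs triv_gprod_inverse shift_simps(1,3,4) pull_id a')
  also have "\<dots> = pull ((triv \<boxtimes> H) \<boxtimes> G) (H \<boxtimes> G) (prod_map (Pr Point) (\<lambda>g. g))
      (pull ((triv \<boxtimes> G) \<boxtimes> (H \<boxtimes> G)) ((triv \<boxtimes> H) \<boxtimes> G) diag_map
        (pull (triv \<boxtimes> (H \<boxtimes> G)) ((triv \<boxtimes> G) \<boxtimes> (H \<boxtimes> G)) (prod_map pfst (\<lambda>h. h)) ?e))"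
    by (subst ext_prod_pull) (simp_all add: obj homs a' unit_closed)
  also have "\<dots> = pull (triv \<boxtimes> (H \<boxtimes> G)) (H \<boxtimes> G)
      (\<lambda>p. prod_map pfst (\<lambda>h. h) (diag_map (prod_map (Pr Point) (\<lambda>g. g) p))) ?e"
    using e by (simp add: pull_pull_pull obj homs)
  also have "\<dots> = pull (triv \<boxtimes> (H \<boxtimes> G)) (H \<boxtimes> G) (Pr Point) ?e"
    by (subst pull_cong[of _ _ "Pr Point"])
      (simp_all add: obj homs prod_map_def diag_map_def gprod_eta)
  also have "\<dots> = a"
    using ext_prod_unit_pull(1) a' obj by blast
  finally show ?thesis .
qed

lemma shift_unit_right:
  assumes H: "H \<in> D" and a: "a \<in> carrier (fobj A\<^sub>G H)"
  shows "fmor A\<^sub>G (H \<boxtimes> triv) H (kclass R H (H \<boxtimes> triv) (iso_biset H pfst))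
    (ext_prod A\<^sub>G H triv a (unit_elt A\<^sub>G)) = a"
proof -
  note obj = H object_simps
  note homs = diag_map_hom prod_map_hom projection_homs triv_homs id_hom
  have a': "a \<in> carrier (fobj A (H \<boxtimes> G))"
    using a by (simp add: shift_simps)
  let ?e = "ext_prod A (H \<boxtimes> G) triv a (unit_elt A)"
  have e: "?e \<in> carrier (fobj A ((H \<boxtimes> G) \<boxtimes> triv))"
    by (intro ext_prod_closed obj unit_closed a')
  have "fmor A\<^sub>G (H \<boxtimes> triv) H (kclass R H (H \<boxtimes> triv) (iso_biset H pfst))
      (ext_prod A\<^sub>G H triv a (unit_elt A\<^sub>G)) =
    pull ((H \<boxtimes> triv) \<boxtimes> G) (H \<boxtimes> G) (prod_map (\<lambda>h. Pr h Point) (\<lambda>g. g))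
      (pull ((H \<boxtimes> G) \<boxtimes> (triv \<boxtimes> G)) ((H \<boxtimes> triv) \<boxtimes> G) diag_map
        (ext_prod A (H \<boxtimes> G) (triv \<boxtimes> G) (pull (H \<boxtimes> G) (H \<boxtimes> G) (\<lambda>h. h) a)
          (pull triv (triv \<boxtimes> G) pfst (unit_elt A))))"
    by (subst kclass_iso_biset[where \<sigma> = "\<lambda>h. Pr h Point"])
      (simp_all add: shift_fmor_kres obj homs triv_gprod_inverse shift_simps(1,3,4) pull_id a')
  also have "\<dots> = pull ((H \<boxtimes> triv) \<boxtimes> G) (H \<boxtimes> G) (prod_map (\<lambda>h. Pr h Point) (\<lambda>g. g))
      (pull ((H \<boxtimes> G) \<boxtimes> (triv \<boxtimes> G)) ((H \<boxtimes> triv) \<boxtimes> G) diag_map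
        (pull ((H \<boxtimes> G) \<boxtimes> triv) ((H \<boxtimes> G) \<boxtimes> (triv \<boxtimes> G)) (prod_map (\<lambda>h. h) pfst) ?e))"
    by (subst ext_prod_pull) (simp_all add: obj homs a' unit_closed)
  also have "\<dots> = pull ((H \<boxtimes> G) \<boxtimes> triv) (H \<boxtimes> G)
      (\<lambda>p. prod_map (\<lambda>h. h) pfst (diag_map (prod_map (\<lambda>h. Pr h Point) (\<lambda>g. g) p))) ?e"
    using e by (simp add: pull_pull_pull obj homs)
  also have "\<dots> = pull ((H \<boxtimes> G) \<boxtimes> triv) (H \<boxtimes> G) (\<lambda>h. Pr h Point) ?e"
    by (subst pull_cong[of _ _ "\<lambda>h. Pr h Point"])
      (simp_all add: obj homs prod_map_def diag_map_def gprod_eta)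
  also have "\<dots> = a"
    using ext_prod_unit_pull(2) a' obj by blast
  finally show ?thesis .
qed

lemma shift_ext_prod_bilinear:
  assumes "K \<in> D" "H \<in> D"
  shows "ext_prod A\<^sub>G K H \<in> bilinear_maps R (fobj A\<^sub>G K) (fobj A\<^sub>G H) (fobj A\<^sub>G (K \<boxtimes> H))"
proof -
  have "(\<lambda>a b. pull ((K \<boxtimes> G) \<boxtimes> (H \<boxtimes> G)) ((K \<boxtimes> H) \<boxtimes> G) diag_map (ext_prod A (K \<boxtimes> G) (H \<boxtimes> G) a b))
      \<in> bilinear_maps R (fobj A (K \<boxtimes> G)) (fobj A (H \<boxtimes> G)) (fobj A ((K \<boxtimes> H) \<boxtimes> G))"
    using assms
    by (intro bilinear_maps_comp_linear[OF ext_prod_bilinear] pull_linear diag_map_hom object_simps)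
  then show ?thesis
    by (simp add: shift_def pull_def diag_biset_res)
qed

lemma shift_green: "green_biset_functor R D A\<^sub>G"
proof (intro green_biset_functor.intro green_biset_functor_axioms.intro shift_biset_functor)
  show "unit_elt A\<^sub>G \<in> carrier (fobj A\<^sub>G triv)"
    unfolding shift_simps by (intro pull_closed projection_homs unit_closed object_simps)
qed (fact shift_ext_prod_bilinear shift_assoc shift_unit_left shift_unit_right shift_functorial)+

end

section \<open>Inflation\<close>

context shifted_green_functor
begin

text \<open>For a biset \<open>X\<close> both composites are \<open>X\<close> with \<open>K \<boxtimes> G\<close> acting through \<open>K\<close>.\<close>

lemma inf_natural_kcomp:
  assumes D: "H \<in> D" "K \<in> D" and \<alpha>: "\<alpha> \<in> carrier (kburnside R K H)"
  shows "kcomp R (K \<boxtimes> G) K H (kres (K \<boxtimes> G) K pfst) \<alpha> =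
    kcomp R (K \<boxtimes> G) (H \<boxtimes> G) H (ext_id K H \<alpha>) (kres (H \<boxtimes> G) H pfst)"
    (is "?f \<alpha> = ?g \<alpha>")
proof (rule kburnside_linear_eq[OF is_cring kburnside_module[OF is_cring] _ _ _ \<alpha>, of ?f _ _ ?g])
  note obj = D object_simps
  show "?f \<in> linear_maps R (kburnside R K H) (kburnside R (K \<boxtimes> G) H)"
    by (intro bilinear_mapsD(1)[OF kcomp_bilinear] is_cring object_group obj kres_closed projection_homs)
  show "?g \<in> linear_maps R (kburnside R K H) (kburnside R (K \<boxtimes> G) H)"
    by (intro linear_maps_comp[OF ext_id_linear bilinear_mapsD(2)[OF kcomp_bilinear]]
        is_cring object_group obj kres_closed projection_homs)
  fix X :: "('a, nat) biset"
  assume X: "is_biset K H X"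
  have bis: "is_biset G G (id_biset G)" "is_biset (H \<boxtimes> G) H (res_biset H pfst)"
    by (intro id_is_biset res_is_biset finite_object obj projection_homs)+
  note [simp] = bis X biset_ext_is_biset is_cring object_group obj
  have "?g (kclass R K H X) = kclass R (K \<boxtimes> G) H
      (biset_comp (H \<boxtimes> G) (biset_ext X (id_biset G)) (inf_biset H))"
    by (simp add: ext_id_class kcomp_class inf_biset_res)
  also have "\<dots> = kclass R (K \<boxtimes> G) H (restrict_left pfst X)"
    by (intro kclass_eq biset_ext_inf_natural comp_is_biset finite_object obj)
      (simp_all add: inf_biset_res)
  also have "\<dots> = ?f (kclass R K H X)"
    by (simp add: kres_kcomp projection_homs)
  finally show "?f (kclass R K H X) = ?g (kclass R K H X)"
    by simp
qed

text \<open>Duplicating the coordinate in \<open>G\<close> and then forgetting both copies is the same as forgetting it.\<close>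

lemma inf_ext_prod:
  assumes "K \<in> D" "H \<in> D" "a \<in> carrier (fobj A K)" "b \<in> carrier (fobj A H)"
  shows "pull (K \<boxtimes> H) ((K \<boxtimes> H) \<boxtimes> G) pfst (ext_prod A K H a b) =
    ext_prod A\<^sub>G K H (pull K (K \<boxtimes> G) pfst a) (pull H (H \<boxtimes> G) pfst b)"
proof -
  note obj = assms(1,2) object_simps
  note homs = diag_map_hom prod_map_hom projection_homs
  have "ext_prod A\<^sub>G K H (pull K (K \<boxtimes> G) pfst a) (pull H (H \<boxtimes> G) pfst b) =
      pull (K \<boxtimes> H) ((K \<boxtimes> H) \<boxtimes> G) (\<lambda>p. prod_map pfst pfst (diag_map p)) (ext_prod A K H a b)"
    by (simp add: shift_simps ext_prod_pull pull_pull obj homs assms(3,4) ext_prod_closed)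
  also have "\<dots> = pull (K \<boxtimes> H) ((K \<boxtimes> H) \<boxtimes> G) pfst (ext_prod A K H a b)"
    by (subst pull_cong[of _ _ pfst]) (simp_all add: obj homs prod_map_def diag_map_def gprod_eta[OF gprod_carrier_proj(1)])
  finally show ?thesis ..
qed

end

theorem proposition4p2:
  fixes R :: "'k ring" and D :: "'a grp set"
    and A :: "('a, 'k, 'm) green_data" and G :: "'a grp"
  assumes "green_biset_functor R D A"
    and "G \<in> D"
  shows "green_biset_functor_morphism R D A (shift R A G)
           (\<lambda>H. fmor A H (H \<boxtimes> G) (kclass R (H \<boxtimes> G) H (inf_biset H)))"
proof -
  interpret shifted_green_functor R D A G
    using assms by (intro shifted_green_functor.intro shifted_green_functor_axioms.intro)
  have inf: "fmor A H (H \<boxtimes> G) (kclass R (H \<boxtimes> G) H (inf_biset H)) = pull H (H \<boxtimes> G) pfst" for H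
    by (simp add: inf_biset_res pull_def)
  show ?thesis
    unfolding inf
  proof (intro green_biset_functor_morphism.intro biset_functor_morphism.intro
      biset_functor_morphism_axioms.intro green_biset_functor_morphism_axioms.intro
      assms(1) shift_green shift_biset_functor green_biset_functor.axioms(1))
    fix H assume "H \<in> D"
    then show "pull H (H \<boxtimes> G) pfst \<in> linear_maps R (fobj A H) (fobj (shift R A G) H)"
      unfolding shift_simps by (intro pull_linear projection_homs object_simps)
  next
    fix H K \<alpha> a
    assume *: "H \<in> D" "K \<in> D" "\<alpha> \<in> carrier (kburnside R K H)" "a \<in> carrier (fobj A H)"
    have "pull K (K \<boxtimes> G) pfst (fmor A H K \<alpha> a) =
        fmor A H (K \<boxtimes> G) (kcomp R (K \<boxtimes> G) K H (kres (K \<boxtimes> G) K pfst) \<alpha>) a"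
      unfolding pull_def using *
      by (intro fmor_comp[symmetric] kres_closed projection_homs object_simps)
    also have "\<dots> = fmor A H (K \<boxtimes> G)
        (kcomp R (K \<boxtimes> G) (H \<boxtimes> G) H (ext_id K H \<alpha>) (kres (H \<boxtimes> G) H pfst)) a"
      using inf_natural_kcomp[OF *(1-3)] by simp
    also have "\<dots> = fmor (shift R A G) H K \<alpha> (pull H (H \<boxtimes> G) pfst a)"
      unfolding shift_simps pull_def using *
      by (intro fmor_comp ext_id_closed kres_closed projection_homs object_simps)
    finally show "pull K (K \<boxtimes> G) pfst (fmor A H K \<alpha> a) =
        fmor (shift R A G) H K \<alpha> (pull H (H \<boxtimes> G) pfst a)" .
  next
    show "pull triv (triv \<boxtimes> G) pfst (unit_elt A) = unit_elt (shift R A G)"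
      by (simp add: shift_simps)
  qed (fact inf_ext_prod)
qed

end
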